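(* Let $\vec u=(u,\partial_t u)$ be a packed solution of $$\partial_{tt}u+2\alpha\partial_t u-\Delta u+u-f(u)=0 .\qquad (\mathrm{DKG})$$ Then $\vec u\in\mathscr C([0,+\infty),H^1\times L^2)$ is globally defined for positive times ($T_{\max}=+\infty$). Moreover, if $(W_0,W_1)\in H^1\times L^2$ is a cluster point for $\vec u$ at $(t_n,y_n)_n$, then $W_0=q$ is a bound state (a solution $q\in H^1(\mathbb R^N)$ of $-\Delta q+q-f(q)=0$) and $W_1=0$. Furthermore, the energy $t\mapsto E(\vec u(t))$ is bounded below on $[0,+\infty)$, $\partial_t u\in L^2([0,+\infty),L^2)$, and for all $t\ge 0$, $$E(\vec u(t))-E(q,0)=2\alpha\int_t^{+\infty}\|\partial_t u(s)\|_{L^2}^2\,ds .$$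
   Context: Standing assumptions: $\alpha>0$, $2\le N\le 5$ is the space dimension, $f(u)=|u|^{p-1}u$, $F(u)=\frac1{p+1}|u|^{p+1}$, with $2<p<\infty$ if $N=2$ and $2<p<\frac{N+2}{N-2}$ if $N=3,4,5$. Functions are real-valued on $\mathbb R^N$; $H^1=H^1(\mathbb R^N)$, $L^2=L^2(\mathbb R^N)$. The Cauchy problem for (DKG) is locally well-posed in $H^1\times L^2$: for any initial data $(u_0,v_0)\in H^1\times L^2$ there is a unique (in some class) maximal solution $u\in\mathscr C([0,T_{\max}),H^1)\cap\mathscr C^1([0,T_{\max}),L^2)$, and if $T_{\max}<\infty$ then $\|\vec u(t)\|_{H^1\times L^2}\to\infty$ as $t\uparrow T_{\max}$. The energy is $$E(u,v)=\frac12\int_{\mathbb R^N}\{|\nabla u|^2+u^2+v^2-2F(u)\}\,dx,$$ and solutions satisfy $E(\vec u(t_2))-E(\vec u(t_1))=-2\alpha\int_{t_1}^{t_2}\|\partial_t u(t)\|_{L^2}^2\,dt$. A maximal solution $\vec u=(u,\partial_t u)\in\mathscr C([0,T_{\max}),H^1\times L^2)$ is a packed solution if there exist $(W_0,W_1)\in H^1\times L^2$, a sequence of times $t_n\to T_{\max}$ and a sequence $y_n\in\mathbb R^N$ such that $$\lim_{n\to\infty}\{\|u(t_n)-W_0(\cdot-y_n)\|_{H^1}+\|\partial_t u(t_n)-W_1(\cdot-y_n)\|_{L^2}\}=0;$$ then $(W_0,W_1)$ is called a cluster point for $\vec u$ at $(t_n,y_n)_n$. *)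

theory Defs
  imports "HOL-Analysis.Analysis"
begin

section \<open>Lebesgue and Sobolev spaces\<close>

text \<open>
  Elements of \<open>L\<^sup>2\<close> and \<open>H\<^sup>1\<close> are represented by Borel functions. Nothing is quotiented, so
  identities in these spaces are stated through the seminorms below or almost everywhere.
\<close>

definition L2 :: "('a::euclidean_space \<Rightarrow> 'b::euclidean_space) set" where
  "L2 = {f \<in> borel_measurable borel. integrable lborel (\<lambda>x. (norm (f x))\<^sup>2)}"

definition L2_norm :: "('a::euclidean_space \<Rightarrow> 'b::euclidean_space) \<Rightarrow> real" where
  "L2_norm f = sqrt (\<integral>x. (norm (f x))\<^sup>2 \<partial>lborel)"

primrec C_k :: "nat \<Rightarrow> ('a::euclidean_space \<Rightarrow> real) \<Rightarrow> bool" where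
  "C_k 0 f \<longleftrightarrow> continuous_on UNIV f"
| "C_k (Suc k) f \<longleftrightarrow> (\<forall>x. f differentiable (at x)) \<and>
     (\<forall>b\<in>Basis. C_k k (\<lambda>x. frechet_derivative f (at x) b))"

definition test_functions :: "('a::euclidean_space \<Rightarrow> real) set" where
  "test_functions = {\<phi>. (\<forall>k. C_k k \<phi>) \<and> compact (closure {x. \<phi> x \<noteq> 0})}"

definition is_weak_gradient :: "('a::euclidean_space \<Rightarrow> real) \<Rightarrow> ('a \<Rightarrow> 'a) \<Rightarrow> bool" where
  "is_weak_gradient w g \<longleftrightarrow> (\<forall>\<phi>\<in>test_functions. \<forall>b\<in>Basis.
     (\<integral>x. w x * frechet_derivative \<phi> (at x) b \<partial>lborel) = - (\<integral>x. (g x \<bullet> b) * \<phi> x \<partial>lborel))"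

definition H1 :: "('a::euclidean_space \<Rightarrow> real) set" where
  "H1 = {w \<in> L2. \<exists>g\<in>L2. is_weak_gradient w g}"

text \<open>The weak gradient is determined only up to a null set; any representative is chosen.\<close>

definition weak_grad :: "('a::euclidean_space \<Rightarrow> real) \<Rightarrow> 'a \<Rightarrow> 'a" where
  "weak_grad w = (SOME g. g \<in> L2 \<and> is_weak_gradient w g)"

definition H1_norm :: "('a::euclidean_space \<Rightarrow> real) \<Rightarrow> real" where
  "H1_norm w = sqrt ((L2_norm (weak_grad w))\<^sup>2 + (L2_norm w)\<^sup>2)"

definition energy_space_norm ::
    "('a::euclidean_space \<Rightarrow> real) \<Rightarrow> ('a \<Rightarrow> real) \<Rightarrow> real" where
  "energy_space_norm w z = sqrt ((H1_norm w)\<^sup>2 + (L2_norm z)\<^sup>2)"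

section \<open>The damped nonlinear Klein-Gordon equation\<close>

definition nl :: "real \<Rightarrow> real \<Rightarrow> real" where
  "nl p s = \<bar>s\<bar> powr (p - 1) * s"

definition NL :: "real \<Rightarrow> real \<Rightarrow> real" where
  "NL p s = \<bar>s\<bar> powr (p + 1) / (p + 1)"

definition energy :: "real \<Rightarrow> ('a::euclidean_space \<Rightarrow> real) \<Rightarrow> ('a \<Rightarrow> real) \<Rightarrow> real" where
  "energy p w z =
     1/2 * (\<integral>x. (norm (weak_grad w x))\<^sup>2 + (w x)\<^sup>2 + (z x)\<^sup>2 - 2 * NL p (w x) \<partial>lborel)"

definition energy_subcritical :: "nat \<Rightarrow> real \<Rightarrow> bool" where
  "energy_subcritical N p \<longleftrightarrow> 2 < p \<and> (3 \<le> N \<longrightarrow> p < (real N + 2) / (real N - 2))"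

text \<open>The pairing \<open>\<integral> \<nabla>w \<cdot> \<nabla>\<phi>\<close>: the derivative of \<open>\<phi>\<close> at \<open>x\<close> in direction \<open>\<nabla>w x\<close> is
  \<open>\<nabla>w x \<cdot> \<nabla>\<phi> x\<close>.\<close>

definition grad_pairing :: "('a::euclidean_space \<Rightarrow> real) \<Rightarrow> ('a \<Rightarrow> real) \<Rightarrow> real" where
  "grad_pairing w \<phi> = (\<integral>x. frechet_derivative \<phi> (at x) (weak_grad w x) \<partial>lborel)"

definition bound_state :: "real \<Rightarrow> ('a::euclidean_space \<Rightarrow> real) \<Rightarrow> bool" where
  "bound_state p q \<longleftrightarrow> q \<in> H1 \<and> (\<forall>\<phi>\<in>test_functions.
     grad_pairing q \<phi> + (\<integral>x. q x * \<phi> x \<partial>lborel) - (\<integral>x. nl p (q x) * \<phi> x \<partial>lborel) = 0)"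

definition time_interval :: "ereal \<Rightarrow> real set" where
  "time_interval T = {t. 0 \<le> t \<and> ereal t < T}"

definition continuous_in_H1_L2 ::
    "real set \<Rightarrow> (real \<Rightarrow> 'a::euclidean_space \<Rightarrow> real) \<Rightarrow> (real \<Rightarrow> 'a \<Rightarrow> real) \<Rightarrow> bool" where
  "continuous_in_H1_L2 I u v \<longleftrightarrow> (\<forall>t\<in>I. u t \<in> H1 \<and> v t \<in> L2 \<and>
     ((\<lambda>s. energy_space_norm (\<lambda>x. u s x - u t x) (\<lambda>x. v s x - v t x)) \<longlongrightarrow> 0) (at t within I))"

definition has_L2_time_derivative ::
    "real set \<Rightarrow> (real \<Rightarrow> 'a::euclidean_space \<Rightarrow> real) \<Rightarrow> (real \<Rightarrow> 'a \<Rightarrow> real) \<Rightarrow> bool" where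
  "has_L2_time_derivative I u v \<longleftrightarrow> (\<forall>t\<in>I.
     ((\<lambda>s. L2_norm (\<lambda>x. (u s x - u t x) / (s - t) - v t x)) \<longlongrightarrow> 0) (at t within I))"

text \<open>
  The pair \<open>(u, v)\<close> with \<open>v = \<partial>\<^sub>t u\<close> solves the equation on \<open>[0, T)\<close>: \<open>u\<close> belongs to
  \<open>C([0,T), H\<^sup>1) \<inter> C\<^sup>1([0,T), L\<^sup>2)\<close> and, at each time, the equation for \<open>\<partial>\<^sub>t v\<close> holds in the
  sense of distributions on the space \<open>'a\<close>. All its other terms are then continuous in time with
  values in the dual of \<open>H\<^sup>1\<close>.
\<close>

definition DKG_solution ::
    "real \<Rightarrow> real \<Rightarrow> ereal \<Rightarrow> (real \<Rightarrow> 'a::euclidean_space \<Rightarrow> real) \<Rightarrow> (real \<Rightarrow> 'a \<Rightarrow> real) \<Rightarrow> bool" where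
  "DKG_solution \<alpha> p T u v \<longleftrightarrow>
     0 < T \<and>
     continuous_in_H1_L2 (time_interval T) u v \<and>
     has_L2_time_derivative (time_interval T) u v \<and>
     (\<forall>\<phi>\<in>test_functions. \<forall>t\<in>time_interval T.
       ((\<lambda>s. \<integral>x. v s x * \<phi> x \<partial>lborel) has_real_derivative
          (- 2 * \<alpha> * (\<integral>x. v t x * \<phi> x \<partial>lborel) - grad_pairing (u t) \<phi>
           - (\<integral>x. u t x * \<phi> x \<partial>lborel) + (\<integral>x. nl p (u t x) * \<phi> x \<partial>lborel)))
         (at t within time_interval T))"

text \<open>
  The Cauchy theory is relative to a class \<open>X\<close> of functions in which uniqueness holds (typically
  an auxiliary space-time integrability condition): \<open>X T\<close> contains the functions on \<open>[0, T)\<close> that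
  are in the class.
\<close>

type_synonym 'a solution_class = "ereal \<Rightarrow> (real \<Rightarrow> 'a \<Rightarrow> real) set"

definition DKG_maximal_solution ::
    "real \<Rightarrow> real \<Rightarrow> 'a::euclidean_space solution_class \<Rightarrow>
     ereal \<Rightarrow> (real \<Rightarrow> 'a \<Rightarrow> real) \<Rightarrow> (real \<Rightarrow> 'a \<Rightarrow> real) \<Rightarrow> bool" where
  "DKG_maximal_solution \<alpha> p X T u v \<longleftrightarrow>
     DKG_solution \<alpha> p T u v \<and> u \<in> X T \<and>
     \<not> (\<exists>T' u' v'. T < T' \<and> DKG_solution \<alpha> p T' u' v' \<and> u' \<in> X T' \<and>
          (\<forall>t\<in>time_interval T. AE x in lborel. u' t x = u t x))"

definition has_initial_data ::
    "(real \<Rightarrow> 'a::euclidean_space \<Rightarrow> real) \<Rightarrow> (real \<Rightarrow> 'a \<Rightarrow> real) \<Rightarrow>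
     ('a \<Rightarrow> real) \<Rightarrow> ('a \<Rightarrow> real) \<Rightarrow> bool" where
  "has_initial_data u v u0 v0 \<longleftrightarrow> (AE x in lborel. u 0 x = u0 x \<and> v 0 x = v0 x)"

definition DKG_locally_well_posed ::
    "real \<Rightarrow> real \<Rightarrow> 'a::euclidean_space solution_class \<Rightarrow> bool" where
  "DKG_locally_well_posed \<alpha> p X \<longleftrightarrow>
     (\<forall>u0\<in>H1. \<forall>v0\<in>L2.
        (\<exists>T u v. DKG_maximal_solution \<alpha> p X T u v \<and> has_initial_data u v u0 v0) \<and>
        (\<forall>T u v T' u' v'.
           DKG_maximal_solution \<alpha> p X T u v \<longrightarrow> has_initial_data u v u0 v0 \<longrightarrow>
           DKG_maximal_solution \<alpha> p X T' u' v' \<longrightarrow> has_initial_data u' v' u0 v0 \<longrightarrow>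
           T = T' \<and> (\<forall>t\<in>time_interval T. AE x in lborel. u t x = u' t x \<and> v t x = v' t x))) \<and>
     (\<forall>r u v. DKG_maximal_solution \<alpha> p X (ereal r) u v \<longrightarrow>
        filterlim (\<lambda>t. energy_space_norm (u t) (v t)) at_top (at_left r))"

definition DKG_energy_identity ::
    "real \<Rightarrow> real \<Rightarrow> 'a::euclidean_space solution_class \<Rightarrow> bool" where
  "DKG_energy_identity \<alpha> p X \<longleftrightarrow>
     (\<forall>T u v. DKG_solution \<alpha> p T u v \<longrightarrow> u \<in> X T \<longrightarrow>
       (\<forall>t1\<in>time_interval T. \<forall>t2\<in>time_interval T. t1 \<le> t2 \<longrightarrow>
          energy p (u t2) (v t2) - energy p (u t1) (v t1)
            = - 2 * \<alpha> * (LBINT t:{t1..t2}. (L2_norm (v t))\<^sup>2)))"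

section \<open>Packed solutions\<close>

definition cluster_point ::
    "ereal \<Rightarrow> (real \<Rightarrow> 'a::euclidean_space \<Rightarrow> real) \<Rightarrow> (real \<Rightarrow> 'a \<Rightarrow> real) \<Rightarrow>
     ('a \<Rightarrow> real) \<Rightarrow> ('a \<Rightarrow> real) \<Rightarrow> (nat \<Rightarrow> real) \<Rightarrow> (nat \<Rightarrow> 'a) \<Rightarrow> bool" where
  "cluster_point T u v W0 W1 t y \<longleftrightarrow>
     W0 \<in> H1 \<and> W1 \<in> L2 \<and>
     (\<forall>n. t n \<in> time_interval T) \<and> (\<lambda>n. ereal (t n)) \<longlonglongrightarrow> T \<and>
     (\<lambda>n. H1_norm (\<lambda>x. u (t n) x - W0 (x - y n)) + L2_norm (\<lambda>x. v (t n) x - W1 (x - y n)))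
       \<longlonglongrightarrow> 0"

definition packed_solution ::
    "real \<Rightarrow> real \<Rightarrow> 'a::euclidean_space solution_class \<Rightarrow>
     ereal \<Rightarrow> (real \<Rightarrow> 'a \<Rightarrow> real) \<Rightarrow> (real \<Rightarrow> 'a \<Rightarrow> real) \<Rightarrow> bool" where
  "packed_solution \<alpha> p X T u v \<longleftrightarrow>
     DKG_maximal_solution \<alpha> p X T u v \<and> (\<exists>W0 W1 t y. cluster_point T u v W0 W1 t y)"

end

theory Submission
  imports Defs "HOL-Real_Asymp.Real_Asymp"
begin

text \<open>
  Translations preserve the energy norm, so a packed solution is bounded along \<open>t\<^sub>n\<close> and cannot blow up; its
  energy decreases to that of the cluster point, which makes the dissipation integrable. No continuous
  dependence on the data is needed to identify the cluster point: on \<open>[t\<^sub>n, t\<^sub>n + 1]\<close> the vanishing dissipation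
  keeps \<open>u\<close> close to \<open>u(t\<^sub>n)\<close> in \<open>L\<^sup>2\<close>, and the energy identity together with the compactness of the potential
  energy (subcriticality) keeps it bounded in \<open>H\<^sup>1\<close>. Hence all terms of the equation tested against a
  translated test function converge uniformly on that interval, and integrating twice in time shows that
  \<open>\<sigma> \<integral> W\<^sub>1 \<phi> - \<sigma>\<^sup>2 / 2 \<langle>- \<Delta> W\<^sub>0 + W\<^sub>0 - f(W\<^sub>0), \<phi>\<rangle>\<close> vanishes for \<open>0 \<le> \<sigma> \<le> 1\<close>.

  The subcritical embedding \<open>H\<^sup>1 \<subseteq> L\<^sup>q\<close> comes from \<open>\<parallel>w(\<cdot> + h) - w\<parallel> \<le> |h| \<parallel>\<nabla>w\<parallel>\<close> alone: averages over cubes of side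
  \<open>2\<^bsup>-k\<^esup>\<close> are \<open>O(2\<^bsup>-k\<^esup>)\<close>-close to \<open>w\<close> in \<open>L\<^sup>2\<close> and grow in sup norm at most like \<open>2\<^bsup>k(N/2-1)\<^esup>\<close> (up to an
  arbitrarily small power if \<open>N = 2\<close>).
\<close>

section \<open>Function spaces: L2, translations, test functions, weak gradients\<close>

section \<open>Square-integrable functions\<close>

text \<open>The well-posedness hypothesis gives existence, uniqueness and blow-up only, so the flow
  started at \<open>(W0, W1)\<close> cannot be compared with \<open>u\<close> after
  \<open>\<tau> n\<close>. On \<open>[\<tau> n, \<tau> n + 1]\<close> one knows L2-closeness and an
  H1 bound for \<open>u\<close>, while closeness of \<open>v\<close> to its limit profile is known
  only at the left endpoint. Two time integrations leave just \<open>u\<close> and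
  \<open>v (\<tau> n)\<close>; the damping term is already small after one of them. Two values of
  the resulting parabola determine both coefficients. L2-closeness must therefore suffice for every
  term: both derivatives of the Laplacian go onto the test function, and for the nonlinear terms
  smallness in L2 is interpolated against a bound in a slightly higher Lebesgue exponent. Since the
  profile drifts with \<open>y n\<close>, the moduli of continuity have to be uniform over
  translations. In the embedding, cubes of side \<open>(1/2)^k\<close> contribute a multiple of
  \<open>(r powr (q - 2) / 4) ^ k\<close>, where r is the growth factor of the averages. With r
  close to \<open>2 powr (N/2 - 1)\<close> this is summable, for N at least 3, precisely when
  \<open>q < 2N/(N-2)\<close>.\<close>

lemma L2_measurable [measurable_dest]: "f \<in> L2 \<Longrightarrow> f \<in> borel_measurable borel"
  by (simp add: L2_def)

lemma L2_integrable_power2: "f \<in> L2 \<Longrightarrow> integrable lborel (\<lambda>x. (norm (f x))\<^sup>2)"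
  by (simp add: L2_def)

lemma L2_norm_nonneg [simp]: "0 \<le> L2_norm f"
  by (simp add: L2_norm_def)

lemma L2_norm_power2: "(L2_norm f)\<^sup>2 = (\<integral>x. (norm (f x))\<^sup>2 \<partial>lborel)"
  by (simp add: L2_norm_def)

lemma L2_norm_cong_AE:
  assumes "AE x in lborel. norm (f x) = norm (g x)" "f \<in> borel_measurable borel" "g \<in> borel_measurable borel"
  shows "L2_norm f = L2_norm g"
  unfolding L2_norm_def using assms by (intro arg_cong[where f=sqrt] integral_cong_AE) auto

lemma L2_bound:
  assumes "f \<in> borel_measurable borel" "g \<in> L2" "\<And>x. norm (f x) \<le> c * norm (g x)"
  shows "f \<in> L2"
proof -
  have [measurable]: "f \<in> borel_measurable borel" "g \<in> borel_measurable borel"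
    using assms by auto
  have "integrable lborel (\<lambda>x. (norm (f x))\<^sup>2)"
  proof (rule Bochner_Integration.integrable_bound)
    show "integrable lborel (\<lambda>x. c\<^sup>2 * (norm (g x))\<^sup>2)"
      using L2_integrable_power2[OF assms(2)] by simp
    show "AE x in lborel. norm ((norm (f x))\<^sup>2) \<le> norm (c\<^sup>2 * (norm (g x))\<^sup>2)"
      using power_mono[OF assms(3) norm_ge_zero, of _ 2] by (simp add: power_mult_distrib)
  qed auto
  then show ?thesis using assms(1) by (simp add: L2_def)
qed

lemma L2_scaleR: "f \<in> L2 \<Longrightarrow> (\<lambda>x. c *\<^sub>R f x) \<in> L2"
  by (rule L2_bound[where c="\<bar>c\<bar>" and g=f]) auto

lemma L2_add:
  fixes f g :: "'a::euclidean_space \<Rightarrow> 'b::euclidean_space"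
  assumes "f \<in> L2" "g \<in> L2"
  shows "(\<lambda>x. f x + g x) \<in> L2"
proof -
  have [measurable]: "f \<in> borel_measurable borel" "g \<in> borel_measurable borel"
    using assms by auto
  have "integrable lborel (\<lambda>x. (norm (f x + g x))\<^sup>2)"
  proof (rule Bochner_Integration.integrable_bound)
    show "integrable lborel (\<lambda>x. 2 * (norm (f x))\<^sup>2 + 2 * (norm (g x))\<^sup>2)"
      by (intro Bochner_Integration.integrable_add integrable_mult_right L2_integrable_power2 assms)
    have "(norm (f x + g x))\<^sup>2 \<le> 2 * (norm (f x))\<^sup>2 + 2 * (norm (g x))\<^sup>2" for x
    proof -
      have "(norm (f x + g x))\<^sup>2 \<le> (norm (f x) + norm (g x))\<^sup>2"
        by (intro power_mono norm_triangle_ineq norm_ge_zero)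
      also have "\<dots> \<le> 2 * (norm (f x))\<^sup>2 + 2 * (norm (g x))\<^sup>2"
        using sum_squares_bound[of "norm (f x)" "norm (g x)"] by (simp add: power2_sum)
      finally show ?thesis .
    qed
    then show "AE x in lborel. norm ((norm (f x + g x))\<^sup>2) \<le> norm (2 * (norm (f x))\<^sup>2 + 2 * (norm (g x))\<^sup>2)"
      by simp
  qed auto
  then show ?thesis by (simp add: L2_def)
qed

lemma L2_uminus: "f \<in> L2 \<Longrightarrow> (\<lambda>x. - f x) \<in> L2"
  by (rule L2_bound[where c=1 and g=f]) auto

lemma L2_diff: "f \<in> L2 \<Longrightarrow> g \<in> L2 \<Longrightarrow> (\<lambda>x. f x - g x) \<in> L2"
  using L2_add[of f "\<lambda>x. - g x"] L2_uminus[of g] by simp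

lemma L2_zero: "(\<lambda>x. 0) \<in> L2"
  by (simp add: L2_def)

lemma L2_norm_zero [simp]: "L2_norm (\<lambda>x. 0) = 0"
  by (simp add: L2_norm_def)

lemma L2_norm_scaleR: "L2_norm (\<lambda>x. c *\<^sub>R f x) = \<bar>c\<bar> * L2_norm f"
  by (simp add: L2_norm_def power_mult_distrib real_sqrt_mult)

lemma L2_norm_minus_commute: "L2_norm (\<lambda>x. f x - g x) = L2_norm (\<lambda>x. g x - f x)"
  by (simp add: L2_norm_def norm_minus_commute)

lemma L2_inner_right: "f \<in> L2 \<Longrightarrow> (\<lambda>x. f x \<bullet> h) \<in> L2"
  by (rule L2_bound[where c="norm h" and g=f]) (auto simp: mult.commute[of "norm h"] Cauchy_Schwarz_ineq2)

lemma integrable_L2_mult_norm: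
  fixes f :: "'a::euclidean_space \<Rightarrow> 'b::euclidean_space" and g :: "'a \<Rightarrow> 'c::euclidean_space"
  assumes "f \<in> L2" "g \<in> L2"
  shows "integrable lborel (\<lambda>x. norm (f x) * norm (g x))"
    and "(\<integral>x. norm (f x) * norm (g x) \<partial>lborel) \<le> L2_norm f * L2_norm g"
proof -
  have [measurable]: "f \<in> borel_measurable borel" "g \<in> borel_measurable borel"
    using assms by auto
  show int: "integrable lborel (\<lambda>x. norm (f x) * norm (g x))"
  proof (rule Bochner_Integration.integrable_bound)
    show "integrable lborel (\<lambda>x. (norm (f x))\<^sup>2 + (norm (g x))\<^sup>2)"
      by (intro Bochner_Integration.integrable_add integrable_mult_right L2_integrable_power2 assms)
    have "norm (f x) * norm (g x) \<le> (norm (f x))\<^sup>2 + (norm (g x))\<^sup>2" for x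
      using sum_squares_bound[of "norm (f x)" "norm (g x)"]
        mult_nonneg_nonneg[OF norm_ge_zero[of "f x"] norm_ge_zero[of "g x"]]
      unfolding mult.assoc by linarith
    then show "AE x in lborel. norm (norm (f x) * norm (g x)) \<le> norm ((norm (f x))\<^sup>2 + (norm (g x))\<^sup>2)"
      by simp
  qed auto
  have "ennreal ((\<integral>x. norm (f x) * norm (g x) \<partial>lborel)\<^sup>2)
      = (\<integral>\<^sup>+x. ennreal (norm (f x)) * ennreal (norm (g x)) \<partial>lborel)\<^sup>2"
    using int by (simp add: ennreal_power nn_integral_eq_integral flip: ennreal_mult')
  also have "\<dots> \<le> (\<integral>\<^sup>+x. (ennreal (norm (f x)))\<^sup>2 \<partial>lborel) * (\<integral>\<^sup>+x. (ennreal (norm (g x)))\<^sup>2 \<partial>lborel)"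
    by (rule Cauchy_Schwarz_nn_integral) auto
  also have "\<dots> = ennreal ((L2_norm f * L2_norm g)\<^sup>2)"
    using assms by (simp add: ennreal_power nn_integral_eq_integral L2_integrable_power2
        L2_norm_power2 power_mult_distrib ennreal_mult)
  finally have "(\<integral>x. norm (f x) * norm (g x) \<partial>lborel)\<^sup>2 \<le> (L2_norm f * L2_norm g)\<^sup>2"
    by (subst (asm) ennreal_le_iff) auto
  then show "(\<integral>x. norm (f x) * norm (g x) \<partial>lborel) \<le> L2_norm f * L2_norm g"
    by (rule power2_le_imp_le) simp
qed

lemma integrable_L2_inner:
  fixes f g :: "'a::euclidean_space \<Rightarrow> 'b::euclidean_space"
  assumes "f \<in> L2" "g \<in> L2"
  shows "integrable lborel (\<lambda>x. f x \<bullet> g x)"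
  using integrable_L2_mult_norm(1)[OF assms] assms
  by (intro Bochner_Integration.integrable_bound[OF integrable_L2_mult_norm(1)[OF assms]])
     (auto simp: Cauchy_Schwarz_ineq2)

lemma L2_Cauchy_Schwarz:
  fixes f g :: "'a::euclidean_space \<Rightarrow> 'b::euclidean_space"
  assumes "f \<in> L2" "g \<in> L2"
  shows "\<bar>\<integral>x. f x \<bullet> g x \<partial>lborel\<bar> \<le> L2_norm f * L2_norm g"
proof -
  have "\<bar>\<integral>x. f x \<bullet> g x \<partial>lborel\<bar> \<le> (\<integral>x. norm (f x \<bullet> g x) \<partial>lborel)"
    using integral_norm_bound[of lborel "\<lambda>x. f x \<bullet> g x"] by simp
  also have "\<dots> \<le> (\<integral>x. norm (f x) * norm (g x) \<partial>lborel)"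
    by (intro integral_mono integrable_norm integrable_L2_inner integrable_L2_mult_norm assms)
       (simp add: Cauchy_Schwarz_ineq2)
  also have "\<dots> \<le> L2_norm f * L2_norm g" by (rule integrable_L2_mult_norm[OF assms])
  finally show ?thesis .
qed

lemma integrable_L2_mult:
  fixes f g :: "'a::euclidean_space \<Rightarrow> real"
  assumes "f \<in> L2" "g \<in> L2"
  shows "integrable lborel (\<lambda>x. f x * g x)"
  using integrable_L2_inner[OF assms] by simp

lemma L2_Cauchy_Schwarz_real:
  fixes f g :: "'a::euclidean_space \<Rightarrow> real"
  assumes "f \<in> L2" "g \<in> L2"
  shows "\<bar>\<integral>x. f x * g x \<partial>lborel\<bar> \<le> L2_norm f * L2_norm g"
  using L2_Cauchy_Schwarz[OF assms] by simp

lemma L2_norm_triangle: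
  fixes f g :: "'a::euclidean_space \<Rightarrow> 'b::euclidean_space"
  assumes "f \<in> L2" "g \<in> L2"
  shows "L2_norm (\<lambda>x. f x + g x) \<le> L2_norm f + L2_norm g"
proof -
  have "(L2_norm (\<lambda>x. f x + g x))\<^sup>2 = (\<integral>x. (norm (f x))\<^sup>2 + (norm (g x))\<^sup>2 + 2 * (f x \<bullet> g x) \<partial>lborel)"
    unfolding L2_norm_power2
    by (intro Bochner_Integration.integral_cong refl)
       (simp add: power2_norm_eq_inner inner_add_left inner_add_right inner_commute)
  also have "\<dots> = (L2_norm f)\<^sup>2 + (L2_norm g)\<^sup>2 + 2 * (\<integral>x. f x \<bullet> g x \<partial>lborel)"
    using assms by (simp add: L2_integrable_power2 L2_norm_power2 integrable_L2_inner)
  also have "\<dots> \<le> (L2_norm f + L2_norm g)\<^sup>2"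
    using L2_Cauchy_Schwarz[OF assms] by (simp add: power2_sum)
  finally show ?thesis by (rule power2_le_imp_le) simp
qed

lemma L2_norm_diff_triangle:
  fixes f g h :: "'a::euclidean_space \<Rightarrow> 'b::euclidean_space"
  assumes "f \<in> L2" "g \<in> L2" "h \<in> L2"
  shows "L2_norm (\<lambda>x. f x - h x) \<le> L2_norm (\<lambda>x. f x - g x) + L2_norm (\<lambda>x. g x - h x)"
  using L2_norm_triangle[of "\<lambda>x. f x - g x" "\<lambda>x. g x - h x"] assms by (simp add: L2_diff)

lemma L2_norm_le_diff:
  fixes f g :: "'a::euclidean_space \<Rightarrow> 'b::euclidean_space"
  assumes "f \<in> L2" "g \<in> L2"
  shows "L2_norm f \<le> L2_norm g + L2_norm (\<lambda>x. f x - g x)"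
  using L2_norm_triangle[of g "\<lambda>x. f x - g x"] assms by (simp add: L2_diff)

lemma nn_integral_L2:
  assumes "f \<in> L2"
  shows "(\<integral>\<^sup>+x. ennreal ((norm (f x))\<^sup>2) \<partial>lborel) = ennreal ((L2_norm f)\<^sup>2)"
  using assms by (simp add: nn_integral_eq_integral L2_integrable_power2 L2_norm_power2)

lemma L2I_nn_integral:
  assumes "f \<in> borel_measurable borel"
    and "(\<integral>\<^sup>+x. ennreal ((norm (f x))\<^sup>2) \<partial>lborel) \<le> ennreal (c\<^sup>2)" "0 \<le> c"
  shows "f \<in> L2" "L2_norm f \<le> c"
proof -
  have [measurable]: "f \<in> borel_measurable borel" by fact
  have "integrable lborel (\<lambda>x. (norm (f x))\<^sup>2)"
    using assms(2) by (intro integrableI_bounded) (auto simp: less_top[symmetric] top_unique)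
  then show "f \<in> L2" by (simp add: L2_def)
  from nn_integral_L2[OF this] assms(2) have "(L2_norm f)\<^sup>2 \<le> c\<^sup>2" by simp
  then show "L2_norm f \<le> c" using assms(3) by (rule power2_le_imp_le)
qed

section \<open>Translations\<close>

lemma lborel_distr_translation: "distr lborel borel (\<lambda>x. x + c) = (lborel :: 'a::euclidean_space measure)"
proof -
  have "(\<lambda>x. x + c) = (+) c" by (simp add: fun_eq_iff add.commute)
  then show ?thesis using lborel_distr_plus[of c] by simp
qed

lemma integral_lborel_translation:
  fixes f :: "'a::euclidean_space \<Rightarrow> 'b::{banach, second_countable_topology}"
  assumes [measurable]: "f \<in> borel_measurable borel"
  shows "(\<integral>x. f (x + c) \<partial>lborel) = (\<integral>x. f x \<partial>lborel)"
  by (subst (2) lborel_distr_translation[of c, symmetric], subst integral_distr) auto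

lemma integrable_lborel_translation:
  fixes f :: "'a::euclidean_space \<Rightarrow> 'b::{banach, second_countable_topology}"
  assumes "integrable lborel f"
  shows "integrable lborel (\<lambda>x. f (x + c))"
  using assms by (subst (asm) lborel_distr_translation[of c, symmetric], subst (asm) integrable_distr_eq) auto

lemma nn_integral_lborel_translation:
  fixes f :: "'a::euclidean_space \<Rightarrow> ennreal"
  assumes [measurable]: "f \<in> borel_measurable borel"
  shows "(\<integral>\<^sup>+x. f (x + c) \<partial>lborel) = (\<integral>\<^sup>+x. f x \<partial>lborel)"
  by (subst (2) lborel_distr_translation[of c, symmetric], subst nn_integral_distr) auto

lemma L2_translation: "f \<in> L2 \<Longrightarrow> (\<lambda>x. f (x + c)) \<in> L2"
  unfolding L2_def using integrable_lborel_translation[of "\<lambda>x. (norm (f x))\<^sup>2" c] by auto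

lemma L2_norm_translation:
  "f \<in> borel_measurable borel \<Longrightarrow> L2_norm (\<lambda>x. f (x + c)) = L2_norm f"
  unfolding L2_norm_def by (subst integral_lborel_translation[of "\<lambda>x. (norm (f x))\<^sup>2" c]) auto


section \<open>Test functions\<close>

lemma differentiable_imp_has_derivative:
  "f differentiable (at x) \<Longrightarrow> (f has_derivative frechet_derivative f (at x)) (at x)"
  using frechet_derivative_works by blast

lemma C_k_continuous: "C_k k f \<Longrightarrow> continuous_on UNIV f"
  by (cases k) (auto intro!: differentiable_imp_continuous_on simp: differentiable_on_def)

lemma C_k_Suc: "C_k (Suc k) f \<Longrightarrow> C_k k f"
proof (induction k arbitrary: f)
  case 0
  then show ?case using C_k_continuous by (simp only: C_k.simps(1))
next
  case (Suc k)
  then show ?case by (auto simp del: C_k.simps simp: C_k.simps(2)[of "Suc k"] C_k.simps(2)[of k f])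
qed

lemma C_k_const: "C_k k (\<lambda>x. c)"
  by (induction k arbitrary: c) (simp_all add: frechet_derivative_const)

lemma C_k_add: "C_k k f \<Longrightarrow> C_k k g \<Longrightarrow> C_k k (\<lambda>x. f x + g x)"
proof (induction k arbitrary: f g)
  case 0
  then show ?case by (auto intro: continuous_intros)
next
  case (Suc k)
  have "frechet_derivative (\<lambda>x. f x + g x) (at x) b
      = frechet_derivative f (at x) b + frechet_derivative g (at x) b" for x b
    using Suc.prems by (subst frechet_derivative_at[symmetric, OF has_derivative_add[OF
       differentiable_imp_has_derivative differentiable_imp_has_derivative]]) auto
  then show ?case using Suc by (auto intro: differentiable_add)
qed

lemma C_k_mult: "C_k k f \<Longrightarrow> C_k k g \<Longrightarrow> C_k k (\<lambda>x. f x * g x)"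
proof (induction k arbitrary: f g)
  case 0
  then show ?case by (auto intro: continuous_intros)
next
  case (Suc k)
  have "frechet_derivative (\<lambda>x. f x * g x) (at x) b
      = f x * frechet_derivative g (at x) b + frechet_derivative f (at x) b * g x" for x b
    using Suc.prems by (subst frechet_derivative_at[symmetric, OF has_derivative_mult[OF
       differentiable_imp_has_derivative differentiable_imp_has_derivative]]) auto
  moreover have "C_k k f" "C_k k g" using Suc.prems C_k_Suc by blast+
  ultimately show ?case using Suc by (auto intro!: differentiable_mult C_k_add)
qed

lemma C_k_prod:
  assumes "finite A" "\<And>b. b \<in> A \<Longrightarrow> C_k k (f b)"
  shows "C_k k (\<lambda>x. \<Prod>b\<in>A. f b x)"
  using assms by (induction A rule: finite_induct) (auto simp: C_k_const intro!: C_k_mult)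

lemma frechet_derivative_translation:
  fixes f :: "'a::real_normed_vector \<Rightarrow> 'b::real_normed_vector"
  assumes "f differentiable (at (x + c))"
  shows "frechet_derivative (\<lambda>x. f (x + c)) (at x) = frechet_derivative f (at (x + c))"
    and "(\<lambda>x. f (x + c)) differentiable (at x)"
proof -
  have "((\<lambda>x. x + c) has_derivative (\<lambda>h. h)) (at x)"
    by (auto intro!: derivative_eq_intros)
  from diff_chain_at[OF this differentiable_imp_has_derivative[OF assms]]
  have "((\<lambda>x. f (x + c)) has_derivative frechet_derivative f (at (x + c))) (at x)"
    by (simp add: o_def)
  then show "frechet_derivative (\<lambda>x. f (x + c)) (at x) = frechet_derivative f (at (x + c))"
    and "(\<lambda>x. f (x + c)) differentiable (at x)"
    using frechet_derivative_at by (metis, auto simp: differentiable_def)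
qed

lemma C_k_translation: "C_k k f \<Longrightarrow> C_k k (\<lambda>x. f (x + c))"
proof (induction k arbitrary: f)
  case 0
  then show ?case by (auto intro!: continuous_on_compose2[of UNIV f] continuous_intros)
next
  case (Suc k)
  have "C_k k (\<lambda>x. frechet_derivative f (at (x + c)) b)" if "b \<in> Basis" for b
    using Suc.prems that by (intro Suc.IH) auto
  then show ?case using Suc.prems by (simp add: frechet_derivative_translation)
qed

lemma test_function_C_k: "\<phi> \<in> test_functions \<Longrightarrow> C_k k \<phi>"
  by (simp add: test_functions_def)

lemma test_function_differentiable: "\<phi> \<in> test_functions \<Longrightarrow> \<phi> differentiable (at x)"
  using test_function_C_k[of \<phi> 1] by simp

lemma test_function_continuous: "\<phi> \<in> test_functions \<Longrightarrow> continuous_on UNIV \<phi>"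
  using test_function_C_k[of \<phi> 0] by simp

lemma test_function_measurable [measurable_dest]: "\<phi> \<in> test_functions \<Longrightarrow> \<phi> \<in> borel_measurable borel"
  using borel_measurable_continuous_onI test_function_continuous by blast

lemma test_function_derivative:
  fixes \<phi> :: "'a::euclidean_space \<Rightarrow> real"
  assumes "\<phi> \<in> test_functions" "b \<in> Basis"
  shows "(\<lambda>x. frechet_derivative \<phi> (at x) b) \<in> test_functions"
proof -
  have "frechet_derivative \<phi> (at x) b = 0" if "x \<notin> closure {x. \<phi> x \<noteq> 0}" for x
  proof -
    have "((\<lambda>x. 0) has_derivative frechet_derivative \<phi> (at x)) (at x)"
    proof (rule has_derivative_transform_within_open)
      show "(\<phi> has_derivative frechet_derivative \<phi> (at x)) (at x)"
        using assms(1) test_function_differentiable differentiable_imp_has_derivative by blast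
      show "open (- closure {x. \<phi> x \<noteq> 0})" "x \<in> - closure {x. \<phi> x \<noteq> 0}" using that by auto
      show "\<phi> y = 0" if "y \<in> - closure {x. \<phi> x \<noteq> 0}" for y
        using that subsetD[OF closure_subset, of y "{x. \<phi> x \<noteq> 0}"] by auto
    qed
    then have "frechet_derivative \<phi> (at x) = (\<lambda>h. 0)"
      using has_derivative_const has_derivative_unique by blast
    then show ?thesis by simp
  qed
  then have "{x. frechet_derivative \<phi> (at x) b \<noteq> 0} \<subseteq> closure {x. \<phi> x \<noteq> 0}" by blast
  then have "closure {x. frechet_derivative \<phi> (at x) b \<noteq> 0} \<subseteq> closure {x. \<phi> x \<noteq> 0}"
    by (simp add: closure_minimal)
  then have "closure {x. \<phi> x \<noteq> 0} \<inter> closure {x. frechet_derivative \<phi> (at x) b \<noteq> 0}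
      = closure {x. frechet_derivative \<phi> (at x) b \<noteq> 0}"
    by (rule Int_absorb1)
  moreover have "compact (closure {x. \<phi> x \<noteq> 0} \<inter> closure {x. frechet_derivative \<phi> (at x) b \<noteq> 0})"
    using assms(1) by (intro compact_Int_closed) (simp_all add: test_functions_def)
  moreover have "C_k k (\<lambda>x. frechet_derivative \<phi> (at x) b)" for k
    using test_function_C_k[OF assms(1), of "Suc k"] assms(2) by simp
  ultimately show ?thesis unfolding test_functions_def by simp
qed

lemma test_function_translation:
  fixes \<phi> :: "'a::euclidean_space \<Rightarrow> real"
  assumes "\<phi> \<in> test_functions"
  shows "(\<lambda>x. \<phi> (x + c)) \<in> test_functions"
proof -
  have "{x. \<phi> (x + c) \<noteq> 0} = (+) (- c) ` {x. \<phi> x \<noteq> 0}"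
    by (force simp: image_iff)
  then have "closure {x. \<phi> (x + c) \<noteq> 0} = (+) (- c) ` closure {x. \<phi> x \<noteq> 0}"
    by (simp only: closure_translation)
  then have "compact (closure {x. \<phi> (x + c) \<noteq> 0})"
    using assms compact_translation[of "closure {x. \<phi> x \<noteq> 0}" "- c"]
    by (simp only: test_functions_def mem_Collect_eq)
  then show ?thesis using assms C_k_translation by (auto simp: test_functions_def)
qed

lemma test_function_bounded:
  fixes \<phi> :: "'a::euclidean_space \<Rightarrow> real"
  assumes "\<phi> \<in> test_functions"
  obtains B R where "0 < B" "0 < R" "\<And>x. \<bar>\<phi> x\<bar> \<le> B" "\<And>x. R < norm x \<Longrightarrow> \<phi> x = 0"
proof -
  let ?K = "closure {x. \<phi> x \<noteq> 0}"
  have K: "compact ?K" using assms by (simp add: test_functions_def)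
  then obtain R where R: "\<And>x. x \<in> ?K \<Longrightarrow> norm x \<le> R"
    using compact_imp_bounded bounded_iff by metis
  have "compact (\<phi> ` ?K)"
    using K assms test_function_continuous by (meson compact_continuous_image continuous_on_subset subset_UNIV)
  then obtain B where B: "\<And>x. x \<in> ?K \<Longrightarrow> norm (\<phi> x) \<le> B"
    using compact_imp_bounded[of "\<phi> ` ?K"] unfolding bounded_iff by blast
  have K0: "x \<notin> ?K \<Longrightarrow> \<phi> x = 0" for x using subsetD[OF closure_subset, of x "{x. \<phi> x \<noteq> 0}"] by auto
  show thesis
  proof
    \<comment> \<open>The maxima with 1 keep both constants positive even if the support of
      \<open>\<phi>\<close> is empty.\<close>
    show "0 < max B 1" "0 < max R 1" by auto
    show "\<bar>\<phi> x\<bar> \<le> max B 1" for x using B[of x] K0[of x] by (cases "x \<in> ?K") auto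
    show "\<phi> x = 0" if "max R 1 < norm x" for x using R[of x] K0[of x] that by force
  qed
qed

lemma L2_indicator_compact:
  assumes "compact (K :: 'a::euclidean_space set)"
  shows "(\<lambda>x. indicator K x :: real) \<in> L2"
proof -
  have [measurable]: "K \<in> sets borel" using assms by (rule borel_compact)
  have "(\<lambda>x. (norm (indicator K x :: real))\<^sup>2) = indicator K" by (simp add: fun_eq_iff indicator_def)
  then show ?thesis
    using emeasure_compact_finite[OF assms] by (auto simp: L2_def integrable_real_indicator)
qed

lemma test_function_L2:
  fixes \<phi> :: "'a::euclidean_space \<Rightarrow> real"
  assumes "\<phi> \<in> test_functions"
  shows "\<phi> \<in> L2"
proof -
  obtain B R where *: "0 < B" "0 < R" "\<And>x. \<bar>\<phi> x\<bar> \<le> B" "\<And>x. R < norm x \<Longrightarrow> \<phi> x = 0"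
    using test_function_bounded[OF assms] by metis
  show ?thesis
  proof (rule L2_bound)
    show "(\<lambda>x. indicator (cball 0 R) x :: real) \<in> L2" by (rule L2_indicator_compact) simp
    show "norm (\<phi> x) \<le> B * norm (indicator (cball 0 R) x :: real)" for x
      using * by (simp add: indicator_def not_le)
  qed (use assms in auto)
qed

lemma frechet_derivative_euclidean:
  fixes \<phi> :: "'a::euclidean_space \<Rightarrow> real"
  assumes "\<phi> differentiable (at x)"
  shows "frechet_derivative \<phi> (at x) h = (\<Sum>b\<in>Basis. (h \<bullet> b) * frechet_derivative \<phi> (at x) b)"
proof -
  interpret linear "frechet_derivative \<phi> (at x)"
    using assms linear_frechet_derivative by blast
  have "frechet_derivative \<phi> (at x) h = frechet_derivative \<phi> (at x) (\<Sum>b\<in>Basis. (h \<bullet> b) *\<^sub>R b)"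
    by (simp add: euclidean_representation)
  also have "\<dots> = (\<Sum>b\<in>Basis. (h \<bullet> b) * frechet_derivative \<phi> (at x) b)"
    by (simp add: sum scale)
  finally show ?thesis .
qed

subsection \<open>Smooth bumps\<close>

text \<open>Weighting the classical flat function exp(-1/t) by all powers \<open>1 / t ^ n\<close>
  gives a family whose derivatives are combinations of its own members, so smoothness follows by one
  induction on the order.\<close>

definition flat_exp :: "nat \<Rightarrow> real \<Rightarrow> real" where
  "flat_exp n t = (if 0 < t then exp (- 1 / t) / t ^ n else 0)"

lemma flat_exp_at_right: "((\<lambda>t. exp (- 1 / t) / t ^ n) \<longlongrightarrow> (0::real)) (at_right 0)"
proof -
  have "((\<lambda>x::real. x ^ n / exp x) \<longlongrightarrow> 0) at_top" by (rule tendsto_power_div_exp_0)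
  then have "((\<lambda>t::real. inverse t ^ n / exp (inverse t)) \<longlongrightarrow> 0) (at_right 0)"
    using filterlim_inverse_at_top_right by (rule filterlim_compose)
  then show ?thesis by (simp add: exp_minus divide_inverse power_inverse mult.commute)
qed

lemma flat_exp_derivative:
  "(flat_exp n has_real_derivative - real n * flat_exp (Suc n) t + flat_exp (Suc (Suc n)) t) (at t)"
proof -
  consider "t < 0" | "0 < t" | "t = 0" by linarith
  then show ?thesis
  proof cases
    case 1
    have "((\<lambda>t. 0) has_real_derivative 0) (at t)" by simp
    then have "(flat_exp n has_real_derivative 0) (at t)"
      by (rule has_field_derivative_transform_within_open[of _ _ _ "{..<0}"]) (use 1 in \<open>auto simp: flat_exp_def\<close>)
    then show ?thesis using 1 by (simp add: flat_exp_def)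
  next
    case 2
    have "((\<lambda>t. exp (- 1 / t) / t ^ n) has_real_derivative
        (- real n * (exp (- 1 / t) / t ^ Suc n) + exp (- 1 / t) / t ^ Suc (Suc n))) (at t)"
    proof -
      have "((\<lambda>t. exp (- 1 / t)) has_real_derivative exp (- 1 / t) * (1 / (t * t))) (at t)"
        using 2 by (auto intro!: derivative_eq_intros)
      from DERIV_divide[OF this DERIV_pow[of n t]] 2
      have D: "((\<lambda>t. exp (- 1 / t) / t ^ n) has_real_derivative
          (exp (- 1 / t) * (1 / (t * t)) * t ^ n - exp (- 1 / t) * (real n * t ^ (n - Suc 0))) / (t ^ n * t ^ n)) (at t)"
        by simp
      have *: "(E * (1 / (t * t)) * (t * y) - E * (c * y)) / ((t * y) * (t * y))
          = - c * (E / (t * (t * y))) + E / (t * (t * (t * y)))" if "y \<noteq> 0" for E c y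
        using 2 that by (simp add: field_simps)
      show ?thesis
      proof (cases n)
        case 0
        then show ?thesis using D by (simp add: mult.assoc)
      next
        case (Suc k)
        have "t ^ k \<noteq> 0" using 2 by simp
        from D show ?thesis unfolding Suc power_Suc diff_Suc_Suc diff_zero *[OF \<open>t ^ k \<noteq> 0\<close>] by simp
      qed
    qed
    then have "(flat_exp n has_real_derivative
        (- real n * (exp (- 1 / t) / t ^ Suc n) + exp (- 1 / t) / t ^ Suc (Suc n))) (at t)"
      by (rule has_field_derivative_transform_within_open[of _ _ _ "{0<..}"]) (use 2 in \<open>auto simp: flat_exp_def\<close>)
    then show ?thesis using 2 by (simp add: flat_exp_def)
  next
    case 3
    \<comment> \<open>To the right of 0 the difference quotient of \<open>flat_exp n\<close> is
      \<open>flat_exp (Suc n)\<close> itself; to the left it vanishes.\<close>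
    have "((\<lambda>s. flat_exp n s / s) \<longlongrightarrow> 0) (at_right 0)"
      by (rule Lim_transform_eventually[OF flat_exp_at_right[of "Suc n"]])
        (auto simp: flat_exp_def eventually_at_filter)
    moreover have "((\<lambda>s. flat_exp n s / s) \<longlongrightarrow> 0) (at_left 0)"
      by (rule tendsto_eventually) (auto simp: flat_exp_def eventually_at_filter)
    ultimately have "((\<lambda>s. flat_exp n s / s) \<longlongrightarrow> 0) (at 0)"
      using filterlim_split_at by blast
    then have "(flat_exp n has_real_derivative 0) (at 0)"
      by (simp add: has_field_derivative_iff flat_exp_def)
    then show ?thesis using 3 by (simp add: flat_exp_def)
  qed
qed

text \<open>Differentiation moves \<open>n\<close> to \<open>n + 1\<close> and \<open>n + 2\<close>,
  hence the induction with \<open>n\<close> arbitrary. For an affine argument the chain rule only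
  contributes the constant factor \<open>v \<bullet> b\<close>.\<close>

lemma C_k_flat_exp: "C_k k (\<lambda>x. flat_exp n (c + v \<bullet> x))"
proof (induction k arbitrary: n)
  case 0
  have "continuous_on UNIV (flat_exp n)"
    using flat_exp_derivative by (meson DERIV_isCont continuous_at_imp_continuous_on)
  then show ?case by (auto intro!: continuous_on_compose2[of UNIV "flat_exp n"] continuous_intros)
next
  case (Suc k)
  have *: "((\<lambda>x. flat_exp n (c + v \<bullet> x)) has_derivative
     (\<lambda>h. (- real n * flat_exp (Suc n) (c + v \<bullet> x) + flat_exp (Suc (Suc n)) (c + v \<bullet> x)) * (v \<bullet> h))) (at x)" for x
  proof -
    have "((\<lambda>x. c + v \<bullet> x) has_derivative (\<lambda>h. v \<bullet> h)) (at x)"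
      by (auto intro!: derivative_eq_intros)
    from diff_chain_at[OF this flat_exp_derivative[THEN has_field_derivative_imp_has_derivative]]
    show ?thesis by (simp add: o_def)
  qed
  have "frechet_derivative (\<lambda>x. flat_exp n (c + v \<bullet> x)) (at x) b
     = (- real n * flat_exp (Suc n) (c + v \<bullet> x) + flat_exp (Suc (Suc n)) (c + v \<bullet> x)) * (v \<bullet> b)" for x b
    using frechet_derivative_at[OF *] by metis
  moreover have "C_k k (\<lambda>x. (- real n * flat_exp (Suc n) (c + v \<bullet> x) + flat_exp (Suc (Suc n)) (c + v \<bullet> x)) * (v \<bullet> b))" for b
    by (intro C_k_mult C_k_add C_k_const Suc)
  moreover have "(\<lambda>x. flat_exp n (c + v \<bullet> x)) differentiable (at x)" for x
    using * by (auto simp: differentiable_def)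
  ultimately show ?case by (simp only: C_k.simps) blast
qed

text \<open>The factor \<open>Suc m\<close> steepens each profile: exp(-1/((m+1) t)) tends to 1 for
  every t > 0. All members vanish outside the same open box and lie between 0 and 1, so they
  converge to its indicator with domination.\<close>

definition box_bump :: "'a::euclidean_space \<Rightarrow> 'a \<Rightarrow> nat \<Rightarrow> 'a \<Rightarrow> real" where
  "box_bump l u m x = (\<Prod>b\<in>Basis. flat_exp 0 (real (Suc m) * (x \<bullet> b - l \<bullet> b)) *
     flat_exp 0 (real (Suc m) * (u \<bullet> b - x \<bullet> b)))"

lemma flat_exp_0_bounds: "0 \<le> flat_exp 0 t" "flat_exp 0 t \<le> 1"
  by (auto simp: flat_exp_def)

lemma box_bump_eq_0: "x \<notin> box l u \<Longrightarrow> box_bump l u m x = 0"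
proof -
  assume "x \<notin> box l u"
  then obtain b where "b \<in> Basis" "x \<bullet> b \<le> l \<bullet> b \<or> u \<bullet> b \<le> x \<bullet> b"
    by (auto simp: box_def not_less)
  then show ?thesis unfolding box_bump_def
    by (intro prod_zero bexI[of _ b]) (auto simp: flat_exp_def zero_less_mult_iff)
qed

lemma box_bump_bounds: "0 \<le> box_bump l u m x" "box_bump l u m x \<le> 1"
  unfolding box_bump_def
  by (auto intro!: prod_nonneg prod_le_1 mult_nonneg_nonneg mult_le_one simp: flat_exp_0_bounds)

lemma box_bump_test_function: "box_bump l u m \<in> test_functions"
proof -
  have "C_k k (\<lambda>x. flat_exp 0 (real (Suc m) * (x \<bullet> b - l \<bullet> b)))" for k and b :: 'a
    using C_k_flat_exp[of k 0 "- real (Suc m) * (l \<bullet> b)" "real (Suc m) *\<^sub>R b"]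
    by (simp add: algebra_simps inner_commute)
  moreover have "C_k k (\<lambda>x. flat_exp 0 (real (Suc m) * (u \<bullet> b - x \<bullet> b)))" for k and b :: 'a
    using C_k_flat_exp[of k 0 "real (Suc m) * (u \<bullet> b)" "- real (Suc m) *\<^sub>R b"]
    by (simp add: algebra_simps inner_commute)
  ultimately have "C_k k (box_bump l u m)" for k
    unfolding box_bump_def by (intro C_k_prod C_k_mult) auto
  moreover have "{x. box_bump l u m x \<noteq> 0} \<subseteq> cbox l u"
    using box_bump_eq_0 box_subset_cbox by blast
  then have "compact (closure {x. box_bump l u m x \<noteq> 0})"
    using bounded_subset[OF bounded_cbox] compact_closure by blast
  ultimately show ?thesis by (simp add: test_functions_def)
qed

lemma box_bump_tendsto: "(\<lambda>m. box_bump l u m x) \<longlonglongrightarrow> indicator (box l u) x"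
proof (cases "x \<in> box l u")
  case True
  have *: "(\<lambda>m. flat_exp 0 (real (Suc m) * t)) \<longlonglongrightarrow> 1" if "0 < t" for t
  proof -
    have "(\<lambda>m. exp (- 1 / (real (Suc m) * t))) \<longlonglongrightarrow> 1"
      using that by real_asymp
    then show ?thesis using that by (simp add: flat_exp_def zero_less_mult_iff)
  qed
  have "(\<lambda>m. box_bump l u m x) \<longlonglongrightarrow> (\<Prod>b\<in>(Basis::'a set). 1 * 1)"
    unfolding box_bump_def by (intro tendsto_prod tendsto_mult *) (use True in \<open>auto simp: box_def\<close>)
  then show ?thesis using True by simp
qed (simp add: box_bump_eq_0)

subsection \<open>The fundamental lemma of the calculus of variations\<close>

text \<open>The positive and the negative part of \<open>g\<close>, taken as densities, define
  measures that agree and are finite on boxes. Boxes are stable under intersection and generate the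
  Borel sets, so the measures coincide, and then so do the densities almost everywhere.\<close>

lemma AE_zero_if_box_integrals_zero:
  fixes g :: "'a::euclidean_space \<Rightarrow> real"
  assumes [measurable]: "g \<in> borel_measurable borel"
    and int: "\<And>l u. integrable lborel (\<lambda>x. g x * indicator (box l u) x)"
    and zero: "\<And>l u. (\<integral>x. g x * indicator (box l u) x \<partial>lborel) = 0"
  shows "AE x in lborel. g x = 0"
proof -
  \<comment> \<open>\<open>ennreal\<close> cuts off at 0, so these are the densities of the positive
    and of the negative part.\<close>
  let ?p = "density lborel (\<lambda>x. ennreal (g x))" and ?n = "density lborel (\<lambda>x. ennreal (- g x))"
  have eq: "emeasure ?p (box l u) = emeasure ?n (box l u)" and fin: "emeasure ?p (box l u) \<noteq> \<infinity>" for l u :: 'a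
  proof -
    let ?P = "\<integral>\<^sup>+ x. ennreal (g x * indicator (box l u) x) \<partial>lborel"
    let ?N = "\<integral>\<^sup>+ x. ennreal (- (g x * indicator (box l u) x)) \<partial>lborel"
    have P: "emeasure ?p (box l u) = ?P"
      by (subst emeasure_density) (auto intro!: nn_integral_cong simp: indicator_def)
    have N: "emeasure ?n (box l u) = ?N"
      by (subst emeasure_density) (auto intro!: nn_integral_cong simp: indicator_def)
    have "?P \<noteq> \<infinity>" "?N \<noteq> \<infinity>"
      using int[of l u] by (auto simp: real_integrable_def)
    moreover have "enn2real ?P = enn2real ?N"
      using real_lebesgue_integral_def[OF int[of l u]] zero[of l u] by simp
    ultimately have "?P = ?N"
      by (cases ?P; cases ?N) auto
    then show "emeasure ?p (box l u) = emeasure ?n (box l u)" "emeasure ?p (box l u) \<noteq> \<infinity>"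
      using P N \<open>?P \<noteq> \<infinity>\<close> by auto
  qed
  have "?p = ?n"
  proof (rule measure_eqI_generator_eq)
    let ?E = "range (\<lambda>(a, b). box a b::'a set)"
    show "Int_stable ?E" by (auto simp: Int_stable_def box_Int_box)
    show "?E \<subseteq> Pow UNIV" "sets ?p = sigma_sets UNIV ?E" "sets ?n = sigma_sets UNIV ?E"
      by (simp_all add: borel_eq_box)
    let ?A = "\<lambda>n::nat. box (- (real n *\<^sub>R One)) (real n *\<^sub>R One) :: 'a set"
    show "range ?A \<subseteq> ?E" "(\<Union>i. ?A i) = UNIV"
      unfolding UN_box_eq_UNIV by auto
    show "emeasure ?p (?A i) \<noteq> \<infinity>" for i by (rule fin)
    show "emeasure ?p X = emeasure ?n X" if "X \<in> ?E" for X
      using that eq by auto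
  qed
  then have "AE x in lborel. ennreal (g x) = ennreal (- g x)"
    by (intro sigma_finite_measure.density_unique[OF sigma_finite_lborel]) auto
  then show ?thesis
  proof eventually_elim
    case (elim x)
    then show ?case by (cases "0 \<le> g x") (auto simp: ennreal_neg ennreal_eq_0_iff)
  qed
qed

text \<open>Box bumps are test functions; dominated convergence passes from them to indicators of
  open boxes, where the integrals of \<open>g\<close> then vanish as well.\<close>

lemma L2_AE_zero_if_weakly_zero:
  fixes g :: "'a::euclidean_space \<Rightarrow> real"
  assumes "g \<in> L2" and zero: "\<And>\<phi>. \<phi> \<in> test_functions \<Longrightarrow> (\<integral>x. g x * \<phi> x \<partial>lborel) = 0"
  shows "AE x in lborel. g x = 0"
proof (rule AE_zero_if_box_integrals_zero)
  show [measurable]: "g \<in> borel_measurable borel" using assms by auto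
  fix l u :: 'a
  have [measurable]: "box_bump l u m \<in> borel_measurable borel" for m
    using box_bump_test_function test_function_measurable by blast
  \<comment> \<open>The closed box serves for domination: it is compact, so its indicator is in L2
    and its product with \<open>g\<close> is integrable.\<close>
  have dom: "integrable lborel (\<lambda>x. \<bar>g x * indicator (cbox l u) x\<bar>)"
    by (intro integrable_abs integrable_L2_mult L2_indicator_compact assms) auto
  show "integrable lborel (\<lambda>x. g x * indicator (box l u) x)"
    by (rule Bochner_Integration.integrable_bound[OF dom])
      (use box_subset_cbox[of l u] in \<open>auto simp: indicator_def\<close>)
  have "(\<lambda>m. \<integral>x. g x * box_bump l u m x \<partial>lborel) \<longlonglongrightarrow> (\<integral>x. g x * indicator (box l u) x \<partial>lborel)"
  proof (rule integral_dominated_convergence[OF _ _ dom])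
    show "AE x in lborel. (\<lambda>m. g x * box_bump l u m x) \<longlonglongrightarrow> g x * indicator (box l u) x"
      by (intro AE_I2 tendsto_intros box_bump_tendsto)
    show "AE x in lborel. norm (g x * box_bump l u m x) \<le> \<bar>g x * indicator (cbox l u) x\<bar>" for m
    proof (intro AE_I2)
      fix x
      show "norm (g x * box_bump l u m x) \<le> \<bar>g x * indicator (cbox l u) x\<bar>"
        using box_bump_eq_0[of x l u m] box_bump_bounds[of l u m x] box_subset_cbox[of l u]
        by (cases "x \<in> box l u") (auto simp: abs_mult subset_iff intro: mult_left_le)
    qed
  qed auto
  moreover have "(\<integral>x. g x * box_bump l u m x \<partial>lborel) = 0" for m
    by (rule zero) (rule box_bump_test_function)
  ultimately show "(\<integral>x. g x * indicator (box l u) x \<partial>lborel) = 0"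
    by (simp add: LIMSEQ_const_iff)
qed


lemma L2_sum:
  fixes f :: "'i \<Rightarrow> 'a::euclidean_space \<Rightarrow> 'b::euclidean_space"
  assumes "\<And>i. i \<in> A \<Longrightarrow> f i \<in> L2"
  shows "(\<lambda>x. \<Sum>i\<in>A. f i x) \<in> L2"
  using assms proof (induction A rule: infinite_finite_induct)
  case (insert i A)
  then show ?case using L2_add[of "f i" "\<lambda>x. \<Sum>i\<in>A. f i x"] by simp
qed (simp_all add: L2_zero)

section \<open>The Sobolev space\<close>

lemma is_weak_gradientD:
  "is_weak_gradient w g \<Longrightarrow> \<phi> \<in> test_functions \<Longrightarrow> b \<in> Basis \<Longrightarrow>
    (\<integral>x. w x * frechet_derivative \<phi> (at x) b \<partial>lborel) = - (\<integral>x. (g x \<bullet> b) * \<phi> x \<partial>lborel)"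
  by (simp add: is_weak_gradient_def)

text \<open>The weak formulation is componentwise, so the fundamental lemma is applied to each
  coordinate of the difference; the finitely many null sets are then united.\<close>

lemma weak_gradient_unique:
  fixes w :: "'a::euclidean_space \<Rightarrow> real"
  assumes "g \<in> L2" "is_weak_gradient w g" "g' \<in> L2" "is_weak_gradient w g'"
  shows "AE x in lborel. g x = g' x"
proof -
  have "AE x in lborel. g x \<bullet> b - g' x \<bullet> b = 0" if b: "b \<in> Basis" for b
  proof (rule L2_AE_zero_if_weakly_zero)
    show "(\<lambda>x. g x \<bullet> b - g' x \<bullet> b) \<in> L2" using assms by (intro L2_diff L2_inner_right)
    fix \<phi> :: "'a \<Rightarrow> real" assume \<phi>: "\<phi> \<in> test_functions"
    have "(\<integral>x. (g x \<bullet> b - g' x \<bullet> b) * \<phi> x \<partial>lborel)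
        = (\<integral>x. (g x \<bullet> b) * \<phi> x \<partial>lborel) - (\<integral>x. (g' x \<bullet> b) * \<phi> x \<partial>lborel)"
      using assms \<phi> by (simp add: left_diff_distrib integrable_L2_mult L2_inner_right test_function_L2)
    also have "\<dots> = 0"
      using is_weak_gradientD[OF assms(2) \<phi> b] is_weak_gradientD[OF assms(4) \<phi> b] by simp
    finally show "(\<integral>x. (g x \<bullet> b - g' x \<bullet> b) * \<phi> x \<partial>lborel) = 0" .
  qed
  then have "AE x in lborel. \<forall>b\<in>Basis. g x \<bullet> b - g' x \<bullet> b = 0"
    by (intro AE_finite_allI) auto
  then show ?thesis by eventually_elim (auto intro: euclidean_eqI)
qed

lemma is_weak_gradient_diff:
  assumes "w \<in> L2" "g \<in> L2" "is_weak_gradient w g" "w' \<in> L2" "g' \<in> L2" "is_weak_gradient w' g'"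
  shows "is_weak_gradient (\<lambda>x. w x - w' x) (\<lambda>x. g x - g' x)"
  unfolding is_weak_gradient_def
proof (intro ballI)
  fix \<phi> :: "'a \<Rightarrow> real" and b :: 'a assume \<phi>: "\<phi> \<in> test_functions" and b: "b \<in> Basis"
  note [simp] = integrable_L2_mult test_function_L2[OF \<phi>] L2_inner_right
    test_function_L2[OF test_function_derivative[OF \<phi> b]]
  show "(\<integral>x. (w x - w' x) * frechet_derivative \<phi> (at x) b \<partial>lborel)
      = - (\<integral>x. ((g x - g' x) \<bullet> b) * \<phi> x \<partial>lborel)"
    using assms is_weak_gradientD[OF assms(3) \<phi> b] is_weak_gradientD[OF assms(6) \<phi> b]
    by (simp add: left_diff_distrib inner_diff_left)
qed

lemma is_weak_gradient_translation:
  assumes "w \<in> borel_measurable borel" "g \<in> borel_measurable borel" "is_weak_gradient w g"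
  shows "is_weak_gradient (\<lambda>x. w (x + c)) (\<lambda>x. g (x + c))"
  unfolding is_weak_gradient_def
proof (intro ballI)
  fix \<phi> :: "'a \<Rightarrow> real" and b :: 'a assume \<phi>: "\<phi> \<in> test_functions" and b: "b \<in> Basis"
  have [measurable]: "w \<in> borel_measurable borel" "g \<in> borel_measurable borel"
    "(\<lambda>x. frechet_derivative \<phi> (at x) b) \<in> borel_measurable borel" "\<phi> \<in> borel_measurable borel"
    using assms \<phi> test_function_derivative[OF \<phi> b] by auto
  have \<psi>: "(\<lambda>x. \<phi> (x + (- c))) \<in> test_functions" by (rule test_function_translation[OF \<phi>])
  have "(\<integral>x. w (x + c) * frechet_derivative \<phi> (at x) b \<partial>lborel)
      = (\<integral>x. w x * frechet_derivative \<phi> (at (x + (- c))) b \<partial>lborel)"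
    using integral_lborel_translation[of "\<lambda>x. w (x + c) * frechet_derivative \<phi> (at x) b" "- c"] by simp
  also have "\<dots> = (\<integral>x. w x * frechet_derivative (\<lambda>x. \<phi> (x + (- c))) (at x) b \<partial>lborel)"
    using frechet_derivative_translation(1)[OF test_function_differentiable[OF \<phi>], where c="- c"] by simp
  also have "\<dots> = - (\<integral>x. (g x \<bullet> b) * \<phi> (x + (- c)) \<partial>lborel)"
    by (rule is_weak_gradientD[OF assms(3) \<psi> b])
  also have "\<dots> = - (\<integral>x. (g (x + c) \<bullet> b) * \<phi> x \<partial>lborel)"
    using integral_lborel_translation[of "\<lambda>x. (g (x + c) \<bullet> b) * \<phi> x" "- c"] by simp
  finally show "(\<integral>x. w (x + c) * frechet_derivative \<phi> (at x) b \<partial>lborel)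
      = - (\<integral>x. (g (x + c) \<bullet> b) * \<phi> x \<partial>lborel)" .
qed

lemma H1_I: "w \<in> L2 \<Longrightarrow> g \<in> L2 \<Longrightarrow> is_weak_gradient w g \<Longrightarrow> w \<in> H1"
  by (auto simp: H1_def)

lemma H1_L2: "w \<in> H1 \<Longrightarrow> w \<in> L2"
  by (simp add: H1_def)

lemma
  assumes "w \<in> H1"
  shows weak_grad_L2: "weak_grad w \<in> L2" and is_weak_gradient_weak_grad: "is_weak_gradient w (weak_grad w)"
proof -
  have "\<exists>g. g \<in> L2 \<and> is_weak_gradient w g" using assms by (auto simp: H1_def)
  from someI_ex[OF this] show "weak_grad w \<in> L2" "is_weak_gradient w (weak_grad w)"
    by (simp_all add: weak_grad_def)
qed

text \<open>\<open>weak_grad\<close> is an arbitrary choice, so even its linearity and its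
  compatibility with translations hold only almost everywhere. Such facts are obtained by exhibiting
  a weak gradient and comparing it with the chosen one.\<close>

lemma weak_grad_AE_eq:
  assumes "w \<in> L2" "g \<in> L2" "is_weak_gradient w g"
  shows "AE x in lborel. weak_grad w x = g x"
  using weak_gradient_unique[OF weak_grad_L2 is_weak_gradient_weak_grad, of w g] H1_I[OF assms] assms by simp

lemma L2_norm_weak_grad_eq:
  assumes "w \<in> L2" "g \<in> L2" "is_weak_gradient w g"
  shows "L2_norm (weak_grad w) = L2_norm g"
proof (rule L2_norm_cong_AE)
  show "AE x in lborel. norm (weak_grad w x) = norm (g x)"
    using weak_grad_AE_eq[OF assms] by eventually_elim simp
qed (use assms weak_grad_L2[OF H1_I[OF assms]] in auto)

lemma H1_norm_nonneg [simp]: "0 \<le> H1_norm w"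
  by (simp add: H1_norm_def)

lemma H1_norm_power2: "(H1_norm w)\<^sup>2 = (L2_norm (weak_grad w))\<^sup>2 + (L2_norm w)\<^sup>2"
  by (simp add: H1_norm_def)

lemma L2_norm_le_H1_norm: "L2_norm w \<le> H1_norm w"
  by (simp add: H1_norm_def real_le_rsqrt)

lemma L2_norm_weak_grad_le_H1_norm: "L2_norm (weak_grad w) \<le> H1_norm w"
  by (simp add: H1_norm_def real_le_rsqrt)

lemma weak_gradient_H1_diff:
  assumes "w \<in> H1" "w' \<in> H1"
  shows "(\<lambda>x. w x - w' x) \<in> L2" "(\<lambda>x. weak_grad w x - weak_grad w' x) \<in> L2"
    "is_weak_gradient (\<lambda>x. w x - w' x) (\<lambda>x. weak_grad w x - weak_grad w' x)"
  using L2_diff[OF H1_L2[OF assms(1)] H1_L2[OF assms(2)]]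
    L2_diff[OF weak_grad_L2[OF assms(1)] weak_grad_L2[OF assms(2)]]
    is_weak_gradient_diff[OF H1_L2[OF assms(1)] weak_grad_L2[OF assms(1)] is_weak_gradient_weak_grad[OF assms(1)]
      H1_L2[OF assms(2)] weak_grad_L2[OF assms(2)] is_weak_gradient_weak_grad[OF assms(2)]]
  by simp_all

lemma H1_diff: "w \<in> H1 \<Longrightarrow> w' \<in> H1 \<Longrightarrow> (\<lambda>x. w x - w' x) \<in> H1"
  by (rule H1_I[OF weak_gradient_H1_diff])

lemma L2_norm_weak_grad_diff:
  assumes "w \<in> H1" "w' \<in> H1"
  shows "L2_norm (weak_grad (\<lambda>x. w x - w' x)) = L2_norm (\<lambda>x. weak_grad w x - weak_grad w' x)"
  by (rule L2_norm_weak_grad_eq[OF weak_gradient_H1_diff[OF assms]])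

lemma weak_gradient_H1_translation:
  assumes "w \<in> H1"
  shows "(\<lambda>x. w (x + c)) \<in> L2" "(\<lambda>x. weak_grad w (x + c)) \<in> L2"
    "is_weak_gradient (\<lambda>x. w (x + c)) (\<lambda>x. weak_grad w (x + c))"
  using L2_translation[OF H1_L2[OF assms]] L2_translation[OF weak_grad_L2[OF assms]]
    is_weak_gradient_translation[OF L2_measurable[OF H1_L2[OF assms]]
      L2_measurable[OF weak_grad_L2[OF assms]] is_weak_gradient_weak_grad[OF assms]]
  by simp_all

lemma H1_translation: "w \<in> H1 \<Longrightarrow> (\<lambda>x. w (x + c)) \<in> H1"
  by (rule H1_I[OF weak_gradient_H1_translation])

lemma L2_norm_weak_grad_translation:
  assumes "w \<in> H1"
  shows "L2_norm (weak_grad (\<lambda>x. w (x + c))) = L2_norm (weak_grad w)"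
  using L2_norm_weak_grad_eq[OF weak_gradient_H1_translation[OF assms]]
    L2_norm_translation[OF L2_measurable[OF weak_grad_L2[OF assms]]] by simp

lemma H1_norm_translation:
  assumes "w \<in> H1"
  shows "H1_norm (\<lambda>x. w (x + c)) = H1_norm w"
  using assms by (simp add: H1_norm_def L2_norm_weak_grad_translation L2_norm_translation H1_L2 L2_measurable)

text \<open>The L2 triangle inequalities for the function and its gradient are combined by the
  triangle inequality for Euclidean norms of pairs.\<close>

lemma H1_norm_le_diff:
  assumes "w \<in> H1" "w' \<in> H1"
  shows "H1_norm w \<le> H1_norm w' + H1_norm (\<lambda>x. w x - w' x)"
proof -
  have "H1_norm w \<le> sqrt ((L2_norm (weak_grad w') + L2_norm (weak_grad (\<lambda>x. w x - w' x)))\<^sup>2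
      + (L2_norm w' + L2_norm (\<lambda>x. w x - w' x))\<^sup>2)"
    unfolding H1_norm_def L2_norm_weak_grad_diff[OF assms]
    by (intro real_sqrt_le_mono add_mono power_mono L2_norm_le_diff weak_grad_L2 H1_L2 assms) auto
  also have "\<dots> \<le> H1_norm w' + H1_norm (\<lambda>x. w x - w' x)"
    unfolding H1_norm_def by (rule real_sqrt_sum_squares_triangle_ineq)
  finally show ?thesis .
qed

lemma H1_norm_minus_commute:
  assumes "w \<in> H1" "w' \<in> H1"
  shows "H1_norm (\<lambda>x. w x - w' x) = H1_norm (\<lambda>x. w' x - w x)"
  unfolding H1_norm_def L2_norm_weak_grad_diff[OF assms] L2_norm_weak_grad_diff[OF assms(2,1)]
  using L2_norm_minus_commute[of w w'] L2_norm_minus_commute[of "weak_grad w" "weak_grad w'"] by simp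

section \<open>Translation estimates, cube averages and the subcritical embedding\<close>

section \<open>Parametric integrals in \<open>L\<^sup>2\<close>\<close>

text \<open>Minkowski's integral inequality over a set of finite measure \<open>m\<close>.
  Cauchy-Schwarz in the parameter yields one factor sqrt m, Tonelli and the uniform bound on the
  slices the other.\<close>

lemma L2_norm_integral_le:
  fixes F :: "'a::euclidean_space \<Rightarrow> 's::euclidean_space \<Rightarrow> real"
  assumes F: "(\<lambda>(x, s). F x s) \<in> borel_measurable (borel \<Otimes>\<^sub>M borel)"
    and [measurable]: "S \<in> sets borel" and m: "emeasure lborel S = ennreal m" "0 \<le> m" and K: "0 \<le> K"
    and bound: "\<And>s. s \<in> S \<Longrightarrow> (\<integral>\<^sup>+x. ennreal ((F x s)\<^sup>2) \<partial>lborel) \<le> ennreal (K\<^sup>2)"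
  shows "(\<lambda>x. \<integral>s. indicator S s * F x s \<partial>lborel) \<in> L2"
    and "L2_norm (\<lambda>x. \<integral>s. indicator S s * F x s \<partial>lborel) \<le> m * K"
proof -
  have [measurable]: "(\<lambda>(x, s). F x s) \<in> borel_measurable (lborel \<Otimes>\<^sub>M lborel)"
    using F by (simp cong: measurable_cong_sets sets_pair_measure_cong)
  have [measurable]: "F x \<in> borel_measurable borel" for x
    using measurable_compose[OF measurable_Pair1' F, of x] by simp
  let ?D = "\<lambda>x. \<integral>s. indicator S s * F x s \<partial>lborel"
  have meas: "?D \<in> borel_measurable borel"
    by (subst measurable_lborel2[symmetric], rule sigma_finite_measure.borel_measurable_lebesgue_integral[OF sigma_finite_lborel]) measurable
  have "ennreal ((norm (?D x))\<^sup>2) \<le> ennreal m * (\<integral>\<^sup>+s. indicator S s * ennreal ((F x s)\<^sup>2) \<partial>lborel)" for x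
  proof -
    have "ennreal (norm (?D x)) \<le> (\<integral>\<^sup>+s. ennreal (norm (indicator S s * F x s)) \<partial>lborel)"
    \<comment> \<open>If the inner integral does not exist, its value is 0 by convention and the
      estimate holds trivially; no integrability has to be checked.\<close>
    proof (cases "integrable lborel (\<lambda>s. indicator S s * F x s)")
      case True
      then show ?thesis by (rule integral_norm_bound_ennreal)
    qed (simp add: not_integrable_integral_eq)
    also have "\<dots> = (\<integral>\<^sup>+s. indicator S s * (indicator S s * ennreal \<bar>F x s\<bar>) \<partial>lborel)"
      by (intro nn_integral_cong) (simp add: indicator_def abs_mult)
    finally have "(ennreal (norm (?D x)))\<^sup>2 \<le> (\<integral>\<^sup>+s. indicator S s * (indicator S s * ennreal \<bar>F x s\<bar>) \<partial>lborel)\<^sup>2"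
      by (rule power_mono_ennreal)
    also have "\<dots> \<le> (\<integral>\<^sup>+s. (indicator S s)\<^sup>2 \<partial>lborel) * (\<integral>\<^sup>+s. (indicator S s * ennreal \<bar>F x s\<bar>)\<^sup>2 \<partial>lborel)"
      by (rule Cauchy_Schwarz_nn_integral) auto
    also have "(\<integral>\<^sup>+s. (indicator S s :: ennreal)\<^sup>2 \<partial>lborel) = (\<integral>\<^sup>+s. indicator S s \<partial>lborel)"
      by (intro nn_integral_cong) (simp add: indicator_def)
    also have "\<dots> = ennreal m" using m by simp
    also have "(\<integral>\<^sup>+s. (indicator S s * ennreal \<bar>F x s\<bar>)\<^sup>2 \<partial>lborel) = (\<integral>\<^sup>+s. indicator S s * ennreal ((F x s)\<^sup>2) \<partial>lborel)"
      by (intro nn_integral_cong) (simp add: indicator_def ennreal_power)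
    finally show ?thesis by (simp add: ennreal_power)
  qed
  then have "(\<integral>\<^sup>+x. ennreal ((norm (?D x))\<^sup>2) \<partial>lborel)
      \<le> (\<integral>\<^sup>+x. ennreal m * (\<integral>\<^sup>+s. indicator S s * ennreal ((F x s)\<^sup>2) \<partial>lborel) \<partial>lborel)"
    by (intro nn_integral_mono) auto
  also have "\<dots> = ennreal m * (\<integral>\<^sup>+x. (\<integral>\<^sup>+s. indicator S s * ennreal ((F x s)\<^sup>2) \<partial>lborel) \<partial>lborel)"
    by (rule nn_integral_cmult) measurable
  also have "\<dots> \<le> ennreal m * (ennreal (K\<^sup>2) * ennreal m)"
  proof (rule mult_left_mono)
    have "(\<integral>\<^sup>+x. (\<integral>\<^sup>+s. indicator S s * ennreal ((F x s)\<^sup>2) \<partial>lborel) \<partial>lborel)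
        = (\<integral>\<^sup>+s. (\<integral>\<^sup>+x. indicator S s * ennreal ((F x s)\<^sup>2) \<partial>lborel) \<partial>lborel)"
      by (rule lborel_pair.Fubini'[symmetric]) measurable
    also have "\<dots> \<le> (\<integral>\<^sup>+s. ennreal (K\<^sup>2) * indicator S s \<partial>lborel)"
      by (intro nn_integral_mono) (use bound in \<open>auto simp: indicator_def\<close>)
    also have "\<dots> = ennreal (K\<^sup>2) * ennreal m" using m by (simp add: nn_integral_cmult_indicator)
    finally show "(\<integral>\<^sup>+x. (\<integral>\<^sup>+s. indicator S s * ennreal ((F x s)\<^sup>2) \<partial>lborel) \<partial>lborel) \<le> ennreal (K\<^sup>2) * ennreal m" .
  qed simp
  also have "\<dots> = ennreal ((m * K)\<^sup>2)"
    using m K by (simp add: power2_eq_square ennreal_mult[symmetric] mult_ac)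
  finally have le: "(\<integral>\<^sup>+x. ennreal ((norm (?D x))\<^sup>2) \<partial>lborel) \<le> ennreal ((m * K)\<^sup>2)" .
  show "?D \<in> L2" "L2_norm ?D \<le> m * K"
    using L2I_nn_integral[OF meas le] m K by auto
qed

text \<open>Absolute integrability on the product comes from \<open>\<bar>f x * F x s\<bar> \<le> (f
  x)\<^sup>2 + (F x s)\<^sup>2\<close>, whose integral over x is bounded uniformly on
  \<open>S\<close>, and from the finite measure of \<open>S\<close>.\<close>

lemma Fubini_L2:
  fixes F :: "'a::euclidean_space \<Rightarrow> 's::euclidean_space \<Rightarrow> real"
  assumes F: "(\<lambda>(x, s). F x s) \<in> borel_measurable (borel \<Otimes>\<^sub>M borel)"
    and [measurable]: "S \<in> sets borel" and m: "emeasure lborel S = ennreal m"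
    and bound: "\<And>s. s \<in> S \<Longrightarrow> (\<integral>\<^sup>+x. ennreal ((F x s)\<^sup>2) \<partial>lborel) \<le> ennreal (K\<^sup>2)"
    and "f \<in> L2"
  shows "(\<integral>x. f x * (\<integral>s. indicator S s * F x s \<partial>lborel) \<partial>lborel)
    = (\<integral>s. indicator S s * (\<integral>x. f x * F x s \<partial>lborel) \<partial>lborel)"
proof -
  have [measurable]: "(\<lambda>(x, s). F x s) \<in> borel_measurable (lborel \<Otimes>\<^sub>M lborel)"
    using F by (simp cong: measurable_cong_sets sets_pair_measure_cong)
  have [measurable]: "f \<in> borel_measurable borel" using assms by auto
  have [measurable]: "(\<lambda>x. F x s) \<in> borel_measurable borel" for s
    using measurable_compose[OF measurable_Pair2' F, of s] by simp
  let ?f = "\<lambda>x s. indicator S s * (f x * F x s)"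
  have "(\<integral>\<^sup>+x. (\<integral>\<^sup>+s. ennreal (norm (?f x s)) \<partial>lborel) \<partial>lborel)
      = (\<integral>\<^sup>+s. (\<integral>\<^sup>+x. ennreal (norm (?f x s)) \<partial>lborel) \<partial>lborel)"
    by (rule lborel_pair.Fubini'[symmetric]) measurable
  also have "\<dots> \<le> (\<integral>\<^sup>+s. ennreal ((L2_norm f)\<^sup>2 + K\<^sup>2) * indicator S s \<partial>lborel)"
  proof (rule nn_integral_mono)
    fix s :: 's
    have "(\<integral>\<^sup>+x. ennreal (norm (?f x s)) \<partial>lborel)
        \<le> (\<integral>\<^sup>+x. ennreal ((norm (f x))\<^sup>2) + ennreal ((F x s)\<^sup>2) \<partial>lborel)"
    proof (rule nn_integral_mono)
      fix x
      have "2 * (\<bar>f x\<bar> * \<bar>F x s\<bar>) \<le> (f x)\<^sup>2 + (F x s)\<^sup>2"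
        using sum_squares_bound[of "\<bar>f x\<bar>" "\<bar>F x s\<bar>"] by (simp add: mult.assoc)
      moreover have "0 \<le> \<bar>f x\<bar> * \<bar>F x s\<bar>" by simp
      ultimately have "\<bar>f x\<bar> * \<bar>F x s\<bar> \<le> (f x)\<^sup>2 + (F x s)\<^sup>2" by linarith
      then show "ennreal (norm (?f x s)) \<le> ennreal ((norm (f x))\<^sup>2) + ennreal ((F x s)\<^sup>2)"
        by (simp add: indicator_def abs_mult flip: ennreal_plus)
    qed
    also have "\<dots> = ennreal ((L2_norm f)\<^sup>2) + (\<integral>\<^sup>+x. ennreal ((F x s)\<^sup>2) \<partial>lborel)"
      using nn_integral_L2[OF \<open>f \<in> L2\<close>] by (subst nn_integral_add) auto
    finally have "s \<in> S \<Longrightarrow> (\<integral>\<^sup>+x. ennreal (norm (?f x s)) \<partial>lborel) \<le> ennreal ((L2_norm f)\<^sup>2 + K\<^sup>2)"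
      using bound[of s] by (auto simp: ennreal_plus intro: order_trans add_left_mono)
    then show "(\<integral>\<^sup>+x. ennreal (norm (?f x s)) \<partial>lborel) \<le> ennreal ((L2_norm f)\<^sup>2 + K\<^sup>2) * indicator S s"
      by (cases "s \<in> S") auto
  qed
  also have "\<dots> = ennreal ((L2_norm f)\<^sup>2 + K\<^sup>2) * ennreal m"
    using m by (simp add: nn_integral_cmult_indicator)
  also have "\<dots> < \<infinity>" by (simp add: ennreal_mult_less_top)
  finally have fin: "(\<integral>\<^sup>+x. (\<integral>\<^sup>+s. ennreal (norm (?f x s)) \<partial>lborel) \<partial>lborel) < \<infinity>" .
  have int: "integrable (lborel \<Otimes>\<^sub>M lborel) (\<lambda>(x, s). ?f x s)"
  proof (rule integrableI_bounded)
    have "(\<integral>\<^sup>+z. ennreal (norm ((\<lambda>(x, s). ?f x s) z)) \<partial>(lborel \<Otimes>\<^sub>M lborel))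
        = (\<integral>\<^sup>+x. (\<integral>\<^sup>+s. ennreal (norm (?f x s)) \<partial>lborel) \<partial>lborel)"
      by (subst lborel.nn_integral_fst[symmetric]) auto
    then show "(\<integral>\<^sup>+z. ennreal (norm ((\<lambda>(x, s). ?f x s) z)) \<partial>(lborel \<Otimes>\<^sub>M lborel)) < \<infinity>"
      using fin by simp
  qed measurable
  have "(\<integral>x. f x * (\<integral>s. indicator S s * F x s \<partial>lborel) \<partial>lborel) = (\<integral>x. (\<integral>s. ?f x s \<partial>lborel) \<partial>lborel)"
  proof (intro Bochner_Integration.integral_cong refl)
    fix x
    have "(\<integral>s. ?f x s \<partial>lborel) = (\<integral>s. f x * (indicator S s * F x s) \<partial>lborel)"
      by (simp add: mult_ac)
    then show "f x * (\<integral>s. indicator S s * F x s \<partial>lborel) = (\<integral>s. ?f x s \<partial>lborel)" by simp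
  qed
  also have "\<dots> = (\<integral>s. (\<integral>x. ?f x s \<partial>lborel) \<partial>lborel)"
    by (rule lborel_pair.Fubini_integral[OF int, symmetric])
  finally show ?thesis by simp
qed

section \<open>Translations in the Sobolev space\<close>

text \<open>Fundamental theorem of calculus on the segment from \<open>x\<close> to
  \<open>x - h\<close>; the antiderivative is \<open>- \<phi>\<close> along it, as the path runs in
  direction \<open>- h\<close>.\<close>

lemma test_function_line_integral:
  fixes \<phi> :: "'a::euclidean_space \<Rightarrow> real"
  assumes "\<phi> \<in> test_functions"
  shows "(\<integral>s. indicator {0..1} s * frechet_derivative \<phi> (at (x - s *\<^sub>R h)) h \<partial>lborel) = \<phi> x - \<phi> (x - h)"
proof -
  have D: "((\<lambda>s. - \<phi> (x - s *\<^sub>R h)) has_vector_derivative frechet_derivative \<phi> (at (x - s *\<^sub>R h)) h) (at s within {0..1})" for s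
  proof -
    have "((\<lambda>s. x - s *\<^sub>R h) has_derivative (\<lambda>r. - (r *\<^sub>R h))) (at s within {0..1})"
      by (auto intro!: derivative_eq_intros)
    moreover have "(\<phi> has_derivative frechet_derivative \<phi> (at (x - s *\<^sub>R h))) (at (x - s *\<^sub>R h))"
      by (intro differentiable_imp_has_derivative test_function_differentiable assms)
    ultimately have "((\<lambda>s. \<phi> (x - s *\<^sub>R h)) has_derivative
        (\<lambda>r. frechet_derivative \<phi> (at (x - s *\<^sub>R h)) (- (r *\<^sub>R h)))) (at s within {0..1})"
      by (rule has_derivative_compose)
    from has_derivative_minus[OF this] show ?thesis
      using linear_frechet_derivative[OF test_function_differentiable[OF assms], of "x - s *\<^sub>R h"]
      by (simp add: has_vector_derivative_def linear_neg linear_cmul)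
  qed
  have "continuous_on {0..1} (\<lambda>s. frechet_derivative \<phi> (at (x - s *\<^sub>R h)) h)"
    unfolding frechet_derivative_euclidean[OF test_function_differentiable[OF assms], of _ h]
    by (intro continuous_on_sum continuous_on_mult continuous_on_const
        continuous_on_compose2[OF test_function_continuous[OF test_function_derivative[OF assms]]])
      (auto intro!: continuous_intros)
  from integral_FTC_atLeastAtMost[OF _ D this] show ?thesis by simp
qed

text \<open>Extends the defining identity of the weak gradient by linearity from basis vectors to
  any direction, and moves the shift from the test function to the gradient.\<close>

lemma integral_frechet_derivative_translation:
  fixes \<phi> :: "'a::euclidean_space \<Rightarrow> real"
  assumes "w \<in> H1" "\<phi> \<in> test_functions"
  shows "(\<integral>x. w x * frechet_derivative \<phi> (at (x - y)) h \<partial>lborel) = - (\<integral>x. (weak_grad w (x + y) \<bullet> h) * \<phi> x \<partial>lborel)"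
proof -
  note [simp] = integrable_L2_mult test_function_L2 L2_inner_right
  let ?\<phi> = "\<lambda>x. \<phi> (x + (- y))"
  have \<psi>: "?\<phi> \<in> test_functions" by (rule test_function_translation[OF assms(2)])
  have w: "w \<in> L2" and g: "weak_grad w \<in> L2" using assms H1_L2 weak_grad_L2 by auto
  have [measurable]: "weak_grad w \<in> borel_measurable borel" "\<phi> \<in> borel_measurable borel"
    using g assms by auto
  have "(\<integral>x. w x * frechet_derivative \<phi> (at (x - y)) h \<partial>lborel) = (\<integral>x. w x * frechet_derivative ?\<phi> (at x) h \<partial>lborel)"
    using frechet_derivative_translation(1)[OF test_function_differentiable[OF assms(2)], where c="- y"] by simp
  also have "\<dots> = (\<integral>x. (\<Sum>b\<in>Basis. (h \<bullet> b) * (w x * frechet_derivative ?\<phi> (at x) b)) \<partial>lborel)"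
    unfolding frechet_derivative_euclidean[OF test_function_differentiable[OF \<psi>], of _ h]
    by (simp add: sum_distrib_left mult_ac)
  also have "\<dots> = (\<Sum>b\<in>Basis. (h \<bullet> b) * (\<integral>x. w x * frechet_derivative ?\<phi> (at x) b \<partial>lborel))"
    using w test_function_derivative[OF \<psi>] by (subst Bochner_Integration.integral_sum) auto
  also have "\<dots> = (\<Sum>b\<in>Basis. (h \<bullet> b) * - (\<integral>x. (weak_grad w x \<bullet> b) * ?\<phi> x \<partial>lborel))"
    using is_weak_gradientD[OF is_weak_gradient_weak_grad[OF assms(1)] \<psi>] by simp
  also have "\<dots> = - (\<integral>x. (\<Sum>b\<in>Basis. (h \<bullet> b) * ((weak_grad w x \<bullet> b) * ?\<phi> x)) \<partial>lborel)"
    using g \<psi> by (subst Bochner_Integration.integral_sum) (auto simp: sum_negf)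
  also have "\<dots> = - (\<integral>x. (weak_grad w x \<bullet> h) * ?\<phi> x \<partial>lborel)"
  proof -
    have "(\<Sum>b\<in>Basis. (h \<bullet> b) * ((weak_grad w x \<bullet> b) * c)) = (weak_grad w x \<bullet> h) * c" for x c
      by (subst euclidean_inner[of "weak_grad w x" h]) (simp add: sum_distrib_right sum_distrib_left mult_ac)
    then show ?thesis by simp
  qed
  also have "\<dots> = - (\<integral>x. (weak_grad w (x + y) \<bullet> h) * \<phi> x \<partial>lborel)"
    using integral_lborel_translation[of "\<lambda>x. (weak_grad w x \<bullet> h) * ?\<phi> x" y] by simp
  finally show ?thesis .
qed

text \<open>The increment equals the integral of the gradient along the segment, almost everywhere,
  and Minkowski's inequality finishes. The identity is proved by duality, so no approximation of
  \<open>w\<close> by smooth functions is involved.\<close>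

lemma L2_norm_H1_translation_diff:
  fixes w :: "'a::euclidean_space \<Rightarrow> real"
  assumes "w \<in> H1"
  shows "L2_norm (\<lambda>x. w (x + h) - w x) \<le> norm h * L2_norm (weak_grad w)"
proof -
  define g where "g = weak_grad w"
  have w: "w \<in> L2" and g: "g \<in> L2" using assms H1_L2 weak_grad_L2 by (auto simp: g_def)
  have [measurable]: "w \<in> borel_measurable borel" "g \<in> borel_measurable borel" using w g by auto
  let ?S = "{0..1::real}" and ?K = "norm h * L2_norm g"
  let ?D = "\<lambda>x. \<integral>s. indicator ?S s * (g (x + s *\<^sub>R h) \<bullet> h) \<partial>lborel"
  have S: "?S \<in> sets borel" "emeasure lborel ?S = ennreal 1" by auto
  have meas: "(\<lambda>(x, s). g (x + s *\<^sub>R h) \<bullet> h) \<in> borel_measurable (borel \<Otimes>\<^sub>M borel)" by measurable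
  have bound: "(\<integral>\<^sup>+x. ennreal ((g (x + s *\<^sub>R h) \<bullet> h)\<^sup>2) \<partial>lborel) \<le> ennreal (?K\<^sup>2)" for s
  proof -
    have "(\<integral>\<^sup>+x. ennreal ((g (x + s *\<^sub>R h) \<bullet> h)\<^sup>2) \<partial>lborel) = (\<integral>\<^sup>+x. ennreal ((g x \<bullet> h)\<^sup>2) \<partial>lborel)"
      by (subst nn_integral_lborel_translation[of "\<lambda>x. ennreal ((g x \<bullet> h)\<^sup>2)"]) auto
    also have "\<dots> \<le> (\<integral>\<^sup>+x. ennreal ((norm h)\<^sup>2) * ennreal ((norm (g x))\<^sup>2) \<partial>lborel)"
    proof (intro nn_integral_mono)
      fix x
      have "(g x \<bullet> h)\<^sup>2 \<le> (norm h)\<^sup>2 * (norm (g x))\<^sup>2"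
        using power_mono[OF Cauchy_Schwarz_ineq2[of "g x" h] abs_ge_zero, of 2]
        by (simp add: power_mult_distrib mult.commute)
      then show "ennreal ((g x \<bullet> h)\<^sup>2) \<le> ennreal ((norm h)\<^sup>2) * ennreal ((norm (g x))\<^sup>2)"
        by (simp flip: ennreal_mult')
    qed
    also have "\<dots> = ennreal (?K\<^sup>2)"
      using nn_integral_L2[OF g] by (simp add: nn_integral_cmult power_mult_distrib ennreal_mult)
    finally show ?thesis .
  qed
  have D: "?D \<in> L2" "L2_norm ?D \<le> ?K"
    using L2_norm_integral_le[OF meas S(1) S(2) _ _ bound] by auto
  \<comment> \<open>Tested against \<open>\<phi>\<close>: the shift moves to \<open>\<phi>\<close>,
    whose increment is a line integral; after exchanging integrals one integrates by parts at fixed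
    s and exchanges back.\<close>
  have "AE x in lborel. w (x + h) - w x - ?D x = 0"
  proof (rule L2_AE_zero_if_weakly_zero)
    show "(\<lambda>x. w (x + h) - w x - ?D x) \<in> L2" using w D by (intro L2_diff L2_translation)
    fix \<phi> :: "'a \<Rightarrow> real" assume \<phi>: "\<phi> \<in> test_functions"
    have [measurable]: "\<phi> \<in> borel_measurable borel" using \<phi> by auto
    note [simp] = integrable_L2_mult test_function_L2[OF \<phi>] L2_translation
    let ?\<psi> = "\<lambda>x. frechet_derivative \<phi> (at x) h"
    have \<psi>: "?\<psi> \<in> L2"
    proof -
      have "?\<psi> = (\<lambda>x. (\<Sum>b\<in>Basis. (h \<bullet> b) *\<^sub>R frechet_derivative \<phi> (at x) b))"
        using frechet_derivative_euclidean[OF test_function_differentiable[OF \<phi>], of _ h] by simp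
      also have "\<dots> \<in> L2"
        by (intro L2_sum L2_scaleR test_function_L2 test_function_derivative \<phi>)
      finally show ?thesis .
    qed
    have [measurable]: "?\<psi> \<in> borel_measurable borel" using \<psi> by auto
    have meas\<psi>: "(\<lambda>(x, s). ?\<psi> (x - s *\<^sub>R h)) \<in> borel_measurable (borel \<Otimes>\<^sub>M borel)" by measurable
    have bound\<psi>: "(\<integral>\<^sup>+x. ennreal ((?\<psi> (x - s *\<^sub>R h))\<^sup>2) \<partial>lborel) \<le> ennreal ((L2_norm ?\<psi>)\<^sup>2)" for s
      using nn_integral_lborel_translation[of "\<lambda>x. ennreal ((?\<psi> x)\<^sup>2)" "- (s *\<^sub>R h)"] nn_integral_L2[OF \<psi>]
      by simp
    have "(\<integral>x. (w (x + h) - w x) * \<phi> x \<partial>lborel) = (\<integral>x. w (x + h) * \<phi> x \<partial>lborel) - (\<integral>x. w x * \<phi> x \<partial>lborel)"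
      using w by (simp add: left_diff_distrib)
    also have "(\<integral>x. w (x + h) * \<phi> x \<partial>lborel) = (\<integral>x. w x * \<phi> (x - h) \<partial>lborel)"
      using integral_lborel_translation[of "\<lambda>x. w x * \<phi> (x - h)" h] by simp
    also have "\<dots> - (\<integral>x. w x * \<phi> x \<partial>lborel) = - (\<integral>x. w x * (\<phi> x - \<phi> (x - h)) \<partial>lborel)"
      using w L2_translation[OF test_function_L2[OF \<phi>], of "- h"] by (simp add: right_diff_distrib)
    also have "\<dots> = - (\<integral>x. w x * (\<integral>s. indicator ?S s * ?\<psi> (x - s *\<^sub>R h) \<partial>lborel) \<partial>lborel)"
      using test_function_line_integral[OF \<phi>] by simp
    also have "\<dots> = - (\<integral>s. indicator ?S s * (\<integral>x. w x * ?\<psi> (x - s *\<^sub>R h) \<partial>lborel) \<partial>lborel)"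
      using Fubini_L2[OF meas\<psi> S bound\<psi> w] by simp
    also have "\<dots> = (\<integral>s. indicator ?S s * (\<integral>x. \<phi> x * (g (x + s *\<^sub>R h) \<bullet> h) \<partial>lborel) \<partial>lborel)"
      by (simp add: integral_frechet_derivative_translation[OF assms \<phi>] mult.commute[of "\<phi> _"] flip: g_def)
    also have "\<dots> = (\<integral>x. \<phi> x * ?D x \<partial>lborel)"
      using Fubini_L2[OF meas S bound test_function_L2[OF \<phi>]] by simp
    finally have "(\<integral>x. (w (x + h) - w x) * \<phi> x \<partial>lborel) = (\<integral>x. ?D x * \<phi> x \<partial>lborel)"
      by (simp add: mult.commute)
    then show "(\<integral>x. (w (x + h) - w x - ?D x) * \<phi> x \<partial>lborel) = 0"
      using w D by (subst left_diff_distrib, subst Bochner_Integration.integral_diff) (auto simp: L2_diff)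
  qed
  then have "L2_norm (\<lambda>x. w (x + h) - w x) = L2_norm ?D"
    using L2_measurable[OF D(1)] by (intro L2_norm_cong_AE) auto
  then show ?thesis using D by (simp add: g_def)
qed


section \<open>Averages over cubes\<close>

definition cube :: "real \<Rightarrow> 'a::euclidean_space set" where
  "cube d = cbox 0 (d *\<^sub>R One)"

text \<open>Each point is the corner of its own cube \<open>x + cube d\<close>. Without a fixed
  dyadic grid the average is a mean of translates of \<open>w\<close>, so translation estimates
  apply to it directly.\<close>

definition cube_average :: "real \<Rightarrow> ('a::euclidean_space \<Rightarrow> real) \<Rightarrow> 'a \<Rightarrow> real" where
  "cube_average d w x = (\<integral>h. indicator (cube d) h * w (x + h) \<partial>lborel) / d ^ DIM('a)"

lemma cube_measurable [measurable, simp]: "cube d \<in> sets borel"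
  by (simp add: cube_def)

lemma emeasure_cube:
  assumes "0 \<le> d"
  shows "emeasure lborel (cube d :: 'a::euclidean_space set) = ennreal (d ^ DIM('a))"
  using assms by (simp add: cube_def emeasure_lborel_cbox_eq inner_sum_left inner_Basis)

lemma indicator_cube_L2: "(\<lambda>h. indicator (cube d) h :: real) \<in> L2"
  by (rule L2_indicator_compact) (simp add: cube_def)

lemma L2_norm_indicator_cube:
  assumes "0 \<le> d"
  shows "L2_norm (\<lambda>h::'a::euclidean_space. indicator (cube d) h :: real) = sqrt (d ^ DIM('a))"
proof -
  have "(\<lambda>h::'a. (norm (indicator (cube d) h :: real))\<^sup>2) = (\<lambda>h. indicator (cube d) h)"
    by (simp add: fun_eq_iff indicator_def)
  then show ?thesis
    using assms emeasure_cube[OF assms, where 'a='a] by (simp add: L2_norm_def measure_def)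
qed

lemma norm_le_DIM_mult:
  fixes h :: "'a::euclidean_space"
  assumes "\<And>b. b \<in> Basis \<Longrightarrow> \<bar>h \<bullet> b\<bar> \<le> d"
  shows "norm h \<le> real DIM('a) * d"
proof -
  have "norm h \<le> (\<Sum>b\<in>Basis. \<bar>h \<bullet> b\<bar>)" by (rule norm_le_l1)
  also have "\<dots> \<le> (\<Sum>b\<in>(Basis :: 'a set). d)" by (intro sum_mono assms)
  finally show ?thesis by simp
qed

lemma mem_cube: "h \<in> cube d \<longleftrightarrow> (\<forall>b\<in>Basis. 0 \<le> h \<bullet> b \<and> h \<bullet> b \<le> d)"
  by (simp add: cube_def mem_box inner_sum_left inner_Basis)

lemma L2_translation_left: "f \<in> L2 \<Longrightarrow> (\<lambda>h. f (x + h)) \<in> L2"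
  using L2_translation[of f x] by (simp add: add.commute)

lemma L2_norm_translation_left:
  "f \<in> borel_measurable borel \<Longrightarrow> L2_norm (\<lambda>h. f (x + h)) = L2_norm f"
  using L2_norm_translation[of f x] by (simp add: add.commute)

lemma integrable_indicator_cube_mult:
  fixes w :: "'a::euclidean_space \<Rightarrow> real"
  shows "w \<in> L2 \<Longrightarrow> integrable lborel (\<lambda>h. indicator (cube d) h * w h)"
  by (rule integrable_L2_mult[OF indicator_cube_L2])

lemma integral_indicator_cube:
  fixes c d :: real
  assumes "0 \<le> d"
  shows "integrable lborel (\<lambda>h::'a::euclidean_space. indicator (cube d) h * c)"
    and "(\<integral>h. indicator (cube d) h * c \<partial>(lborel :: 'a measure)) = d ^ DIM('a) * c"
  using assms emeasure_cube[OF assms, where 'a='a] by (auto simp: measure_def)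

lemma integral_cube_diff:
  fixes w :: "'a::euclidean_space \<Rightarrow> real"
  assumes "w \<in> L2" "0 < d"
  shows "(\<integral>h. indicator (cube d) h * (w (x + h) - c) \<partial>lborel) = d ^ DIM('a) * (cube_average d w x - c)"
proof -
  have "(\<integral>h. indicator (cube d) h * (w (x + h) - c) \<partial>lborel)
      = (\<integral>h. indicator (cube d) h * w (x + h) - indicator (cube d) h * c \<partial>lborel)"
    by (simp only: right_diff_distrib)
  also have "\<dots> = (\<integral>h. indicator (cube d) h * w (x + h) \<partial>lborel) - d ^ DIM('a) * c"
    using integrable_indicator_cube_mult[OF L2_translation_left[OF assms(1)], of d x]
      integral_indicator_cube[of d c, where 'a='a] assms(2)
    by (subst Bochner_Integration.integral_diff) simp_all
  finally show ?thesis using assms(2) by (simp add: cube_average_def right_diff_distrib)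
qed

text \<open>The difference is the mean over the cube of the increments of \<open>w\<close> by h. The
  dimension factor is the crude bound of the norm of h by the sum of its coordinates.\<close>

lemma L2_norm_cube_average_diff:
  fixes w :: "'a::euclidean_space \<Rightarrow> real"
  assumes "w \<in> H1" "0 < d"
  shows "(\<lambda>x. cube_average d w x - w x) \<in> L2"
    and "L2_norm (\<lambda>x. cube_average d w x - w x) \<le> real DIM('a) * d * L2_norm (weak_grad w)"
proof -
  have w: "w \<in> L2" using assms H1_L2 by auto
  have [measurable]: "w \<in> borel_measurable borel" using w by auto
  let ?K = "real DIM('a) * d * L2_norm (weak_grad w)"
  let ?D = "\<lambda>x. \<integral>h. indicator (cube d) h * (w (x + h) - w x) \<partial>lborel"
  have meas: "(\<lambda>(x, h). w (x + h) - w x) \<in> borel_measurable (borel \<Otimes>\<^sub>M borel)" by measurable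
  have bound: "(\<integral>\<^sup>+x. ennreal ((w (x + h) - w x)\<^sup>2) \<partial>lborel) \<le> ennreal (?K\<^sup>2)" if "h \<in> cube d" for h
  proof -
    have "norm h \<le> real DIM('a) * d" using that by (intro norm_le_DIM_mult) (auto simp: mem_cube)
    then have "L2_norm (\<lambda>x. w (x + h) - w x) \<le> ?K"
      using L2_norm_H1_translation_diff[OF assms(1), of h]
      by (meson L2_norm_nonneg mult_right_mono order_trans)
    then show ?thesis
      using nn_integral_L2[OF L2_diff[OF L2_translation[OF w, of h] w]]
      by (simp add: power_mono)
  qed
  have D: "?D \<in> L2" "L2_norm ?D \<le> d ^ DIM('a) * ?K"
    using L2_norm_integral_le[OF meas cube_measurable emeasure_cube _ _ bound] assms(2) by auto
  have "cube_average d w x - w x = (1 / d ^ DIM('a)) *\<^sub>R ?D x" for x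
    using integral_cube_diff[OF w assms(2), of x "w x"] assms(2) by simp
  then have eq: "(\<lambda>x. cube_average d w x - w x) = (\<lambda>x. (1 / d ^ DIM('a)) *\<^sub>R ?D x)" by blast
  show "(\<lambda>x. cube_average d w x - w x) \<in> L2" unfolding eq by (rule L2_scaleR[OF D(1)])
  show "L2_norm (\<lambda>x. cube_average d w x - w x) \<le> ?K"
    unfolding eq L2_norm_scaleR using D(2) assms(2) by (simp add: field_simps)
qed

lemma cube_average_le:
  fixes w :: "'a::euclidean_space \<Rightarrow> real"
  assumes "w \<in> L2"
  shows "\<bar>cube_average 1 w x\<bar> \<le> L2_norm w"
  using L2_Cauchy_Schwarz_real[OF indicator_cube_L2 L2_translation_left[OF assms], of 1 x]
    L2_norm_indicator_cube[of 1, where 'a='a] L2_norm_translation_left[of w x] assms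
  by (simp add: cube_average_def L2_measurable)

text \<open>Poincare inequality on the cube \<open>x + cube d\<close>: the deviation from the mean
  is itself a mean of increments between two points of the cube, and these are controlled by the
  translation estimate.\<close>

lemma L2_norm_cube_Poincare:
  fixes w :: "'a::euclidean_space \<Rightarrow> real" and x :: 'a
  assumes "w \<in> H1" "0 < d"
  defines "D \<equiv> \<lambda>h. indicator (cube d) h * (w (x + h) - cube_average d w x)"
  shows "D \<in> L2" and "L2_norm D \<le> 2 ^ DIM('a) * real DIM('a) * d * L2_norm (weak_grad w)"
proof -
  have w: "w \<in> L2" using assms H1_L2 by auto
  have [measurable]: "w \<in> borel_measurable borel" using w by auto
  let ?K = "real DIM('a) * d * L2_norm (weak_grad w)"
  \<comment> \<open>The offset m between two points of the cube ranges over \<open>?S\<close>, whose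
    volume is \<open>(2 * d) ^ DIM('a)\<close>; dividing by the volume of the cube leaves the factor
    \<open>2 ^ DIM('a)\<close>. The second indicator in \<open>?F\<close> keeps \<open>h + m\<close>
    inside the cube.\<close>
  let ?S = "cbox (- (d *\<^sub>R One)) (d *\<^sub>R One) :: 'a set"
  let ?F = "\<lambda>h m. indicator (cube d) h * (indicator (cube d) (h + m) * (w (x + h) - w (x + (h + m))))"
  have S: "?S \<in> sets borel" "emeasure lborel ?S = ennreal ((2 * d) ^ DIM('a))"
  proof -
    have "(\<Prod>b\<in>Basis. (d *\<^sub>R (One :: 'a) - - (d *\<^sub>R One)) \<bullet> b) = (\<Prod>b\<in>(Basis :: 'a set). 2 * d)"
      by (intro prod.cong) (simp_all add: inner_diff_left inner_add_left inner_minus_left inner_sum_left inner_Basis)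
    then show "emeasure lborel ?S = ennreal ((2 * d) ^ DIM('a))"
      using assms(2) by (subst emeasure_lborel_cbox) (auto simp: inner_sum_left inner_Basis)
  qed simp
  have meas: "(\<lambda>(h, m). ?F h m) \<in> borel_measurable (borel \<Otimes>\<^sub>M borel)" by measurable
  have bound: "(\<integral>\<^sup>+h. ennreal ((?F h m)\<^sup>2) \<partial>lborel) \<le> ennreal (?K\<^sup>2)" if "m \<in> ?S" for m
  proof -
    have "norm m \<le> real DIM('a) * d"
      using that by (intro norm_le_DIM_mult) (auto simp: mem_box inner_sum_left inner_Basis abs_le_iff minus_le_iff)
    then have "L2_norm (\<lambda>y. w (y + m) - w y) \<le> ?K"
      using L2_norm_H1_translation_diff[OF assms(1), of m]
      by (meson L2_norm_nonneg mult_right_mono order_trans)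
    then have "(\<integral>\<^sup>+y. ennreal ((w (y + m) - w y)\<^sup>2) \<partial>lborel) \<le> ennreal (?K\<^sup>2)"
      using nn_integral_L2[OF L2_diff[OF L2_translation[OF w, of m] w]]
      by (simp add: power_mono)
    moreover have "(\<integral>\<^sup>+h. ennreal ((?F h m)\<^sup>2) \<partial>lborel) \<le> (\<integral>\<^sup>+h. ennreal ((w (h + x + m) - w (h + x))\<^sup>2) \<partial>lborel)"
      by (intro nn_integral_mono) (auto simp: indicator_def power2_commute ac_simps)
    moreover have "\<dots> = (\<integral>\<^sup>+y. ennreal ((w (y + m) - w y)\<^sup>2) \<partial>lborel)"
      by (rule nn_integral_lborel_translation[of "\<lambda>y. ennreal ((w (y + m) - w y)\<^sup>2)"]) measurable
    ultimately show ?thesis by simp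
  qed
  let ?E = "\<lambda>h. \<integral>m. indicator ?S m * ?F h m \<partial>lborel"
  have E: "?E \<in> L2" "L2_norm ?E \<le> (2 * d) ^ DIM('a) * ?K"
    using L2_norm_integral_le[OF meas S _ _ bound] assms(2) by auto
  have "?E h = d ^ DIM('a) * D h" for h
  proof (cases "h \<in> cube d")
    case True
    have "?E h = (\<integral>m. indicator (cube d) (h + m) * (w (x + h) - w (x + (h + m))) \<partial>lborel)"
    proof (intro Bochner_Integration.integral_cong refl)
      fix m
      have "h + m \<in> cube d \<Longrightarrow> m \<in> ?S"
        using True by (force simp: mem_cube mem_box inner_sum_left inner_Basis inner_add_left)
      then show "indicator ?S m * ?F h m = indicator (cube d) (h + m) * (w (x + h) - w (x + (h + m)))"
        using True by (simp add: indicator_def)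
    qed
    also have "\<dots> = (\<integral>k. indicator (cube d) k * (w (x + h) - w (x + k)) \<partial>lborel)"
      using integral_lborel_translation[of "\<lambda>k. indicator (cube d) k * (w (x + h) - w (x + k))" h]
      by (simp add: add.commute)
    also have "\<dots> = - (\<integral>k. indicator (cube d) k * (w (x + k) - w (x + h)) \<partial>lborel)"
      by (simp add: right_diff_distrib flip: Bochner_Integration.integral_minus)
    also have "\<dots> = d ^ DIM('a) * D h"
      using integral_cube_diff[OF w assms(2), of x "w (x + h)"] True by (simp add: D_def algebra_simps)
    finally show ?thesis .
  qed (simp add: D_def)
  then have eq: "D = (\<lambda>h. (1 / d ^ DIM('a)) *\<^sub>R ?E h)"
    using assms(2) by (simp add: fun_eq_iff)
  show "D \<in> L2" unfolding eq by (rule L2_scaleR[OF E(1)])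
  show "L2_norm D \<le> 2 ^ DIM('a) * real DIM('a) * d * L2_norm (weak_grad w)"
    unfolding eq L2_norm_scaleR using E(2) assms(2) by (simp add: field_simps power_mult_distrib)
qed

lemma sqrt_mult_divide: "0 < v \<Longrightarrow> sqrt v * P / v = P / sqrt v"
  using sqrt_divide_self_eq[of v] by (metis divide_inverse less_imp_le mult.commute times_divide_eq_right)

text \<open>The change of the mean is the average over the small cube of the deviation from the
  large mean. Cauchy-Schwarz against the Poincare inequality yields a multiple of d^(1 - N/2), which
  is the scaling of the gradient norm against the sup norm.\<close>

lemma cube_average_halving:
  fixes w :: "'a::euclidean_space \<Rightarrow> real"
  assumes "w \<in> H1" "0 < d"
  shows "\<bar>cube_average (d / 2) w x - cube_average d w x\<bar>
    \<le> 2 ^ DIM('a) * real DIM('a) * d * L2_norm (weak_grad w) / sqrt ((d / 2) ^ DIM('a))"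
proof -
  have w: "w \<in> L2" using assms H1_L2 by auto
  let ?c = "cube_average d w x"
  let ?D = "\<lambda>h. indicator (cube d) h * (w (x + h) - ?c)"
  let ?P = "2 ^ DIM('a) * real DIM('a) * d * L2_norm (weak_grad w)"
  let ?v = "(d / 2) ^ DIM('a)"
  have v: "0 < ?v" using assms(2) by simp
  have sub: "(cube (d / 2) :: 'a set) \<subseteq> cube d"
    using assms(2) by (force simp: mem_cube)
  have "cube_average (d / 2) w x - ?c = (\<integral>h. indicator (cube (d / 2)) h * (w (x + h) - ?c) \<partial>lborel) / ?v"
    using integral_cube_diff[OF w, of "d / 2" x ?c] assms(2) by simp
  also have "(\<integral>h. indicator (cube (d / 2)) h * (w (x + h) - ?c) \<partial>lborel) = (\<integral>h. indicator (cube (d / 2)) h * ?D h \<partial>lborel)"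
    using sub by (intro Bochner_Integration.integral_cong refl) (auto simp: indicator_def)
  finally have "\<bar>cube_average (d / 2) w x - ?c\<bar> = \<bar>\<integral>h. indicator (cube (d / 2)) h * ?D h \<partial>lborel\<bar> / ?v"
    using v by (simp add: abs_divide)
  also have "\<dots> \<le> sqrt ?v * ?P / ?v"
  proof (rule divide_right_mono)
    have "\<bar>\<integral>h. indicator (cube (d / 2)) h * ?D h \<partial>lborel\<bar> \<le> L2_norm (\<lambda>h::'a. indicator (cube (d / 2)) h :: real) * L2_norm ?D"
      by (rule L2_Cauchy_Schwarz_real[OF indicator_cube_L2 L2_norm_cube_Poincare(1)[OF assms]])
    also have "\<dots> = sqrt ?v * L2_norm ?D"
      using L2_norm_indicator_cube[of "d / 2", where 'a='a] assms(2) by simp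
    also have "\<dots> \<le> sqrt ?v * ?P"
      using v by (intro mult_left_mono L2_norm_cube_Poincare(2)[OF assms]) auto
    finally show "\<bar>\<integral>h. indicator (cube (d / 2)) h * ?D h \<partial>lborel\<bar> \<le> sqrt ?v * ?P" .
  qed (use v in simp)
  also have "\<dots> = ?P / sqrt ?v"
        using v by (rule sqrt_mult_divide)
  finally show ?thesis .
qed

text \<open>Telescoping over halvings, starting from the unit cube where Cauchy-Schwarz gives
  \<open>M\<close>. The rate \<open>r\<close> may exceed \<open>2 powr (N/2 - 1)\<close> because the
  geometric sum needs a ratio above 1, whereas that rate equals 1 for N = 2. In \<open>C\<close>,
  the last factor stems from the side of the halved cube, the others from the Poincare
  inequality.\<close>

lemma cube_average_dyadic_bound:
  fixes w :: "'a::euclidean_space \<Rightarrow> real"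
  assumes "w \<in> H1" "H1_norm w \<le> M" "1 < r" "2 powr (real DIM('a) / 2 - 1) \<le> r"
  defines "C \<equiv> 2 ^ DIM('a) * real DIM('a) * 2 powr (real DIM('a) / 2)"
  shows "\<bar>cube_average ((1 / 2) ^ k) w x\<bar> \<le> M * (1 + C / (r - 1)) * r ^ k"
proof -
  let ?N = "real DIM('a)"
  have M: "L2_norm w \<le> M" "L2_norm (weak_grad w) \<le> M" "0 \<le> M"
    using assms(2) L2_norm_le_H1_norm[of w] L2_norm_weak_grad_le_H1_norm[of w] H1_norm_nonneg[of w] by linarith+
  have C: "0 \<le> C" by (simp add: C_def)
  have step: "\<bar>cube_average ((1 / 2) ^ Suc j) w x - cube_average ((1 / 2) ^ j) w x\<bar> \<le> C * M * r ^ j" for j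
  proof -
    have "\<bar>cube_average ((1 / 2) ^ Suc j) w x - cube_average ((1 / 2) ^ j) w x\<bar>
        \<le> 2 ^ DIM('a) * ?N * (1 / 2) ^ j * L2_norm (weak_grad w) / sqrt (((1 / 2) ^ Suc j) ^ DIM('a))"
      using cube_average_halving[OF assms(1), of "(1 / 2) ^ j" x] by (simp add: mult.commute)
    also have "\<dots> \<le> 2 ^ DIM('a) * ?N * (1 / 2) ^ j * M / sqrt (((1 / 2) ^ Suc j) ^ DIM('a))"
      using M by (intro divide_right_mono mult_left_mono) auto
    also have "\<dots> = 2 ^ DIM('a) * ?N * M * ((1 / 2) ^ j / sqrt (((1 / 2) ^ Suc j) ^ DIM('a)))"
      by simp
    \<comment> \<open>The exponent -j + (j + 1) N/2 equals N/2 + j (N/2 - 1): a fixed constant times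
      the j-th power of the rate.\<close>
    also have "(1 / 2) ^ j / sqrt (((1 / 2) ^ Suc j) ^ DIM('a)) = 2 powr (?N / 2) * (2 powr (?N / 2 - 1)) ^ j"
    proof -
      have half: "(1 / 2 :: real) ^ n = 2 powr (- real n)" for n
        by (simp add: powr_minus powr_realpow power_one_over inverse_eq_divide)
      have "sqrt (((1 / 2) ^ Suc j) ^ DIM('a)) = 2 powr (- (real (Suc j) * ?N / 2))"
        unfolding half
        by (simp add: powr_half_sqrt[symmetric] powr_powr powr_power,
            rule arg_cong[where f="\<lambda>z. 2 powr z"], simp add: field_simps)
      then have "(1 / 2) ^ j / sqrt (((1 / 2) ^ Suc j) ^ DIM('a)) = 2 powr (- real j - - (real (Suc j) * ?N / 2))"
        by (simp only: half powr_diff)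
      also have "- real j - - (real (Suc j) * ?N / 2) = ?N / 2 + (?N / 2 - 1) * real j"
        by (simp add: field_simps)
      finally show ?thesis by (simp add: powr_add powr_power mult.commute[of "real j"])
    qed
    also have "2 ^ DIM('a) * ?N * M * (2 powr (?N / 2) * (2 powr (?N / 2 - 1)) ^ j)
        \<le> 2 ^ DIM('a) * ?N * M * (2 powr (?N / 2) * r ^ j)"
      using M assms(4) by (intro mult_left_mono power_mono) auto
    also have "\<dots> = C * M * r ^ j" by (simp add: C_def)
    finally show ?thesis .
  qed
  have "\<bar>cube_average ((1 / 2) ^ k) w x\<bar> \<le> M + C * M * ((r ^ k - 1) / (r - 1))"
  proof (induction k)
    case 0
    then show ?case using cube_average_le[OF H1_L2[OF assms(1)], of x] M by simp
  next
    case (Suc k)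
    have "M + C * M * ((r ^ k - 1) / (r - 1)) + C * M * r ^ k = M + C * M * ((r ^ Suc k - 1) / (r - 1))"
      using assms(3) by (simp add: field_simps)
    with Suc step[of k] show ?case by linarith
  qed
  also have "\<dots> \<le> M * r ^ k + C * M * (r ^ k / (r - 1))"
    using assms(3) M C by (intro add_mono mult_left_mono divide_right_mono) (auto simp: mult_le_cancel_left1)
  also have "\<dots> = M * (1 + C / (r - 1)) * r ^ k"
    by (simp add: algebra_simps)
  finally show ?thesis .
qed

section \<open>The subcritical Sobolev embedding\<close>

text \<open>On the level set \<open>2 B r\<^sup>k < |w| \<le> 2 B r\<^bsup>k+1\<^esup>\<close> the function is at least twice as large as its average
  over cubes of side \<open>2\<^bsup>-k\<^esup>\<close>, hence dominated there by its distance to this average.\<close>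

lemma le_suminf_ennreal: "f k \<le> (\<Sum>k. f k :: ennreal)"
  using sum_le_suminf[OF summableI, of "{k}" f] by simp

lemma powr_le_dyadic_averages:
  fixes a :: "nat \<Rightarrow> real"
  assumes "1 < r" "0 < B" "2 < q" and a: "\<And>k. \<bar>a k\<bar> \<le> B * r ^ k"
  shows "ennreal (\<bar>y\<bar> powr q) \<le> ennreal ((2 * B) powr (q - 2) * y\<^sup>2)
    + (\<Sum>k. ennreal (4 * (2 * B * r) powr (q - 2) * (r powr (q - 2)) ^ k * (a k - y)\<^sup>2))"
    (is "_ \<le> _ + suminf ?t")
proof -
  have split: "\<bar>y\<bar> powr q = \<bar>y\<bar> powr (q - 2) * y\<^sup>2"
    using powr_add[of "\<bar>y\<bar>" "q - 2" 2] by (cases "y = 0") (auto simp: powr_numeral)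
  show ?thesis
  proof (cases "\<bar>y\<bar> \<le> 2 * B")
    case True
    then have "\<bar>y\<bar> powr q \<le> (2 * B) powr (q - 2) * y\<^sup>2"
      unfolding split using assms by (intro mult_right_mono powr_mono2) auto
    then have "ennreal (\<bar>y\<bar> powr q) \<le> ennreal ((2 * B) powr (q - 2) * y\<^sup>2)" by (rule ennreal_leI)
    then show ?thesis by (rule add_increasing2[rotated]) simp
  next
    case False
    obtain n where "\<bar>y\<bar> / (2 * B) < r ^ n" using real_arch_pow[OF assms(1)] by blast
    then have ex: "\<bar>y\<bar> \<le> 2 * B * r ^ n" using assms(2) by (simp add: field_simps)
    \<comment> \<open>Minimality of \<open>m\<close> places \<open>y\<close> in one level set: with
      \<open>m = Suc k\<close>, the bound fails at k, so \<open>\<bar>y\<bar>\<close> exceeds twice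
      the bound on \<open>a k\<close>, and it holds at k + 1.\<close>
    define m where "m = (LEAST n. \<bar>y\<bar> \<le> 2 * B * r ^ n)"
    have m: "\<bar>y\<bar> \<le> 2 * B * r ^ m" unfolding m_def using ex by (rule LeastI)
    with False obtain k where k: "m = Suc k" by (cases m) auto
    have "\<not> \<bar>y\<bar> \<le> 2 * B * r ^ k" using not_less_Least[of k "\<lambda>n. \<bar>y\<bar> \<le> 2 * B * r ^ n"] k unfolding m_def by linarith
    moreover have "\<bar>y\<bar> - \<bar>a k\<bar> \<le> \<bar>a k - y\<bar>" by linarith
    moreover have "Y \<le> 2 * d" if "\<not> Y \<le> 2 * X" "Y - A \<le> d" "A \<le> X" for A X Y d :: real
      using that by linarith
    ultimately have "\<bar>y\<bar> \<le> 2 * \<bar>a k - y\<bar>" using a[of k] unfolding mult.assoc by blast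
    then have "\<bar>y\<bar>\<^sup>2 \<le> (2 * \<bar>a k - y\<bar>)\<^sup>2" by (intro power_mono) auto
    then have "y\<^sup>2 \<le> 4 * (a k - y)\<^sup>2" by (simp add: power_mult_distrib)
    moreover have "\<bar>y\<bar> powr (q - 2) \<le> (2 * B * r) powr (q - 2) * (r powr (q - 2)) ^ k"
    proof -
      have "\<bar>y\<bar> powr (q - 2) \<le> ((2 * B * r) * r ^ k) powr (q - 2)"
        using m k assms by (intro powr_mono2) (auto simp: mult_ac)
      also have "\<dots> = (2 * B * r) powr (q - 2) * (r powr (q - 2)) ^ k"
        using assms by (simp add: powr_mult powr_power mult.commute flip: powr_realpow)
           (simp add: powr_powr mult.commute)
      finally show ?thesis .
    qed
    ultimately have "\<bar>y\<bar> powr q \<le> ((2 * B * r) powr (q - 2) * (r powr (q - 2)) ^ k) * (4 * (a k - y)\<^sup>2)"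
      unfolding split by (intro mult_mono) auto
    then have "ennreal (\<bar>y\<bar> powr q) \<le> ?t k" by (intro ennreal_leI) (simp add: mult_ac)
    also have "\<dots> \<le> suminf ?t" by (rule le_suminf_ennreal)
    finally show ?thesis by (rule add_increasing[rotated]) simp
  qed
qed

text \<open>After integration the k-th level costs \<open>r powr (q - 2)\<close> to the power k from
  the height, while the squared L2-distance of \<open>w\<close> to its average gains 4^(-k). The
  hypothesis \<open>r powr (q - 2) < 4\<close> makes this a convergent geometric series.\<close>

lemma H1_Lq_bound_aux:
  fixes r q M :: real
  assumes "1 < r" "2 powr (real DIM('a) / 2 - 1) \<le> r" "r powr (q - 2) < 4" "2 < q" "0 < M"
  shows "\<exists>K\<ge>0. \<forall>w\<in>(H1 :: ('a::euclidean_space \<Rightarrow> real) set). H1_norm w \<le> M \<longrightarrow>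
    integrable lborel (\<lambda>x. \<bar>w x\<bar> powr q) \<and> (\<integral>x. \<bar>w x\<bar> powr q \<partial>lborel) \<le> K"
proof -
  define C where "C = 2 ^ DIM('a) * real DIM('a) * 2 powr (real DIM('a) / 2)"
  define B where "B = M * (1 + C / (r - 1))"
  have B: "0 < B" using assms by (auto simp: B_def C_def intro!: mult_pos_pos add_pos_nonneg)
  define c where "c = 4 * (2 * B * r) powr (q - 2)"
  define \<rho> where "\<rho> = r powr (q - 2)"
  have c: "0 \<le> c" by (simp add: c_def)
  have \<rho>: "0 \<le> \<rho>" "\<rho> / 4 < 1" using assms by (auto simp: \<rho>_def)
  define L where "L = c * (real DIM('a) * M)\<^sup>2"
  define K where "K = (2 * B) powr (q - 2) * M\<^sup>2 + L * (1 / (1 - \<rho> / 4))"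
  have K: "0 \<le> K" using c \<rho> by (auto simp: K_def L_def)
  have "integrable lborel (\<lambda>x. \<bar>w x\<bar> powr q) \<and> (\<integral>x. \<bar>w x\<bar> powr q \<partial>lborel) \<le> K"
    if w: "w \<in> H1" and wM: "H1_norm w \<le> M" for w :: "'a \<Rightarrow> real"
  proof -
    let ?a = "\<lambda>k x. cube_average ((1 / 2) ^ k) w x"
    have wL2: "w \<in> L2" using w H1_L2 by auto
    have dL2: "(\<lambda>x. ?a k x - w x) \<in> L2" for k using L2_norm_cube_average_diff(1)[OF w, of "(1/2)^k"] by simp
    have [measurable]: "w \<in> borel_measurable borel" "(\<lambda>x. ?a k x - w x) \<in> borel_measurable borel" for k
      using wL2 dL2 by auto
    have M: "L2_norm w \<le> M" "L2_norm (weak_grad w) \<le> M"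
      using wM L2_norm_le_H1_norm[of w] L2_norm_weak_grad_le_H1_norm[of w] by linarith+
    have bound: "\<bar>?a k x\<bar> \<le> B * r ^ k" for k x
      using cube_average_dyadic_bound[OF w wM assms(1,2), of k x] by (simp add: B_def C_def)
    have "(\<integral>\<^sup>+x. ennreal (\<bar>w x\<bar> powr q) \<partial>lborel)
        \<le> (\<integral>\<^sup>+x. ennreal ((2 * B) powr (q - 2) * (w x)\<^sup>2) + (\<Sum>k. ennreal (c * \<rho> ^ k * (?a k x - w x)\<^sup>2)) \<partial>lborel)"
      unfolding c_def \<rho>_def by (intro nn_integral_mono powr_le_dyadic_averages assms B bound)
    also have "\<dots> = (\<integral>\<^sup>+x. ennreal ((2 * B) powr (q - 2) * (w x)\<^sup>2) \<partial>lborel)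
        + (\<Sum>k. \<integral>\<^sup>+x. ennreal (c * \<rho> ^ k * (?a k x - w x)\<^sup>2) \<partial>lborel)"
      by (subst nn_integral_add) (auto simp: nn_integral_suminf)
    also have "\<dots> \<le> ennreal ((2 * B) powr (q - 2) * M\<^sup>2) + (\<Sum>k. ennreal (L * (\<rho> / 4) ^ k))"
    proof (intro add_mono suminf_le)
      have "(\<integral>\<^sup>+x. ennreal ((2 * B) powr (q - 2) * (w x)\<^sup>2) \<partial>lborel) = ennreal ((2 * B) powr (q - 2) * (L2_norm w)\<^sup>2)"
        using nn_integral_L2[OF wL2] by (simp add: ennreal_mult nn_integral_cmult)
      also have "\<dots> \<le> ennreal ((2 * B) powr (q - 2) * M\<^sup>2)"
        using M by (intro ennreal_leI mult_left_mono power_mono) auto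
      finally show "(\<integral>\<^sup>+x. ennreal ((2 * B) powr (q - 2) * (w x)\<^sup>2) \<partial>lborel) \<le> ennreal ((2 * B) powr (q - 2) * M\<^sup>2)" .
      fix k
      have "(\<integral>\<^sup>+x. ennreal (c * \<rho> ^ k * (?a k x - w x)\<^sup>2) \<partial>lborel) = ennreal (c * \<rho> ^ k * (L2_norm (\<lambda>x. ?a k x - w x))\<^sup>2)"
        using nn_integral_L2[OF dL2[of k]] c \<rho> by (simp add: ennreal_mult nn_integral_cmult)
      also have "\<dots> \<le> ennreal (c * \<rho> ^ k * (real DIM('a) * (1 / 2) ^ k * M)\<^sup>2)"
      proof (intro ennreal_leI mult_left_mono power_mono)
        have "L2_norm (\<lambda>x. ?a k x - w x) \<le> real DIM('a) * (1 / 2) ^ k * L2_norm (weak_grad w)"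
          by (rule L2_norm_cube_average_diff(2)[OF w]) simp
        also have "\<dots> \<le> real DIM('a) * (1 / 2) ^ k * M" using M by (intro mult_left_mono) auto
        finally show "L2_norm (\<lambda>x. ?a k x - w x) \<le> real DIM('a) * (1 / 2) ^ k * M" .
      qed (use c \<rho> in auto)
      also have "c * \<rho> ^ k * (real DIM('a) * (1 / 2) ^ k * M)\<^sup>2 = L * (\<rho> / 4) ^ k"
      proof -
        have "((1 / 2 :: real) ^ k)\<^sup>2 = (1 / 4) ^ k"
          by (simp add: power2_eq_square flip: power_mult_distrib)
        moreover have "(\<rho> / 4) ^ k = \<rho> ^ k * (1 / 4) ^ k" by (simp add: power_divide)
        ultimately show ?thesis by (simp add: L_def power_mult_distrib)
      qed
      finally show "(\<integral>\<^sup>+x. ennreal (c * \<rho> ^ k * (?a k x - w x)\<^sup>2) \<partial>lborel) \<le> ennreal (L * (\<rho> / 4) ^ k)" .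
    qed auto
    also have "(\<Sum>k. ennreal (L * (\<rho> / 4) ^ k)) = ennreal (L * (1 / (1 - \<rho> / 4)))"
    proof (rule suminf_ennreal_eq)
      show "0 \<le> L * (\<rho> / 4) ^ k" for k using c \<rho> by (simp add: L_def)
      show "(\<lambda>k. L * (\<rho> / 4) ^ k) sums (L * (1 / (1 - \<rho> / 4)))"
        using \<rho> by (intro sums_mult geometric_sums) auto
    qed
    also have "ennreal ((2 * B) powr (q - 2) * M\<^sup>2) + \<dots> = ennreal K"
      using c \<rho> by (subst ennreal_plus[symmetric]) (auto simp: K_def L_def)
    finally have le: "(\<integral>\<^sup>+x. ennreal (\<bar>w x\<bar> powr q) \<partial>lborel) \<le> ennreal K" .
    have int: "integrable lborel (\<lambda>x. \<bar>w x\<bar> powr q)"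
      using le by (intro integrableI_bounded) (auto simp: less_top[symmetric] top_unique)
    moreover have "(\<integral>x. \<bar>w x\<bar> powr q \<partial>lborel) \<le> K"
      using le K nn_integral_eq_integral[OF int] by simp
    ultimately show ?thesis by simp
  qed
  with K show ?thesis by blast
qed

definition sobolev_subcritical :: "nat \<Rightarrow> real \<Rightarrow> bool" where
  "sobolev_subcritical N q \<longleftrightarrow> 2 < q \<and> (3 \<le> N \<longrightarrow> q < 2 * real N / (real N - 2))"

text \<open>With r = 2^s the last condition is s (q - 2) < 2; at s = N/2 - 1 and N at least 3 this
  is the inequality q < 2N/(N - 2).\<close>

lemma sobolev_subcritical_powr:
  assumes "sobolev_subcritical N q"
  obtains r where "1 < r" "2 powr (real N / 2 - 1) \<le> r" "r powr (q - 2) < 4"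
proof
  \<comment> \<open>The alternative \<open>1 / (q - 2)\<close> keeps \<open>s\<close> positive when
    N/2 - 1 is not, and makes s (q - 2) equal to 1, still below 2.\<close>
  define s where "s = max (real N / 2 - 1) (1 / (q - 2))"
  have q: "2 < q" using assms by (simp add: sobolev_subcritical_def)
  have s: "0 < s" using q by (simp add: s_def less_max_iff_disj)
  have "(real N / 2 - 1) * (q - 2) < 2"
  proof (cases "3 \<le> N")
    case True
    then have "q * (real N - 2) < 2 * real N"
      using assms by (auto simp: sobolev_subcritical_def pos_less_divide_eq)
    then show ?thesis by (simp add: algebra_simps)
  next
    case False
    then have "(real N / 2 - 1) * (q - 2) \<le> 0" using q by (intro mult_nonpos_nonneg) auto
    then show ?thesis by simp
  qed
  then have "s * (q - 2) < 2" using q by (auto simp: s_def max_def)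
  then have "2 powr (s * (q - 2)) < 2 powr 2" by (intro powr_less_mono) auto
  then show "(2 powr s) powr (q - 2) < 4" by (simp add: powr_powr)
  show "1 < 2 powr s" using s by simp
  show "2 powr (real N / 2 - 1) \<le> 2 powr s" by (intro powr_mono) (auto simp: s_def)
qed

lemma H1_Lq_bound:
  fixes q M :: real
  assumes "sobolev_subcritical DIM('a) q"
  obtains K where "0 \<le> K"
    "\<And>w :: 'a::euclidean_space \<Rightarrow> real. w \<in> H1 \<Longrightarrow> H1_norm w \<le> M \<Longrightarrow> integrable lborel (\<lambda>x. \<bar>w x\<bar> powr q)"
    "\<And>w :: 'a \<Rightarrow> real. w \<in> H1 \<Longrightarrow> H1_norm w \<le> M \<Longrightarrow> (\<integral>x. \<bar>w x\<bar> powr q \<partial>lborel) \<le> K"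
proof -
  obtain r where r: "1 < r" "2 powr (real DIM('a) / 2 - 1) \<le> r" "r powr (q - 2) < 4"
    using sobolev_subcritical_powr[OF assms] by metis
  have "2 < q" using assms by (simp add: sobolev_subcritical_def)
  \<comment> \<open>The auxiliary bound needs a positive radius, while \<open>M\<close> is arbitrary
    here.\<close>
  have M: "0 < max M 1" by simp
  from H1_Lq_bound_aux[OF r \<open>2 < q\<close> M]
  obtain K where "0 \<le> K" and K: "\<And>w :: 'a \<Rightarrow> real. w \<in> H1 \<Longrightarrow> H1_norm w \<le> max M 1 \<Longrightarrow>
      integrable lborel (\<lambda>x. \<bar>w x\<bar> powr q) \<and> (\<integral>x. \<bar>w x\<bar> powr q \<partial>lborel) \<le> K"
    by blast
  then show thesis by (intro that[of K]) (simp_all add: le_max_iff_disj)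
qed

lemma H1_integrable_powr:
  fixes w :: "'a::euclidean_space \<Rightarrow> real"
  assumes "sobolev_subcritical DIM('a) q" "w \<in> H1"
  shows "integrable lborel (\<lambda>x. \<bar>w x\<bar> powr q)"
  using H1_Lq_bound[OF assms(1), of "H1_norm w"] assms(2) by blast

text \<open>Provides the spare exponent against which L2-smallness is interpolated.\<close>

lemma sobolev_subcritical_open:
  assumes "sobolev_subcritical N q"
  obtains q' where "q < q'" "sobolev_subcritical N q'"
proof (cases "3 \<le> N")
  case True
  then obtain q' where "q < q'" "q' < 2 * real N / (real N - 2)"
    using assms dense unfolding sobolev_subcritical_def by blast
  then show ?thesis using that assms by (auto simp: sobolev_subcritical_def)
next
  case False
  then show ?thesis using that[of "q + 1"] assms by (auto simp: sobolev_subcritical_def)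
qed

text \<open>Interpolation by splitting at a height \<open>R\<close>: below it the q-th power is at
  most R^(q - 2) times the square, above it at most R^(q - q') times the power q'. A large
  \<open>R\<close> makes the second part small, and then \<open>\<delta>\<close> the first.\<close>

lemma H1_Lq_small:
  fixes q M \<epsilon> :: real
  assumes "sobolev_subcritical DIM('a) q" "0 < \<epsilon>"
  obtains \<delta> where "0 < \<delta>"
    "\<And>w :: 'a::euclidean_space \<Rightarrow> real. w \<in> H1 \<Longrightarrow> H1_norm w \<le> M \<Longrightarrow> L2_norm w \<le> \<delta>
      \<Longrightarrow> (\<integral>x. \<bar>w x\<bar> powr q \<partial>lborel) \<le> \<epsilon>"
proof -
  obtain q' where q': "q < q'" "sobolev_subcritical DIM('a) q'" using sobolev_subcritical_open[OF assms(1)] by metis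
  have q: "2 < q" using assms by (simp add: sobolev_subcritical_def)
  obtain K where K: "0 \<le> K" 
    "\<And>w :: 'a \<Rightarrow> real. w \<in> H1 \<Longrightarrow> H1_norm w \<le> M \<Longrightarrow> integrable lborel (\<lambda>x. \<bar>w x\<bar> powr q')"
    "\<And>w :: 'a \<Rightarrow> real. w \<in> H1 \<Longrightarrow> H1_norm w \<le> M \<Longrightarrow> (\<integral>x. \<bar>w x\<bar> powr q' \<partial>lborel) \<le> K"
    using H1_Lq_bound[OF q'(2), of M] by metis
  \<comment> \<open>Solves R^(q - q') (K + 1) = \<epsilon>/2, the exponent being negative;
    \<open>K + 1\<close> avoids a zero denominator. Below, \<open>\<delta>\<close> makes the other
    part \<epsilon>/2.\<close>
  define R where "R = (\<epsilon> / (2 * (K + 1))) powr (1 / (q - q'))"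
  have R: "0 < R" "R powr (q - q') = \<epsilon> / (2 * (K + 1))"
    using assms(2) K(1) q'(1) by (auto simp: R_def powr_powr)
  define \<delta> where "\<delta> = sqrt (\<epsilon> / (2 * R powr (q - 2)))"
  have \<delta>: "0 < \<delta>" "R powr (q - 2) * \<delta>\<^sup>2 = \<epsilon> / 2" using assms(2) R by (auto simp: \<delta>_def)
  show thesis
  proof (rule that[OF \<delta>(1)])
    fix w :: "'a \<Rightarrow> real" assume w: "w \<in> H1" "H1_norm w \<le> M" "L2_norm w \<le> \<delta>"
    have wL2: "w \<in> L2" using w H1_L2 by auto
    have pw: "\<bar>y\<bar> powr q \<le> R powr (q - 2) * y\<^sup>2 + R powr (q - q') * \<bar>y\<bar> powr q'" for y :: real
    proof (cases "\<bar>y\<bar> \<le> R")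
      case True
      have "\<bar>y\<bar> powr q = \<bar>y\<bar> powr (q - 2) * y\<^sup>2"
        using powr_add[of "\<bar>y\<bar>" "q - 2" 2] by (cases "y = 0") (auto simp: powr_numeral)
      also have "\<dots> \<le> R powr (q - 2) * y\<^sup>2"
        using True q by (intro mult_right_mono powr_mono2) auto
      finally show ?thesis by (simp add: add_increasing2)
    next
      case False
      have "\<bar>y\<bar> powr q = \<bar>y\<bar> powr (q - q') * \<bar>y\<bar> powr q'" by (simp flip: powr_add)
      also have "\<dots> \<le> R powr (q - q') * \<bar>y\<bar> powr q'"
        using False q'(1) R by (intro mult_right_mono powr_mono2') auto
      finally show ?thesis by (simp add: add_increasing)
    qed
    have "(\<integral>x. \<bar>w x\<bar> powr q \<partial>lborel) \<le> (\<integral>x. R powr (q - 2) * (norm (w x))\<^sup>2 + R powr (q - q') * \<bar>w x\<bar> powr q' \<partial>lborel)"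
      using K(2)[OF w(1,2)] L2_integrable_power2[OF wL2] H1_integrable_powr[OF assms(1) w(1)] pw
      by (intro integral_mono) auto
    also have "\<dots> = R powr (q - 2) * (L2_norm w)\<^sup>2 + R powr (q - q') * (\<integral>x. \<bar>w x\<bar> powr q' \<partial>lborel)"
      using K(2)[OF w(1,2)] L2_integrable_power2[OF wL2] unfolding L2_norm_power2 by simp
    also have "\<dots> \<le> R powr (q - 2) * \<delta>\<^sup>2 + \<epsilon> / (2 * (K + 1)) * (K + 1)"
      unfolding R(2) using w(3) K(1) K(3)[OF w(1,2)] assms(2)
      by (intro add_mono mult_left_mono power_mono) auto
    also have "\<dots> = \<epsilon>" using \<delta>(2) K(1) by (simp add: field_simps)
    finally show "(\<integral>x. \<bar>w x\<bar> powr q \<partial>lborel) \<le> \<epsilon>" .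
  qed
qed


lemma H1_measurable [measurable_dest]: "w \<in> H1 \<Longrightarrow> w \<in> borel_measurable borel"
  by (rule L2_measurable[OF H1_L2])

section \<open>Continuity of nonlinearity, energy and residual under L2-closeness\<close>

section \<open>Homogeneous nonlinearities\<close>

text \<open>Covers \<open>NL p\<close> (degree p + 1) and \<open>nl p\<close> (degree p) at once. By
  homogeneity, continuity at 1 and -1 is all that is needed for difference estimates.\<close>

definition homogeneous_nonlinearity :: "real \<Rightarrow> (real \<Rightarrow> real) \<Rightarrow> bool" where
  "homogeneous_nonlinearity q F \<longleftrightarrow> F \<in> borel_measurable borel \<and>
     (\<forall>c>0. \<forall>x. F (c * x) = c powr q * F x) \<and> (\<forall>x. \<bar>F x\<bar> \<le> \<bar>x\<bar> powr q) \<and>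
     isCont F 1 \<and> isCont F (-1)"

text \<open>Rescale to b = 1 or b = -1. If a is close to b relative to \<open>\<bar>b\<bar>\<close>,
  continuity there gives the first term; otherwise both numbers are bounded by a multiple of their
  distance and the growth bound gives the second.\<close>

lemma homogeneous_nonlinearity_diff_bound:
  assumes "homogeneous_nonlinearity q F" "0 < q" "0 < \<epsilon>"
  obtains C where "0 \<le> C" "\<And>a b. \<bar>F a - F b\<bar> \<le> \<epsilon> * \<bar>b\<bar> powr q + C * \<bar>a - b\<bar> powr q"
proof -
  have hom: "\<And>c x. 0 < c \<Longrightarrow> F (c * x) = c powr q * F x" and bd: "\<And>x. \<bar>F x\<bar> \<le> \<bar>x\<bar> powr q"
    and cont: "isCont F 1" "isCont F (-1)"
    using assms(1) by (auto simp: homogeneous_nonlinearity_def)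
  obtain d1 where d1: "0 < d1" "\<And>t. \<bar>t - 1\<bar> < d1 \<Longrightarrow> \<bar>F t - F 1\<bar> < \<epsilon>"
    using cont(1) assms(3) unfolding continuous_at_eps_delta dist_real_def by metis
  obtain d2 where d2: "0 < d2" "\<And>t. \<bar>t - (-1)\<bar> < d2 \<Longrightarrow> \<bar>F t - F (-1)\<bar> < \<epsilon>"
    using cont(2) assms(3) unfolding continuous_at_eps_delta dist_real_def by metis
  define d where "d = min d1 d2"
  have d: "0 < d" using d1 d2 by (simp add: d_def)
  \<comment> \<open>In the second case \<open>\<bar>b\<bar> \<le> \<bar>a - b\<bar> / d\<close>,
    hence \<open>\<bar>a\<bar> \<le> (1 + 1 / d) * \<bar>a - b\<bar>\<close>; the two summands bound
    \<open>F a\<close> and \<open>F b\<close>.\<close>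
  define C where "C = (1 + 1 / d) powr q + (1 / d) powr q"
  show thesis
  proof (rule that[of C])
    show "0 \<le> C" by (simp add: C_def)
    fix a b
    show "\<bar>F a - F b\<bar> \<le> \<epsilon> * \<bar>b\<bar> powr q + C * \<bar>a - b\<bar> powr q"
    proof (cases "\<bar>a - b\<bar> < d * \<bar>b\<bar>")
      case True
      then have b: "0 < \<bar>b\<bar>" using d by (cases "b = 0") auto
      have F: "F x = \<bar>b\<bar> powr q * F (x / \<bar>b\<bar>)" for x using hom[OF b, of "x / \<bar>b\<bar>"] b by simp
      have "\<bar>a / \<bar>b\<bar> - sgn b\<bar> = \<bar>a - b\<bar> / \<bar>b\<bar>"
        using b by (simp add: sgn_if abs_if field_simps)
      also have "\<dots> < d" using True b by (simp add: pos_divide_less_eq)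
      finally have "\<bar>F (a / \<bar>b\<bar>) - F (sgn b)\<bar> \<le> \<epsilon>"
        using d1(2)[of "a / \<bar>b\<bar>"] d2(2)[of "a / \<bar>b\<bar>"] b by (auto simp: d_def sgn_if split: if_splits)
      moreover have "b / \<bar>b\<bar> = sgn b" using b by (simp add: sgn_if abs_if)
      ultimately have "\<bar>F a - F b\<bar> \<le> \<bar>b\<bar> powr q * \<epsilon>"
        unfolding F[of a] F[of b] by (simp add: abs_mult mult_left_mono flip: right_diff_distrib)
      moreover have "0 \<le> C * \<bar>a - b\<bar> powr q" by (simp add: C_def)
      ultimately show ?thesis by (simp add: mult.commute)
    next
      case False
      then have b: "\<bar>b\<bar> \<le> 1 / d * \<bar>a - b\<bar>" using d by (simp add: field_simps)
      then have a: "\<bar>a\<bar> \<le> (1 + 1 / d) * \<bar>a - b\<bar>" by (simp add: algebra_simps)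
      have "\<bar>F a - F b\<bar> \<le> \<bar>a\<bar> powr q + \<bar>b\<bar> powr q" using bd[of a] bd[of b] by linarith
      also have "\<dots> \<le> ((1 + 1 / d) * \<bar>a - b\<bar>) powr q + (1 / d * \<bar>a - b\<bar>) powr q"
        using a b assms(2) by (intro add_mono powr_mono2) auto
      also have "((1 + 1 / d) * \<bar>a - b\<bar>) powr q = (1 + 1 / d) powr q * \<bar>a - b\<bar> powr q"
        by (rule powr_mult)
      also have "(1 / d * \<bar>a - b\<bar>) powr q = (1 / d) powr q * \<bar>a - b\<bar> powr q"
        by (rule powr_mult)
      also have "(1 + 1 / d) powr q * \<bar>a - b\<bar> powr q + (1 / d) powr q * \<bar>a - b\<bar> powr q = C * \<bar>a - b\<bar> powr q"
        by (simp only: C_def distrib_right)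
      finally show ?thesis using assms(3) by (simp add: add_increasing)
    qed
  qed
qed

lemma integrable_homogeneous_nonlinearity:
  fixes w :: "'a::euclidean_space \<Rightarrow> real"
  assumes "homogeneous_nonlinearity q F" "sobolev_subcritical DIM('a) q" "w \<in> H1"
    and "\<psi> \<in> borel_measurable borel" "\<And>x. \<bar>\<psi> x\<bar> \<le> B"
  shows "integrable lborel (\<lambda>x. F (w x) * \<psi> x)"
proof -
  have [measurable]: "F \<in> borel_measurable borel" "w \<in> borel_measurable borel" "\<psi> \<in> borel_measurable borel"
    using assms H1_measurable by (auto simp: homogeneous_nonlinearity_def)
  show ?thesis
  proof (rule Bochner_Integration.integrable_bound)
    show "integrable lborel (\<lambda>x. B * \<bar>w x\<bar> powr q)"
      using H1_integrable_powr[OF assms(2,3)] by simp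
    have "\<bar>F (w x) * \<psi> x\<bar> \<le> \<bar>B * \<bar>w x\<bar> powr q\<bar>" for x
    proof -
      have "\<bar>F (w x)\<bar> * \<bar>\<psi> x\<bar> \<le> \<bar>w x\<bar> powr q * B"
        using assms(1,5) by (intro mult_mono) (auto simp: homogeneous_nonlinearity_def)
      also have "\<dots> \<le> \<bar>B * \<bar>w x\<bar> powr q\<bar>"
        using abs_ge_self[of "B * \<bar>w x\<bar> powr q"] by (simp only: mult.commute)
      finally show ?thesis by (simp only: abs_mult[of "F (w x)"])
    qed
    then show "AE x in lborel. norm (F (w x) * \<psi> x) \<le> norm (B * \<bar>w x\<bar> powr q)" by simp
  qed measurable
qed

lemma L2_norm_diff_le:
  fixes f g :: "'a::euclidean_space \<Rightarrow> 'b::euclidean_space"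
  assumes "f \<in> L2" "g \<in> L2"
  shows "L2_norm (\<lambda>x. f x - g x) \<le> L2_norm f + L2_norm g"
  using L2_norm_triangle[of f "\<lambda>x. - g x"] L2_uminus[of g] assms L2_norm_scaleR[of "-1" g] by simp

lemma H1_norm_diff_le:
  assumes "w \<in> H1" "w' \<in> H1"
  shows "H1_norm (\<lambda>x. w x - w' x) \<le> H1_norm w + H1_norm w'"
proof -
  have "H1_norm (\<lambda>x. w x - w' x) \<le> sqrt ((L2_norm (weak_grad w) + L2_norm (weak_grad w'))\<^sup>2
      + (L2_norm w + L2_norm w')\<^sup>2)"
    unfolding H1_norm_def L2_norm_weak_grad_diff[OF assms]
    by (intro real_sqrt_le_mono add_mono power_mono L2_norm_diff_le weak_grad_L2 H1_L2 assms) auto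
  also have "\<dots> \<le> H1_norm w + H1_norm w'"
    unfolding H1_norm_def by (rule real_sqrt_sum_squares_triangle_ineq)
  finally show ?thesis .
qed

text \<open>In the pointwise difference bound the first term is paid by the uniform Lq bound, the
  second by Lq-smallness of the difference. Only the sup bound of the weight enters, so
  \<open>\<delta>\<close> serves all translates of a test function as well as the weight 1 of the
  potential energy.\<close>

lemma H1_nonlinearity_uniformly_continuous:
  fixes M B \<epsilon> q :: real
  assumes F: "homogeneous_nonlinearity q F" and sub: "sobolev_subcritical DIM('a) q" and "0 < \<epsilon>" "0 \<le> B"
  shows "\<exists>\<delta>>0. \<forall>w\<in>(H1 :: ('a::euclidean_space \<Rightarrow> real) set). \<forall>w'\<in>H1. \<forall>\<psi>\<in>borel_measurable borel.
    H1_norm w \<le> M \<longrightarrow> H1_norm w' \<le> M \<longrightarrow> L2_norm (\<lambda>x. w x - w' x) \<le> \<delta> \<longrightarrow> (\<forall>x. \<bar>\<psi> x\<bar> \<le> B) \<longrightarrow>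
      \<bar>(\<integral>x. F (w x) * \<psi> x \<partial>lborel) - (\<integral>x. F (w' x) * \<psi> x \<partial>lborel)\<bar> \<le> \<epsilon>"
proof -
  obtain K where K: "0 \<le> K"
    "\<And>w :: 'a \<Rightarrow> real. w \<in> H1 \<Longrightarrow> H1_norm w \<le> M \<Longrightarrow> (\<integral>x. \<bar>w x\<bar> powr q \<partial>lborel) \<le> K"
    using H1_Lq_bound[OF sub, of M] by metis
  have cancel: "b * (e / (2 * b * k) * k) = e / 2" if "b \<noteq> 0" "k \<noteq> 0" for e b k :: real
    using that by simp
  \<comment> \<open>\<open>\<epsilon>1\<close> and \<open>\<epsilon>2\<close> make the two
    contributions \<epsilon>/2 each; the added ones exclude zero denominators. The radius
    \<open>2 * M\<close> used for \<open>\<delta>\<close> bounds the difference of two functions of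
    norm at most \<open>M\<close>.\<close>
  define \<epsilon>1 where "\<epsilon>1 = \<epsilon> / (2 * (B + 1) * (K + 1))"
  have \<epsilon>1: "0 < \<epsilon>1" using assms K by (simp add: \<epsilon>1_def)
  have q: "0 < q" using sub by (simp add: sobolev_subcritical_def)
  obtain C where C: "0 \<le> C" "\<And>a b. \<bar>F a - F b\<bar> \<le> \<epsilon>1 * \<bar>b\<bar> powr q + C * \<bar>a - b\<bar> powr q"
    using homogeneous_nonlinearity_diff_bound[OF F q \<epsilon>1] by metis
  define \<epsilon>2 where "\<epsilon>2 = \<epsilon> / (2 * (B + 1) * (C + 1))"
  have \<epsilon>2: "0 < \<epsilon>2" using assms C by (simp add: \<epsilon>2_def)
  obtain \<delta> where \<delta>: "0 < \<delta>" "\<And>w :: 'a \<Rightarrow> real. w \<in> H1 \<Longrightarrow> H1_norm w \<le> 2 * M \<Longrightarrow> L2_norm w \<le> \<delta>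
      \<Longrightarrow> (\<integral>x. \<bar>w x\<bar> powr q \<partial>lborel) \<le> \<epsilon>2"
    using H1_Lq_small[OF sub \<epsilon>2, of "2 * M"] by metis
  show ?thesis
  proof (intro exI[of _ \<delta>] conjI ballI impI \<delta>(1))
    fix w w' \<psi> :: "'a \<Rightarrow> real"
    assume w: "w \<in> H1" "H1_norm w \<le> M" and w': "w' \<in> H1" "H1_norm w' \<le> M"
      and close: "L2_norm (\<lambda>x. w x - w' x) \<le> \<delta>"
      and \<psi>m: "\<psi> \<in> borel_measurable borel" and \<psi>B: "\<forall>x. \<bar>\<psi> x\<bar> \<le> B"
    have [measurable]: "F \<in> borel_measurable borel" using F by (simp add: homogeneous_nonlinearity_def)
    have d: "(\<lambda>x. w x - w' x) \<in> H1" by (rule H1_diff[OF w(1) w'(1)])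
    have dM: "H1_norm (\<lambda>x. w x - w' x) \<le> 2 * M" using H1_norm_diff_le[OF w(1) w'(1)] w w' by simp
    have i1: "integrable lborel (\<lambda>x. F (w x) * \<psi> x)" and i2: "integrable lborel (\<lambda>x. F (w' x) * \<psi> x)"
      by (rule integrable_homogeneous_nonlinearity[OF F sub _ \<psi>m \<psi>B[rule_format]], fact)+
    have j1: "integrable lborel (\<lambda>x. \<bar>w' x\<bar> powr q)" and j2: "integrable lborel (\<lambda>x. \<bar>w x - w' x\<bar> powr q)"
      using H1_integrable_powr[OF sub w'(1)] H1_integrable_powr[OF sub d] by auto
    have "\<bar>(\<integral>x. F (w x) * \<psi> x \<partial>lborel) - (\<integral>x. F (w' x) * \<psi> x \<partial>lborel)\<bar>
        = \<bar>\<integral>x. F (w x) * \<psi> x - F (w' x) * \<psi> x \<partial>lborel\<bar>"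
      using i1 i2 by simp
    also have "\<dots> \<le> (\<integral>x. \<bar>F (w x) * \<psi> x - F (w' x) * \<psi> x\<bar> \<partial>lborel)"
      by (rule integral_abs_bound)
    also have "\<dots> \<le> (\<integral>x. B * (\<epsilon>1 * \<bar>w' x\<bar> powr q + C * \<bar>w x - w' x\<bar> powr q) \<partial>lborel)"
    proof (rule integral_mono)
      show "integrable lborel (\<lambda>x. \<bar>F (w x) * \<psi> x - F (w' x) * \<psi> x\<bar>)" using i1 i2 by simp
      show "integrable lborel (\<lambda>x. B * (\<epsilon>1 * \<bar>w' x\<bar> powr q + C * \<bar>w x - w' x\<bar> powr q))"
        using j1 j2 by simp
      fix x
      have "\<bar>F (w x) * \<psi> x - F (w' x) * \<psi> x\<bar> = \<bar>\<psi> x\<bar> * \<bar>F (w x) - F (w' x)\<bar>"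
        by (simp add: abs_mult[symmetric] algebra_simps)
      also have "\<dots> \<le> B * (\<epsilon>1 * \<bar>w' x\<bar> powr q + C * \<bar>w x - w' x\<bar> powr q)"
        by (rule mult_mono) (use \<psi>B C assms in auto)
      finally show "\<bar>F (w x) * \<psi> x - F (w' x) * \<psi> x\<bar> \<le> B * (\<epsilon>1 * \<bar>w' x\<bar> powr q + C * \<bar>w x - w' x\<bar> powr q)" .
    qed
    also have "\<dots> = B * (\<epsilon>1 * (\<integral>x. \<bar>w' x\<bar> powr q \<partial>lborel) + C * (\<integral>x. \<bar>w x - w' x\<bar> powr q \<partial>lborel))"
      using j1 j2 by simp
    also have "\<dots> \<le> (B + 1) * (\<epsilon>1 * (K + 1) + (C + 1) * \<epsilon>2)"
    proof (rule mult_mono)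
      have "\<epsilon>1 * (\<integral>x. \<bar>w' x\<bar> powr q \<partial>lborel) \<le> \<epsilon>1 * (K + 1)"
        using K(2)[OF w'] \<epsilon>1 by (intro mult_left_mono) auto
      moreover have "C * (\<integral>x. \<bar>w x - w' x\<bar> powr q \<partial>lborel) \<le> (C + 1) * \<epsilon>2"
        using \<delta>(2)[OF d dM close] C \<epsilon>2 by (intro mult_mono) auto
      ultimately show "\<epsilon>1 * (\<integral>x. \<bar>w' x\<bar> powr q \<partial>lborel) + C * (\<integral>x. \<bar>w x - w' x\<bar> powr q \<partial>lborel)
          \<le> \<epsilon>1 * (K + 1) + (C + 1) * \<epsilon>2" by simp
      have "0 \<le> (\<integral>x. \<bar>w' x\<bar> powr q \<partial>lborel)" "0 \<le> (\<integral>x. \<bar>w x - w' x\<bar> powr q \<partial>lborel)"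
        by simp_all
      then show "0 \<le> \<epsilon>1 * (\<integral>x. \<bar>w' x\<bar> powr q \<partial>lborel) + C * (\<integral>x. \<bar>w x - w' x\<bar> powr q \<partial>lborel)"
        using C(1) \<epsilon>1 by simp
      show "B \<le> B + 1" "0 \<le> B + 1" using assms by auto
    qed
    also have "\<dots> = (B + 1) * (\<epsilon>1 * (K + 1)) + (B + 1) * ((C + 1) * \<epsilon>2)"
      by (rule distrib_left)
    also have "(B + 1) * (\<epsilon>1 * (K + 1)) = \<epsilon> / 2"
      unfolding \<epsilon>1_def using assms K(1) by (intro cancel) auto
    also have "(B + 1) * ((C + 1) * \<epsilon>2) = \<epsilon> / 2"
      unfolding \<epsilon>2_def mult.commute[of "C + 1"] using assms C(1) by (intro cancel) auto
    finally show "\<bar>(\<integral>x. F (w x) * \<psi> x \<partial>lborel) - (\<integral>x. F (w' x) * \<psi> x \<partial>lborel)\<bar> \<le> \<epsilon>" by simp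
  qed
qed

lemma homogeneous_nonlinearity_NL:
  assumes "2 < p"
  shows "homogeneous_nonlinearity (p + 1) (NL p)"
proof -
  have "NL p (c * x) = c powr (p + 1) * NL p x" if "0 < c" for c x
    using that by (simp add: NL_def abs_mult powr_mult)
  moreover have "\<bar>NL p x\<bar> \<le> \<bar>x\<bar> powr (p + 1)" for x
    using assms mult_left_mono[of 1 "p + 1" "\<bar>x\<bar> powr (p + 1)"]
    by (simp add: NL_def abs_divide pos_divide_le_eq)
  moreover have "NL p \<in> borel_measurable borel" unfolding NL_def by measurable
  moreover have "isCont (NL p) 1" "isCont (NL p) (-1)"
    using assms unfolding NL_def by (auto intro!: continuous_intros)
  ultimately show ?thesis by (simp add: homogeneous_nonlinearity_def)
qed

lemma homogeneous_nonlinearity_nl: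
  assumes "2 < p"
  shows "homogeneous_nonlinearity p (nl p)"
proof -
  have pow: "c powr (p - 1) * c = c powr p" if "0 \<le> c" for c :: real
    using powr_add[of c "p - 1" 1] that by (cases "c = 0") auto
  have "nl p (c * x) = c powr p * nl p x" if "0 < c" for c x
    using that pow[of c] by (simp add: nl_def abs_mult powr_mult flip: pow)
  moreover have "\<bar>nl p x\<bar> \<le> \<bar>x\<bar> powr p" for x
    using pow[of "\<bar>x\<bar>"] by (simp add: nl_def abs_mult)
  moreover have "nl p \<in> borel_measurable borel" unfolding nl_def by measurable
  moreover have "isCont (nl p) 1" "isCont (nl p) (-1)"
    unfolding nl_def by (auto intro!: continuous_intros)
  ultimately show ?thesis by (simp add: homogeneous_nonlinearity_def)
qed

text \<open>The upper bound rests on (N + 2)/(N - 2) + 1 = 2N/(N - 2). Exponent p + 1 serves the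
  potential energy, exponent p the tested nonlinearity.\<close>

lemma energy_subcritical_sobolev:
  assumes "energy_subcritical N p"
  shows "sobolev_subcritical N (p + 1)" "sobolev_subcritical N p"
proof -
  have "p + 1 < 2 * real N / (real N - 2)" if "3 \<le> N"
  proof -
    have "0 < real N - 2" using that by simp
    then show ?thesis using assms that by (simp add: energy_subcritical_def field_simps)
  qed
  then show "sobolev_subcritical N (p + 1)" "sobolev_subcritical N p"
    using assms by (force simp: energy_subcritical_def sobolev_subcritical_def)+
qed

section \<open>The energy\<close>

lemma energy_space_norm_nonneg [simp]: "0 \<le> energy_space_norm w z"
  by (simp add: energy_space_norm_def)

lemma energy_space_norm_power2: "(energy_space_norm w z)\<^sup>2 = (H1_norm w)\<^sup>2 + (L2_norm z)\<^sup>2"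
  by (simp add: energy_space_norm_def)

lemma H1_norm_le_energy_space_norm: "H1_norm w \<le> energy_space_norm w z"
  by (simp add: energy_space_norm_def real_le_rsqrt)

lemma L2_norm_le_energy_space_norm: "L2_norm z \<le> energy_space_norm w z"
  by (simp add: energy_space_norm_def real_le_rsqrt)

lemma energy_space_norm_le_add: "energy_space_norm w z \<le> H1_norm w + L2_norm z"
  unfolding energy_space_norm_def by (rule sqrt_sum_squares_le_sum) auto

lemma energy_space_norm_le_diff:
  assumes "w \<in> H1" "w' \<in> H1" "z \<in> L2" "z' \<in> L2"
  shows "energy_space_norm w z \<le> energy_space_norm w' z' + energy_space_norm (\<lambda>x. w x - w' x) (\<lambda>x. z x - z' x)"
proof -
  have "energy_space_norm w z \<le> sqrt ((H1_norm w' + H1_norm (\<lambda>x. w x - w' x))\<^sup>2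
      + (L2_norm z' + L2_norm (\<lambda>x. z x - z' x))\<^sup>2)"
    unfolding energy_space_norm_def
    by (intro real_sqrt_le_mono add_mono power_mono H1_norm_le_diff L2_norm_le_diff assms) auto
  also have "\<dots> \<le> energy_space_norm w' z' + energy_space_norm (\<lambda>x. w x - w' x) (\<lambda>x. z x - z' x)"
    unfolding energy_space_norm_def by (rule real_sqrt_sum_squares_triangle_ineq)
  finally show ?thesis .
qed

lemma energy_space_norm_minus_commute:
  assumes "w \<in> H1" "w' \<in> H1"
  shows "energy_space_norm (\<lambda>x. w x - w' x) (\<lambda>x. z x - z' x)
    = energy_space_norm (\<lambda>x. w' x - w x) (\<lambda>x. z' x - z x)"
  unfolding energy_space_norm_def by (simp only: H1_norm_minus_commute[OF assms] L2_norm_minus_commute[of z z'])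

lemma energy_space_norm_diff_le:
  assumes "w \<in> H1" "w' \<in> H1" "z \<in> L2" "z' \<in> L2"
  shows "\<bar>energy_space_norm w z - energy_space_norm w' z'\<bar> \<le> energy_space_norm (\<lambda>x. w x - w' x) (\<lambda>x. z x - z' x)"
  using energy_space_norm_le_diff[OF assms] energy_space_norm_le_diff[OF assms(2,1,4,3)]
    energy_space_norm_minus_commute[OF assms(1,2), of z z'] by linarith

text \<open>Splitting the integral requires integrability of the potential term, which the
  subcritical embedding supplies.\<close>

lemma energy_eq:
  fixes w z :: "'a::euclidean_space \<Rightarrow> real"
  assumes "energy_subcritical DIM('a) p" "w \<in> H1" "z \<in> L2"
  shows "energy p w z = 1/2 * (energy_space_norm w z)\<^sup>2 - (\<integral>x. NL p (w x) \<partial>lborel)"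
proof -
  have "2 < p" using assms by (simp add: energy_subcritical_def)
  then have "integrable lborel (\<lambda>x. NL p (w x) * 1)"
    by (intro integrable_homogeneous_nonlinearity[OF homogeneous_nonlinearity_NL
      energy_subcritical_sobolev(1)[OF assms(1)] assms(2), where B=1]) auto
  then show ?thesis
    using L2_integrable_power2[OF weak_grad_L2[OF assms(2)]] L2_integrable_power2[OF H1_L2[OF assms(2)]]
      L2_integrable_power2[OF assms(3)]
    by (simp add: energy_def energy_space_norm_power2 H1_norm_power2 L2_norm_power2 algebra_simps)
qed

section \<open>The stationary equation\<close>

definition laplacian :: "('a::euclidean_space \<Rightarrow> real) \<Rightarrow> 'a \<Rightarrow> real" where
  "laplacian \<phi> x = (\<Sum>b\<in>Basis. frechet_derivative (\<lambda>y. frechet_derivative \<phi> (at y) b) (at x) b)"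

lemma laplacian_L2:
  assumes "\<phi> \<in> test_functions"
  shows "laplacian \<phi> \<in> L2"
proof -
  have "(\<lambda>x. \<Sum>b\<in>Basis. frechet_derivative (\<lambda>y. frechet_derivative \<phi> (at y) b) (at x) b) \<in> L2"
    by (intro L2_sum test_function_L2 test_function_derivative assms)
  then show ?thesis by (simp add: laplacian_def[abs_def])
qed

lemma laplacian_translation:
  assumes "\<phi> \<in> test_functions"
  shows "laplacian (\<lambda>x. \<phi> (x + c)) x = laplacian \<phi> (x + c)"
proof -
  have "frechet_derivative (\<lambda>y. frechet_derivative (\<lambda>x. \<phi> (x + c)) (at y) b) (at x) b
      = frechet_derivative (\<lambda>y. frechet_derivative \<phi> (at y) b) (at (x + c)) b" if "b \<in> Basis" for b
  proof -
    have "(\<lambda>y. frechet_derivative (\<lambda>x. \<phi> (x + c)) (at y) b) = (\<lambda>y. frechet_derivative \<phi> (at (y + c)) b)"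
      using frechet_derivative_translation(1)[OF test_function_differentiable[OF assms]] by metis
    then show ?thesis
      using frechet_derivative_translation(1)[OF test_function_differentiable[OF
          test_function_derivative[OF assms that]], where x=x and c=c] by simp
  qed
  then show ?thesis by (simp add: laplacian_def)
qed

text \<open>With both derivatives on the test function the pairing becomes continuous in the L2 norm
  of \<open>w\<close> alone, the only norm in which closeness is known after
  \<open>\<tau> n\<close>.\<close>

lemma grad_pairing_eq:
  fixes w :: "'a::euclidean_space \<Rightarrow> real"
  assumes "w \<in> H1" "\<phi> \<in> test_functions"
  shows "grad_pairing w \<phi> = - (\<integral>x. w x * laplacian \<phi> x \<partial>lborel)"
proof -
  have g: "weak_grad w \<in> L2" and w: "w \<in> L2" using assms weak_grad_L2 H1_L2 by auto
  have D: "(\<lambda>x. frechet_derivative \<phi> (at x) b) \<in> test_functions" if "b \<in> Basis" for b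
    using test_function_derivative[OF assms(2) that] .
  have i1: "integrable lborel (\<lambda>x. (weak_grad w x \<bullet> b) * frechet_derivative \<phi> (at x) b)" if "b \<in> Basis" for b
    by (intro integrable_L2_mult L2_inner_right g test_function_L2 D that)
  have i2: "integrable lborel (\<lambda>x. w x * frechet_derivative (\<lambda>y. frechet_derivative \<phi> (at y) b) (at x) b)"
    if "b \<in> Basis" for b
    by (intro integrable_L2_mult w test_function_L2 test_function_derivative[OF D] that)
  have "grad_pairing w \<phi> = (\<integral>x. (\<Sum>b\<in>Basis. (weak_grad w x \<bullet> b) * frechet_derivative \<phi> (at x) b) \<partial>lborel)"
    unfolding grad_pairing_def
    by (intro Bochner_Integration.integral_cong refl frechet_derivative_euclidean test_function_differentiable assms)
  also have "\<dots> = (\<Sum>b\<in>Basis. (\<integral>x. (weak_grad w x \<bullet> b) * frechet_derivative \<phi> (at x) b \<partial>lborel))"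
    by (rule Bochner_Integration.integral_sum) (rule i1)
  also have "\<dots> = (\<Sum>b\<in>Basis. - (\<integral>x. w x * frechet_derivative (\<lambda>y. frechet_derivative \<phi> (at y) b) (at x) b \<partial>lborel))"
    using is_weak_gradientD[OF is_weak_gradient_weak_grad[OF assms(1)] D] by (intro sum.cong) auto
  also have "\<dots> = - (\<integral>x. w x * laplacian \<phi> x \<partial>lborel)"
    unfolding laplacian_def sum_distrib_left
    by (subst Bochner_Integration.integral_sum) (auto intro: i2 simp: sum_negf)
  finally show ?thesis .
qed

definition residual :: "real \<Rightarrow> ('a::euclidean_space \<Rightarrow> real) \<Rightarrow> ('a \<Rightarrow> real) \<Rightarrow> real" where
  "residual p w \<phi> = grad_pairing w \<phi> + (\<integral>x. w x * \<phi> x \<partial>lborel) - (\<integral>x. nl p (w x) * \<phi> x \<partial>lborel)"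

text \<open>The gradient term is compared through the Laplacian form, which does not involve the
  choice made by \<open>weak_grad\<close>; the rest is translation invariance of the
  integral.\<close>

lemma residual_translation:
  fixes w \<phi> :: "'a::euclidean_space \<Rightarrow> real"
  assumes "w \<in> H1" "\<phi> \<in> test_functions"
  shows "residual p (\<lambda>x. w (x + c)) (\<lambda>x. \<phi> (x + c)) = residual p w \<phi>"
proof -
  have [measurable]: "w \<in> borel_measurable borel" "\<phi> \<in> borel_measurable borel"
      "laplacian \<phi> \<in> borel_measurable borel"
    using H1_measurable[OF assms(1)] test_function_measurable[OF assms(2)] L2_measurable[OF laplacian_L2[OF assms(2)]] by auto
  have [measurable]: "nl p \<in> borel_measurable borel" unfolding nl_def by measurable
  show ?thesis
    using grad_pairing_eq[OF assms] grad_pairing_eq[OF H1_translation[OF assms(1)] test_function_translation[OF assms(2)], of c c]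
      integral_lborel_translation[of "\<lambda>x. w x * laplacian \<phi> x" c]
      integral_lborel_translation[of "\<lambda>x. w x * \<phi> x" c]
      integral_lborel_translation[of "\<lambda>x. nl p (w x) * \<phi> x" c]
    by (simp add: residual_def laplacian_translation[OF assms(2)])
qed

text \<open>\<open>\<delta>\<close> must not depend on the shift \<open>c\<close>, since the test
  function follows the drifting centres \<open>y n\<close>. The linear terms depend on the test
  function only through translation invariant L2 norms, the nonlinear one only through its sup
  norm.\<close>

lemma residual_uniformly_continuous:
  fixes \<phi> :: "'a::euclidean_space \<Rightarrow> real"
  assumes "energy_subcritical DIM('a) p" "\<phi> \<in> test_functions" "0 < \<epsilon>"
  shows "\<exists>\<delta>>0. \<forall>w\<in>H1. \<forall>w'\<in>H1. \<forall>c.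
    H1_norm w \<le> M \<longrightarrow> H1_norm w' \<le> M \<longrightarrow> L2_norm (\<lambda>x. w x - w' x) \<le> \<delta> \<longrightarrow>
      \<bar>residual p w (\<lambda>x. \<phi> (x + c)) - residual p w' (\<lambda>x. \<phi> (x + c))\<bar> \<le> \<epsilon>"
proof -
  obtain B R where B: "0 < B" "\<And>x. \<bar>\<phi> x\<bar> \<le> B"
    using test_function_bounded[OF assms(2)] by metis
  have p: "2 < p" using assms by (simp add: energy_subcritical_def)
  obtain \<delta>1 where \<delta>1: "0 < \<delta>1"
    "\<forall>w\<in>(H1 :: ('a \<Rightarrow> real) set). \<forall>w'\<in>H1. \<forall>\<psi>\<in>borel_measurable borel.
      H1_norm w \<le> M \<longrightarrow> H1_norm w' \<le> M \<longrightarrow> L2_norm (\<lambda>x. w x - w' x) \<le> \<delta>1 \<longrightarrow> (\<forall>x. \<bar>\<psi> x\<bar> \<le> B) \<longrightarrow>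
      \<bar>(\<integral>x. nl p (w x) * \<psi> x \<partial>lborel) - (\<integral>x. nl p (w' x) * \<psi> x \<partial>lborel)\<bar> \<le> \<epsilon> / 2"
    using H1_nonlinearity_uniformly_continuous[OF homogeneous_nonlinearity_nl[OF p]
        energy_subcritical_sobolev(2)[OF assms(1)] half_gt_zero[OF assms(3)] less_imp_le[OF B(1)], of M] by blast
  define A where "A = L2_norm (laplacian \<phi>) + L2_norm \<phi>"
  have A: "0 \<le> A" by (simp add: A_def)
  define \<delta> where "\<delta> = min \<delta>1 (\<epsilon> / (2 * (A + 1)))"
  have \<delta>: "0 < \<delta>" "\<delta> \<le> \<delta>1" using \<delta>1(1) assms(3) A by (auto simp: \<delta>_def)
  have A\<delta>: "\<delta> * A \<le> \<epsilon> / 2"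
  proof -
    have "\<delta> * A \<le> \<epsilon> / (2 * (A + 1)) * (A + 1)" using A \<delta>(1) assms(3) by (intro mult_mono) (auto simp: \<delta>_def)
    also have "\<dots> = \<epsilon> / 2" using A by (simp add: field_simps)
    finally show ?thesis .
  qed
  show ?thesis
  proof (intro exI[of _ \<delta>] conjI ballI allI impI \<delta>(1))
    fix w w' :: "'a \<Rightarrow> real" and c
    assume w: "w \<in> H1" "H1_norm w \<le> M" and w': "w' \<in> H1" "H1_norm w' \<le> M"
      and close: "L2_norm (\<lambda>x. w x - w' x) \<le> \<delta>"
    let ?\<phi> = "\<lambda>x. \<phi> (x + c)"
    have \<psi>: "?\<phi> \<in> test_functions" by (rule test_function_translation[OF assms(2)])
    have L2: "w \<in> L2" "w' \<in> L2" "?\<phi> \<in> L2" "laplacian ?\<phi> \<in> L2" "(\<lambda>x. w x - w' x) \<in> L2"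
      using w w' H1_L2 test_function_L2[OF \<psi>] laplacian_L2[OF \<psi>] L2_diff by auto
    have norms: "L2_norm ?\<phi> = L2_norm \<phi>" "L2_norm (laplacian ?\<phi>) = L2_norm (laplacian \<phi>)"
      using L2_norm_translation[of \<phi> c] L2_norm_translation[of "laplacian \<phi>" c] assms(2)
        L2_measurable[OF laplacian_L2[OF assms(2)]]
      by (auto simp: laplacian_translation[OF assms(2), abs_def])
    have nl: "\<bar>(\<integral>x. nl p (w x) * ?\<phi> x \<partial>lborel) - (\<integral>x. nl p (w' x) * ?\<phi> x \<partial>lborel)\<bar> \<le> \<epsilon> / 2"
      using \<delta>1(2)[rule_format, OF w(1) w'(1) test_function_measurable[OF \<psi>] w(2) w'(2)] close \<delta>(2) B(2) by simp
    have lap: "\<bar>(\<integral>x. w x * laplacian ?\<phi> x \<partial>lborel) - (\<integral>x. w' x * laplacian ?\<phi> x \<partial>lborel)\<bar>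
        \<le> L2_norm (\<lambda>x. w x - w' x) * L2_norm (laplacian \<phi>)"
      using L2_Cauchy_Schwarz_real[OF L2(5,4)] integrable_L2_mult[OF L2(1,4)] integrable_L2_mult[OF L2(2,4)] norms
      by (simp add: left_diff_distrib)
    have lin: "\<bar>(\<integral>x. w x * ?\<phi> x \<partial>lborel) - (\<integral>x. w' x * ?\<phi> x \<partial>lborel)\<bar>
        \<le> L2_norm (\<lambda>x. w x - w' x) * L2_norm \<phi>"
      using L2_Cauchy_Schwarz_real[OF L2(5,3)] integrable_L2_mult[OF L2(1,3)] integrable_L2_mult[OF L2(2,3)] norms
      by (simp add: left_diff_distrib)
    have "L2_norm (\<lambda>x. w x - w' x) * A \<le> \<epsilon> / 2"
      using mult_right_mono[OF close A] A\<delta> by simp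
    then have "L2_norm (\<lambda>x. w x - w' x) * L2_norm (laplacian \<phi>) + L2_norm (\<lambda>x. w x - w' x) * L2_norm \<phi> \<le> \<epsilon> / 2"
      by (simp add: A_def distrib_left)
    then show "\<bar>residual p w ?\<phi> - residual p w' ?\<phi>\<bar> \<le> \<epsilon>"
      using nl lap lin
      unfolding residual_def grad_pairing_eq[OF w(1) \<psi>] grad_pairing_eq[OF w'(1) \<psi>] by linarith
  qed
qed


section \<open>Global existence and the dissipation estimate\<close>

section \<open>Cluster points\<close>

lemma time_interval_infinity [simp]: "time_interval \<infinity> = {0..}"
  by (auto simp: time_interval_def)

lemma H1_translation_diff: "w \<in> H1 \<Longrightarrow> (\<lambda>x. w (x - c)) \<in> H1"
  using H1_translation[of w "- c"] by simp

lemma L2_translation_diff: "z \<in> L2 \<Longrightarrow> (\<lambda>x. z (x - c)) \<in> L2"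
  using L2_translation[of z "- c"] by simp

lemma energy_space_norm_translation_diff:
  assumes "w \<in> H1" "z \<in> L2"
  shows "energy_space_norm (\<lambda>x. w (x - c)) (\<lambda>x. z (x - c)) = energy_space_norm w z"
  using H1_norm_translation[OF assms(1), of "- c"] L2_norm_translation[OF L2_measurable[OF assms(2)], of "- c"]
  by (simp add: energy_space_norm_def)

lemma cluster_point_tendsto:
  assumes "cluster_point T u v W0 W1 \<tau> y"
    and "\<And>t. t \<in> time_interval T \<Longrightarrow> u t \<in> H1 \<and> v t \<in> L2"
  shows "(\<lambda>n. energy_space_norm (\<lambda>x. u (\<tau> n) x - W0 (x - y n)) (\<lambda>x. v (\<tau> n) x - W1 (x - y n))) \<longlonglongrightarrow> 0"
    and "(\<lambda>n. energy_space_norm (u (\<tau> n)) (v (\<tau> n))) \<longlonglongrightarrow> energy_space_norm W0 W1"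
proof -
  have W: "W0 \<in> H1" "W1 \<in> L2" and \<tau>: "\<And>n. \<tau> n \<in> time_interval T"
    and lim: "(\<lambda>n. H1_norm (\<lambda>x. u (\<tau> n) x - W0 (x - y n)) + L2_norm (\<lambda>x. v (\<tau> n) x - W1 (x - y n))) \<longlonglongrightarrow> 0"
    using assms(1) by (auto simp: cluster_point_def)
  show *: "(\<lambda>n. energy_space_norm (\<lambda>x. u (\<tau> n) x - W0 (x - y n)) (\<lambda>x. v (\<tau> n) x - W1 (x - y n))) \<longlonglongrightarrow> 0"
    by (rule tendsto_sandwich[OF _ _ tendsto_const lim]) (auto simp: energy_space_norm_le_add)
  have "\<bar>energy_space_norm (u (\<tau> n)) (v (\<tau> n)) - energy_space_norm W0 W1\<bar>
      \<le> energy_space_norm (\<lambda>x. u (\<tau> n) x - W0 (x - y n)) (\<lambda>x. v (\<tau> n) x - W1 (x - y n))" for n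
    using energy_space_norm_diff_le[of "u (\<tau> n)" "\<lambda>x. W0 (x - y n)" "v (\<tau> n)" "\<lambda>x. W1 (x - y n)"]
      assms(2)[OF \<tau>[of n]] H1_translation_diff[OF W(1)] L2_translation_diff[OF W(2)]
    by (simp add: energy_space_norm_translation_diff[OF W])
  then have "(\<lambda>n. energy_space_norm (u (\<tau> n)) (v (\<tau> n)) - energy_space_norm W0 W1) \<longlonglongrightarrow> 0"
    by (intro Lim_null_comparison[OF _ *]) auto
  then show "(\<lambda>n. energy_space_norm (u (\<tau> n)) (v (\<tau> n))) \<longlonglongrightarrow> energy_space_norm W0 W1"
    by (simp add: LIM_zero_iff)
qed

lemma DKG_solution_spaces:
  "DKG_solution \<alpha> p T u v \<Longrightarrow> t \<in> time_interval T \<Longrightarrow> u t \<in> H1 \<and> v t \<in> L2"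
  by (simp add: DKG_solution_def continuous_in_H1_L2_def)

lemma packed_solution_global:
  assumes "DKG_locally_well_posed \<alpha> p X" "DKG_maximal_solution \<alpha> p X T u v"
    and cluster: "cluster_point T u v W0 W1 \<tau> y"
  shows "T = \<infinity>"
proof (cases T)
  case (real r)
  have sol: "DKG_solution \<alpha> p T u v" using assms(2) by (simp add: DKG_maximal_solution_def)
  have blowup: "filterlim (\<lambda>t. energy_space_norm (u t) (v t)) at_top (at_left r)"
    using assms(1,2) unfolding DKG_locally_well_posed_def real by blast
  have \<tau>: "\<And>n. \<tau> n < r" "\<tau> \<longlonglongrightarrow> r"
    using cluster by (auto simp: cluster_point_def real time_interval_def)
  have "filterlim \<tau> (at_left r) sequentially"
    using \<tau> by (auto simp: filterlim_at intro: always_eventually dest: less_imp_neq)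
  with blowup have "filterlim (\<lambda>n. energy_space_norm (u (\<tau> n)) (v (\<tau> n))) at_top sequentially"
    by (rule filterlim_compose)
  then show ?thesis
    using not_tendsto_and_filterlim_at_infinity[OF _ cluster_point_tendsto(2)[OF cluster DKG_solution_spaces[OF sol]]]
      filterlim_at_top_imp_at_infinity by force
next
  case MInf
  then show ?thesis using assms(2) by (simp add: DKG_maximal_solution_def DKG_solution_def)
qed simp

section \<open>Global solutions\<close>

lemma derivative_within_nonpos_imp_le:
  fixes f :: "real \<Rightarrow> real"
  assumes "a \<le> b" and D: "\<And>x. x \<in> {a..b} \<Longrightarrow> (f has_real_derivative f' x) (at x within {a..b})"
    and "\<And>x. x \<in> {a..b} \<Longrightarrow> f' x \<le> 0"
  shows "f b \<le> f a"
proof (rule DERIV_nonpos_imp_decreasing_open[OF assms(1)])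
  show "\<exists>y. (f has_real_derivative y) (at x) \<and> y \<le> 0" if "a < x" "x < b" for x
    using D[of x] assms(3)[of x] that at_within_Icc_at[of a x b] by auto
  show "continuous_on {a..b} f"
    unfolding continuous_on_eq_continuous_within using D DERIV_continuous by blast
qed

text \<open>Once T is infinite, the uniqueness class matters only through the energy identity, which
  is therefore recorded for this one solution.\<close>

locale global_solution =
  fixes \<alpha> p :: real and u v :: "real \<Rightarrow> 'a::euclidean_space \<Rightarrow> real"
  assumes alpha_pos: "0 < \<alpha>"
    and subcritical: "energy_subcritical DIM('a) p"
    and solution: "DKG_solution \<alpha> p \<infinity> u v"
    and energy_identity: "\<And>t1 t2. 0 \<le> t1 \<Longrightarrow> t1 \<le> t2 \<Longrightarrow>
      energy p (u t2) (v t2) - energy p (u t1) (v t1) = - 2 * \<alpha> * (LBINT t:{t1..t2}. (L2_norm (v t))\<^sup>2)"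
begin

abbreviation E :: "real \<Rightarrow> real" where
  "E t \<equiv> energy p (u t) (v t)"

lemma u_H1: "0 \<le> t \<Longrightarrow> u t \<in> H1" and v_L2: "0 \<le> t \<Longrightarrow> v t \<in> L2" and u_L2: "0 \<le> t \<Longrightarrow> u t \<in> L2"
  using DKG_solution_spaces[OF solution, of t] H1_L2 by auto

lemma continuous_in_energy_space: "continuous_in_H1_L2 {0..} u v"
  using solution by (simp add: DKG_solution_def)

lemma energy_space_distance_tendsto:
  assumes "0 \<le> t"
  shows "((\<lambda>s. energy_space_norm (\<lambda>x. u s x - u t x) (\<lambda>x. v s x - v t x)) \<longlongrightarrow> 0) (at t within {0..})"
  using continuous_in_energy_space assms by (auto simp: continuous_in_H1_L2_def)

lemma continuous_on_energy_space_norm: "continuous_on {0..} (\<lambda>t. energy_space_norm (u t) (v t))"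
proof (unfold continuous_on_def, intro ballI)
  fix t :: real assume t: "t \<in> {0..}"
  have "((\<lambda>s. energy_space_norm (u s) (v s) - energy_space_norm (u t) (v t)) \<longlongrightarrow> 0) (at t within {0..})"
  proof (rule Lim_null_comparison)
    show "((\<lambda>s. energy_space_norm (\<lambda>x. u s x - u t x) (\<lambda>x. v s x - v t x)) \<longlongrightarrow> 0) (at t within {0..})"
      using t energy_space_distance_tendsto by simp
    show "eventually (\<lambda>s. norm (energy_space_norm (u s) (v s) - energy_space_norm (u t) (v t))
        \<le> energy_space_norm (\<lambda>x. u s x - u t x) (\<lambda>x. v s x - v t x)) (at t within {0..})"
      using t by (auto simp: eventually_at_filter intro!: always_eventually energy_space_norm_diff_le u_H1 v_L2)
  qed
  then show "((\<lambda>s. energy_space_norm (u s) (v s)) \<longlongrightarrow> energy_space_norm (u t) (v t)) (at t within {0..})"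
    by (simp add: LIM_zero_iff)
qed

lemma continuous_on_L2_norm_v: "continuous_on {0..} (\<lambda>t. L2_norm (v t))"
proof (unfold continuous_on_def, intro ballI)
  fix t :: real assume t: "t \<in> {0..}"
  have "((\<lambda>s. L2_norm (v s) - L2_norm (v t)) \<longlongrightarrow> 0) (at t within {0..})"
  proof (rule Lim_null_comparison)
    show "((\<lambda>s. energy_space_norm (\<lambda>x. u s x - u t x) (\<lambda>x. v s x - v t x)) \<longlongrightarrow> 0) (at t within {0..})"
      using t energy_space_distance_tendsto by simp
    have "norm (L2_norm (v s) - L2_norm (v t)) \<le> energy_space_norm (\<lambda>x. u s x - u t x) (\<lambda>x. v s x - v t x)"
      if "0 \<le> s" for s
      using L2_norm_le_diff[OF v_L2[OF that] v_L2[of t]] L2_norm_le_diff[OF v_L2[of t] v_L2[OF that]] t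
        L2_norm_minus_commute[of "v s" "v t"]
        L2_norm_le_energy_space_norm[of "\<lambda>x. v s x - v t x" "\<lambda>x. u s x - u t x"] by auto
    then show "eventually (\<lambda>s. norm (L2_norm (v s) - L2_norm (v t))
        \<le> energy_space_norm (\<lambda>x. u s x - u t x) (\<lambda>x. v s x - v t x)) (at t within {0..})"
      by (simp add: eventually_at_filter)
  qed
  then show "((\<lambda>s. L2_norm (v s)) \<longlongrightarrow> L2_norm (v t)) (at t within {0..})"
    by (simp add: LIM_zero_iff)
qed

lemma continuous_on_dissipation: "0 \<le> a \<Longrightarrow> continuous_on {a..b} (\<lambda>t. (L2_norm (v t))\<^sup>2)"
  by (intro continuous_on_power continuous_on_subset[OF continuous_on_L2_norm_v]) auto

lemma energy_antimono:
  assumes "0 \<le> a" "a \<le> b"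
  shows "E b \<le> E a"
proof -
  have "0 \<le> (LBINT t:{a..b}. (L2_norm (v t))\<^sup>2)"
    unfolding set_lebesgue_integral_def by (rule Bochner_Integration.integral_nonneg) simp
  then have "0 \<le> \<alpha> * (LBINT t:{a..b}. (L2_norm (v t))\<^sup>2)" using alpha_pos by simp
  then show ?thesis using energy_identity[OF assms] by simp
qed

text \<open>The dissipation is continuous in time, so the fundamental theorem of calculus turns the
  integral identity into a derivative.\<close>

lemma energy_has_derivative:
  assumes "0 \<le> a" "t \<in> {a..b}"
  shows "(E has_real_derivative - 2 * \<alpha> * (L2_norm (v t))\<^sup>2) (at t within {a..b})"
proof -
  have eq: "E s = E a + - 2 * \<alpha> * integral {a..s} (\<lambda>t. (L2_norm (v t))\<^sup>2)" if "s \<in> {a..b}" for s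
  proof -
    have "(LBINT t:{a..s}. (L2_norm (v t))\<^sup>2) = integral {a..s} (\<lambda>t. (L2_norm (v t))\<^sup>2)"
      by (intro set_borel_integral_eq_integral(2) borel_integrable_atLeastAtMost' continuous_on_dissipation assms)
    then show ?thesis using energy_identity[OF assms(1), of s] that by simp
  qed
  have D: "((\<lambda>s. E a + - 2 * \<alpha> * integral {a..s} (\<lambda>t. (L2_norm (v t))\<^sup>2))
      has_real_derivative - 2 * \<alpha> * (L2_norm (v t))\<^sup>2) (at t within {a..b})"
    using integral_has_real_derivative[OF continuous_on_dissipation[OF assms(1)] assms(2)]
    by (auto intro!: derivative_eq_intros)
  show ?thesis
    by (rule has_field_derivative_transform_within[OF D zero_less_one assms(2)]) (rule eq[symmetric])
qed

lemma pairing_has_derivative: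
  assumes "\<psi> \<in> L2" "0 \<le> t"
  shows "((\<lambda>s. \<integral>x. u s x * \<psi> x \<partial>lborel) has_real_derivative (\<integral>x. v t x * \<psi> x \<partial>lborel)) (at t within {0..})"
proof -
  have lim: "((\<lambda>s. L2_norm (\<lambda>x. (u s x - u t x) / (s - t) - v t x) * L2_norm \<psi>) \<longlongrightarrow> 0) (at t within {0..})"
    using solution assms(2)
    by (intro tendsto_mult_left_zero) (auto simp: DKG_solution_def has_L2_time_derivative_def)
  have bound: "norm (((\<integral>x. u s x * \<psi> x \<partial>lborel) - (\<integral>x. u t x * \<psi> x \<partial>lborel)) / (s - t) - (\<integral>x. v t x * \<psi> x \<partial>lborel))
      \<le> L2_norm (\<lambda>x. (u s x - u t x) / (s - t) - v t x) * L2_norm \<psi>" if "0 \<le> s" for s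
  proof -
    have L2: "u s \<in> L2" "u t \<in> L2" "v t \<in> L2" using that assms u_L2 v_L2 by auto
    have "(\<lambda>x. (1 / (s - t)) *\<^sub>R (u s x - u t x) - v t x) \<in> L2"
      by (intro L2_diff L2_scaleR L2)
    then have d: "(\<lambda>x. (u s x - u t x) / (s - t) - v t x) \<in> L2" by (simp add: divide_inverse mult.commute)
    have i: "integrable lborel (\<lambda>x. u s x * \<psi> x)" "integrable lborel (\<lambda>x. u t x * \<psi> x)" "integrable lborel (\<lambda>x. v t x * \<psi> x)"
      using integrable_L2_mult[OF L2(1) assms(1)] integrable_L2_mult[OF L2(2) assms(1)]
        integrable_L2_mult[OF L2(3) assms(1)] by auto
    have "(\<integral>x. ((u s x - u t x) / (s - t) - v t x) * \<psi> x \<partial>lborel)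
        = (\<integral>x. (u s x * \<psi> x - u t x * \<psi> x) / (s - t) - v t x * \<psi> x \<partial>lborel)"
      by (simp add: left_diff_distrib)
    also have "\<dots> = ((\<integral>x. u s x * \<psi> x \<partial>lborel) - (\<integral>x. u t x * \<psi> x \<partial>lborel)) / (s - t) - (\<integral>x. v t x * \<psi> x \<partial>lborel)"
      using i by simp
    finally show ?thesis using L2_Cauchy_Schwarz_real[OF d assms(1)] by simp
  qed
  have "((\<lambda>s. ((\<integral>x. u s x * \<psi> x \<partial>lborel) - (\<integral>x. u t x * \<psi> x \<partial>lborel)) / (s - t) - (\<integral>x. v t x * \<psi> x \<partial>lborel))
      \<longlongrightarrow> 0) (at t within {0..})"
    by (rule Lim_null_comparison[OF _ lim]) (use bound in \<open>simp add: eventually_at_filter\<close>)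
  then show ?thesis by (simp add: has_field_derivative_iff LIM_zero_iff)
qed

text \<open>Formally the increment is at most the time integral of the norm of v. Young's inequality
  bounds that norm by \<eta>/2 plus its square over 2 \<eta>, and by dissipation the latter is
  -E'/(4 \<alpha> \<eta>). Pairing with the fixed increment replaces an L2-valued integral by a
  scalar monotonicity argument.\<close>

lemma L2_increment_le:
  assumes "0 \<le> a" "a \<le> b" "0 < \<eta>"
  shows "L2_norm (\<lambda>x. u b x - u a x) \<le> \<eta> * (b - a) / 2 + (E a - E b) / (4 * \<alpha> * \<eta>)"
proof -
  define \<psi> where "\<psi> = (\<lambda>x. u b x - u a x)"
  have L2: "u b \<in> L2" "u a \<in> L2" using assms u_L2 by auto
  have \<psi>: "\<psi> \<in> L2" unfolding \<psi>_def using L2 by (rule L2_diff)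
  define k where "k = L2_norm \<psi>"
  have k: "0 \<le> k" by (simp add: k_def)
  let ?m = "\<lambda>s. \<integral>x. u s x * \<psi> x \<partial>lborel"
  \<comment> \<open>The pairing minus \<open>k\<close> times an antiderivative of the Young bound;
    its derivative is nonpositive by Cauchy-Schwarz.\<close>
  let ?G = "\<lambda>s. ?m s - k * (\<eta> / 2 * s - 1 / (4 * \<alpha> * \<eta>) * E s)"
  let ?G' = "\<lambda>s. (\<integral>x. v s x * \<psi> x \<partial>lborel) - k * (\<eta> / 2 - 1 / (4 * \<alpha> * \<eta>) * (- 2 * \<alpha> * (L2_norm (v s))\<^sup>2))"
  have "?G b \<le> ?G a"
  proof (rule derivative_within_nonpos_imp_le[OF assms(2)])
    fix s assume s: "s \<in> {a..b}"
    have "(?m has_real_derivative (\<integral>x. v s x * \<psi> x \<partial>lborel)) (at s within {a..b})"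
      using pairing_has_derivative[OF \<psi>, of s] s assms(1) by (auto intro: DERIV_subset)
    with energy_has_derivative[OF assms(1) s]
    show "(?G has_real_derivative ?G' s) (at s within {a..b})"
      using assms(3) by (auto intro!: derivative_eq_intros)
    have "2 * L2_norm (v s) * \<eta> \<le> (L2_norm (v s))\<^sup>2 + \<eta>\<^sup>2" by (rule sum_squares_bound)
    then have "L2_norm (v s) \<le> \<eta> / 2 + (L2_norm (v s))\<^sup>2 / (2 * \<eta>)"
      using assms(3) by (simp add: field_simps power2_eq_square)
    also have "\<dots> = \<eta> / 2 - 1 / (4 * \<alpha> * \<eta>) * (- 2 * \<alpha> * (L2_norm (v s))\<^sup>2)"
      using alpha_pos assms(3) by (simp add: field_simps)
    finally have "k * L2_norm (v s) \<le> k * (\<eta> / 2 - 1 / (4 * \<alpha> * \<eta>) * (- 2 * \<alpha> * (L2_norm (v s))\<^sup>2))"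
      using k by (rule mult_left_mono)
    moreover have "(\<integral>x. v s x * \<psi> x \<partial>lborel) \<le> L2_norm (v s) * k"
      using L2_Cauchy_Schwarz_real[OF v_L2 \<psi>, of s] s assms(1) by (simp add: k_def)
    ultimately show "?G' s \<le> 0" by (simp add: mult.commute)
  qed
  moreover have "?m b - ?m a = k\<^sup>2"
  proof -
    have "?m b - ?m a = (\<integral>x. \<psi> x * \<psi> x \<partial>lborel)"
      using integrable_L2_mult[OF L2(1) \<psi>] integrable_L2_mult[OF L2(2) \<psi>]
      by (subst Bochner_Integration.integral_diff[symmetric]) (auto simp: \<psi>_def left_diff_distrib)
    then show ?thesis using L2_norm_power2[of \<psi>] by (simp add: k_def power2_eq_square)
  qed
  ultimately have "k * k \<le> k * (\<eta> * (b - a) / 2 + (E a - E b) / (4 * \<alpha> * \<eta>))"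
    by (simp add: power2_eq_square algebra_simps diff_divide_distrib)
  moreover have "0 \<le> \<eta> * (b - a) / 2 + (E a - E b) / (4 * \<alpha> * \<eta>)"
    using assms energy_antimono[OF assms(1,2)] alpha_pos by (intro add_nonneg_nonneg divide_nonneg_nonneg) auto
  \<comment> \<open>Division by \<open>k\<close> is possible unless \<open>k = 0\<close>, where
    nonnegativity of the right-hand side is used.\<close>
  ultimately have "k \<le> \<eta> * (b - a) / 2 + (E a - E b) / (4 * \<alpha> * \<eta>)"
    using k by (cases "k = 0") (auto simp: mult_le_cancel_left)
  then show ?thesis by (simp add: k_def \<psi>_def)
qed

end


section \<open>Identification of cluster points\<close>

lemma real_eq_0I:
  fixes x C :: real
  assumes "0 \<le> C" "\<And>\<epsilon>. 0 < \<epsilon> \<Longrightarrow> \<bar>x\<bar> \<le> \<epsilon> * C"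
  shows "x = 0"
proof (rule ccontr)
  assume "x \<noteq> 0"
  then have "\<bar>x\<bar> \<le> \<bar>x\<bar> / (2 * (C + 1)) * C" using assms(1) by (intro assms(2)) auto
  also have "\<dots> \<le> \<bar>x\<bar> / (2 * (C + 1)) * (C + 1)" using assms(1) by (intro mult_left_mono) auto
  also have "\<dots> = \<bar>x\<bar> / 2" using assms(1) by (simp add: field_simps)
  finally show False using \<open>x \<noteq> 0\<close> by simp
qed

text \<open>Mean value inequality; the interval has length 1, so no length factor appears.\<close>

lemma derivative_within_bound_imp_le:
  fixes f :: "real \<Rightarrow> real"
  assumes "a \<le> s" "s \<le> a + 1" "\<And>x. x \<in> {a..a+1} \<Longrightarrow> (f has_real_derivative f' x) (at x within {a..a+1})"
    and "\<And>x. x \<in> {a..a+1} \<Longrightarrow> \<bar>f' x\<bar> \<le> B"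
  shows "\<bar>f s - f a\<bar> \<le> B"
proof -
  have "0 \<le> B" using assms(4)[of a] by force
  have "norm (f s - f a) \<le> B * norm (s - a)"
    by (rule field_differentiable_bound[of "{a..a+1}" f f']) (use assms in auto)
  also have "\<dots> \<le> B" using assms(1,2) \<open>0 \<le> B\<close> by (simp add: mult_left_le)
  finally show ?thesis by simp
qed

locale clustering_solution = global_solution \<alpha> p u v
  for \<alpha> p :: real and u v :: "real \<Rightarrow> 'a::euclidean_space \<Rightarrow> real" +
  fixes W0 W1 :: "'a \<Rightarrow> real" and \<tau> :: "nat \<Rightarrow> real" and y :: "nat \<Rightarrow> 'a"
  assumes cluster: "cluster_point \<infinity> u v W0 W1 \<tau> y"
begin

abbreviation E_lim :: real where "E_lim \<equiv> energy p W0 W1"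

abbreviation W0_at :: "nat \<Rightarrow> 'a \<Rightarrow> real" where "W0_at n \<equiv> \<lambda>x. W0 (x - y n)"

abbreviation W1_at :: "nat \<Rightarrow> 'a \<Rightarrow> real" where "W1_at n \<equiv> \<lambda>x. W1 (x - y n)"

lemma W0_H1: "W0 \<in> H1" and W1_L2: "W1 \<in> L2" and tau_nonneg: "0 \<le> \<tau> n"
  using cluster by (auto simp: cluster_point_def)

lemma W0_at_H1: "W0_at n \<in> H1"
  by (rule H1_translation_diff[OF W0_H1])

lemma W1_at_L2: "W1_at n \<in> L2"
  by (rule L2_translation_diff[OF W1_L2])

lemma H1_norm_W0_at: "H1_norm (W0_at n) = H1_norm W0"
  using H1_norm_translation[OF W0_H1, of "- y n"] by simp

lemma tau_at_top: "filterlim \<tau> at_top sequentially"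
  using cluster by (simp add: cluster_point_def tendsto_PInfty_eq_at_top)

lemma distance_tendsto:
  "(\<lambda>n. energy_space_norm (\<lambda>x. u (\<tau> n) x - W0_at n x) (\<lambda>x. v (\<tau> n) x - W1_at n x)) \<longlonglongrightarrow> 0"
  and norm_tendsto: "(\<lambda>n. energy_space_norm (u (\<tau> n)) (v (\<tau> n))) \<longlonglongrightarrow> energy_space_norm W0 W1"
  using cluster_point_tendsto[OF cluster DKG_solution_spaces[OF solution]] by simp_all

lemma eventually_close_at_tau:
  assumes "0 < \<delta>"
  shows "eventually (\<lambda>n. L2_norm (\<lambda>x. u (\<tau> n) x - W0_at n x) \<le> \<delta> \<and> L2_norm (\<lambda>x. v (\<tau> n) x - W1_at n x) \<le> \<delta>) sequentially"
  using order_tendstoD(2)[OF distance_tendsto assms]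
proof eventually_elim
  case (elim n)
  then show ?case
    using H1_norm_le_energy_space_norm[of "\<lambda>x. u (\<tau> n) x - W0_at n x" "\<lambda>x. v (\<tau> n) x - W1_at n x"]
      L2_norm_le_H1_norm[of "\<lambda>x. u (\<tau> n) x - W0_at n x"]
      L2_norm_le_energy_space_norm[of "\<lambda>x. v (\<tau> n) x - W1_at n x" "\<lambda>x. u (\<tau> n) x - W0_at n x"] by linarith
qed

lemma norm_bound_at_tau:
  obtains M where "0 \<le> M" "\<And>n. energy_space_norm (u (\<tau> n)) (v (\<tau> n)) \<le> M" "H1_norm W0 \<le> M"
proof -
  obtain K where K: "\<And>n. norm (energy_space_norm (u (\<tau> n)) (v (\<tau> n))) \<le> K"
    using convergent_imp_Bseq[OF convergentI[OF norm_tendsto]] unfolding Bseq_def by blast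
  show thesis
  proof (rule that[of "max K (H1_norm W0)"])
    show "energy_space_norm (u (\<tau> n)) (v (\<tau> n)) \<le> max K (H1_norm W0)" for n
      using K[of n] by simp
  qed (simp_all add: le_max_iff_disj)
qed

lemma potential_energy_uniformly_continuous:
  assumes "0 < \<epsilon>"
  shows "\<exists>\<delta>>0. \<forall>w\<in>(H1 :: ('a \<Rightarrow> real) set). \<forall>w'\<in>H1. H1_norm w \<le> M \<longrightarrow> H1_norm w' \<le> M \<longrightarrow>
    L2_norm (\<lambda>x. w x - w' x) \<le> \<delta> \<longrightarrow>
    \<bar>(\<integral>x. NL p (w x) \<partial>lborel) - (\<integral>x. NL p (w' x) \<partial>lborel)\<bar> \<le> \<epsilon>"
proof -
  have "2 < p" using subcritical by (simp add: energy_subcritical_def)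
  then obtain \<delta> where \<delta>: "0 < \<delta>" "\<forall>w\<in>(H1 :: ('a \<Rightarrow> real) set). \<forall>w'\<in>H1. \<forall>\<psi>\<in>borel_measurable borel.
      H1_norm w \<le> M \<longrightarrow> H1_norm w' \<le> M \<longrightarrow> L2_norm (\<lambda>x. w x - w' x) \<le> \<delta> \<longrightarrow> (\<forall>x. \<bar>\<psi> x\<bar> \<le> 1) \<longrightarrow>
      \<bar>(\<integral>x. NL p (w x) * \<psi> x \<partial>lborel) - (\<integral>x. NL p (w' x) * \<psi> x \<partial>lborel)\<bar> \<le> \<epsilon>"
    using H1_nonlinearity_uniformly_continuous[OF homogeneous_nonlinearity_NL
        energy_subcritical_sobolev(1)[OF subcritical] assms zero_le_one, of M] by blast
  have "(\<lambda>x. 1 :: real) \<in> borel_measurable borel" by simp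
  with \<delta> show ?thesis by (intro exI[of _ \<delta>]) fastforce
qed

text \<open>The quadratic part converges with the norms. The comparison functions
  \<open>W0_at n\<close> move with n, so the potential part relies on a modulus of continuity
  depending only on the norm bound.\<close>

lemma energy_tendsto: "(\<lambda>n. E (\<tau> n)) \<longlonglongrightarrow> E_lim"
proof -
  obtain M where M: "0 \<le> M" "\<And>n. energy_space_norm (u (\<tau> n)) (v (\<tau> n)) \<le> M" "H1_norm W0 \<le> M"
    using norm_bound_at_tau by metis
  have [measurable]: "W0 \<in> borel_measurable borel" using W0_H1 by (rule H1_measurable)
  have [measurable]: "NL p \<in> borel_measurable borel" unfolding NL_def by measurable
  have NL_at: "(\<integral>x. NL p (W0_at n x) \<partial>lborel) = (\<integral>x. NL p (W0 x) \<partial>lborel)" for n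
    using integral_lborel_translation[of "\<lambda>x. NL p (W0 x)" "- y n"] by simp
  have "(\<lambda>n. \<integral>x. NL p (u (\<tau> n) x) \<partial>lborel) \<longlonglongrightarrow> (\<integral>x. NL p (W0 x) \<partial>lborel)"
  proof (rule tendstoI)
    fix e :: real assume "0 < e"
    then obtain \<delta> where \<delta>: "0 < \<delta>" "\<forall>w\<in>(H1 :: ('a \<Rightarrow> real) set). \<forall>w'\<in>H1. H1_norm w \<le> M \<longrightarrow> H1_norm w' \<le> M \<longrightarrow>
        L2_norm (\<lambda>x. w x - w' x) \<le> \<delta> \<longrightarrow>
        \<bar>(\<integral>x. NL p (w x) \<partial>lborel) - (\<integral>x. NL p (w' x) \<partial>lborel)\<bar> \<le> e / 2"
      using potential_energy_uniformly_continuous[of "e / 2" M] half_gt_zero by blast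
    show "eventually (\<lambda>n. dist (\<integral>x. NL p (u (\<tau> n) x) \<partial>lborel) (\<integral>x. NL p (W0 x) \<partial>lborel) < e) sequentially"
      using eventually_close_at_tau[OF \<delta>(1)]
    proof eventually_elim
      case (elim n)
      have "H1_norm (u (\<tau> n)) \<le> M"
        using H1_norm_le_energy_space_norm[of "u (\<tau> n)" "v (\<tau> n)"] M(2)[of n] by linarith
      moreover have "H1_norm (W0_at n) \<le> M" using M(3) H1_norm_W0_at by simp
      ultimately have "\<bar>(\<integral>x. NL p (u (\<tau> n) x) \<partial>lborel) - (\<integral>x. NL p (W0_at n x) \<partial>lborel)\<bar> \<le> e / 2"
        using \<delta>(2)[rule_format, OF u_H1[OF tau_nonneg] W0_at_H1] elim by blast
      then show ?case using \<open>0 < e\<close> NL_at by (simp add: dist_real_def)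
    qed
  qed
  then have "(\<lambda>n. 1/2 * (energy_space_norm (u (\<tau> n)) (v (\<tau> n)))\<^sup>2 - (\<integral>x. NL p (u (\<tau> n) x) \<partial>lborel))
      \<longlonglongrightarrow> 1/2 * (energy_space_norm W0 W1)\<^sup>2 - (\<integral>x. NL p (W0 x) \<partial>lborel)"
    by (intro tendsto_intros norm_tendsto)
  then show ?thesis
    using energy_eq[OF subcritical u_H1[OF tau_nonneg] v_L2[OF tau_nonneg]] energy_eq[OF subcritical W0_H1 W1_L2]
    by simp
qed

lemma E_lim_le:
  assumes "0 \<le> t"
  shows "E_lim \<le> E t"
proof (rule tendsto_upperbound[OF energy_tendsto])
  show "eventually (\<lambda>n. E (\<tau> n) \<le> E t) sequentially"
    using filterlim_at_top[THEN iffD1, OF tau_at_top, rule_format, of t]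
    by eventually_elim (rule energy_antimono[OF assms])
qed simp

text \<open>Monotonicity upgrades convergence along \<open>\<tau>\<close> to convergence in t, which
  yields the same limit for every cluster point.\<close>

lemma energy_tendsto_at_top: "(E \<longlongrightarrow> E_lim) at_top"
proof (rule tendstoI)
  fix e :: real assume "0 < e"
  then obtain n where n: "E (\<tau> n) < E_lim + e"
    using order_tendstoD(2)[OF energy_tendsto, of "E_lim + e"] eventually_happens'[OF sequentially_bot] by auto
  show "eventually (\<lambda>t. dist (E t) E_lim < e) at_top"
    using eventually_ge_at_top[of "\<tau> n"]
  proof eventually_elim
    case (elim t)
    then have "E t \<le> E (\<tau> n)" by (rule energy_antimono[OF tau_nonneg])
    moreover have "E_lim \<le> E t" using E_lim_le elim tau_nonneg[of n] by simp
    ultimately show ?case using n by (simp add: dist_real_def)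
  qed
qed

text \<open>Monotone convergence as the right end of the time interval in the energy identity goes
  to infinity.\<close>

lemma dissipation_integral:
  assumes "0 \<le> t"
  shows "set_integrable lborel {t..} (\<lambda>s. (L2_norm (v s))\<^sup>2)"
    and "E t - E_lim = 2 * \<alpha> * (LBINT s:{t..}. (L2_norm (v s))\<^sup>2)"
proof -
  let ?f = "\<lambda>s. indicator {t..} s *\<^sub>R (L2_norm (v s))\<^sup>2"
  have eq: "?f s * indicator {..r} s = indicator {t..r} s *\<^sub>R (L2_norm (v s))\<^sup>2" for r s
    by (auto simp: indicator_def)
  have meas: "?f \<in> borel_measurable borel"
    by (intro borel_measurable_continuous_on_indicator continuous_on_power
        continuous_on_subset[OF continuous_on_L2_norm_v]) (use assms in auto)
  have int: "integrable lborel (\<lambda>s. ?f s * indicator {..r} s)" for r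
    unfolding eq using borel_integrable_atLeastAtMost'[OF continuous_on_dissipation[OF assms]]
    by (simp add: set_integrable_def)
  have "((\<lambda>r. (E t - E r) / (2 * \<alpha>)) \<longlongrightarrow> (E t - E_lim) / (2 * \<alpha>)) at_top"
    by (intro tendsto_intros energy_tendsto_at_top) (use alpha_pos in auto)
  moreover have "eventually (\<lambda>r. (E t - E r) / (2 * \<alpha>) = (\<integral>s. ?f s * indicator {..r} s \<partial>lborel)) at_top"
    using eventually_ge_at_top[of t]
  proof eventually_elim
    case (elim r)
    then show ?case
      using energy_identity[OF assms elim] alpha_pos unfolding eq
      by (simp add: set_lebesgue_integral_def field_simps)
  qed
  ultimately have lim: "((\<lambda>r. \<integral>s. ?f s * indicator {..r} s \<partial>lborel) \<longlongrightarrow> (E t - E_lim) / (2 * \<alpha>)) at_top"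
    by (rule Lim_transform_eventually)
  have "has_bochner_integral lborel ?f ((E t - E_lim) / (2 * \<alpha>))"
    by (rule has_bochner_integral_monotone_convergence_at_top[OF _ _ meas int lim]) auto
  then have "integrable lborel ?f" "(\<integral>s. ?f s \<partial>lborel) = (E t - E_lim) / (2 * \<alpha>)"
    by (auto simp: has_bochner_integral_iff)
  then show "set_integrable lborel {t..} (\<lambda>s. (L2_norm (v s))\<^sup>2)"
    "E t - E_lim = 2 * \<alpha> * (LBINT s:{t..}. (L2_norm (v s))\<^sup>2)"
    using alpha_pos by (auto simp: set_integrable_def set_lebesgue_integral_def)
qed

text \<open>Since the dissipation on \<open>[\<tau>\<^sub>n, \<tau>\<^sub>n + 1]\<close> vanishes in the limit, the solution hardly moves in \<open>L\<^sup>2\<close> there.\<close>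

lemma eventually_close:
  assumes "0 < \<delta>"
  shows "eventually (\<lambda>n. \<forall>s\<in>{\<tau> n..\<tau> n + 1}. L2_norm (\<lambda>x. u s x - u (\<tau> n) x) \<le> \<delta>) sequentially"
proof -
  \<comment> \<open>The margin is tuned to the choice \<open>\<eta> = \<delta>\<close> in
    \<open>L2_increment_le\<close>: both summands there are then at most \<delta>/2.\<close>
  have "E_lim < E_lim + 2 * \<alpha> * \<delta>\<^sup>2" using assms alpha_pos by simp
  from order_tendstoD(2)[OF energy_tendsto this] show ?thesis
  proof eventually_elim
    case (elim n)
    show ?case
    proof
      fix s assume s: "s \<in> {\<tau> n..\<tau> n + 1}"
      have "L2_norm (\<lambda>x. u s x - u (\<tau> n) x) \<le> \<delta> * (s - \<tau> n) / 2 + (E (\<tau> n) - E s) / (4 * \<alpha> * \<delta>)"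
        using s assms by (intro L2_increment_le tau_nonneg) auto
      also have "\<dots> \<le> \<delta> * 1 / 2 + (2 * \<alpha> * \<delta>\<^sup>2) / (4 * \<alpha> * \<delta>)"
      proof (intro add_mono divide_right_mono mult_left_mono)
        show "E (\<tau> n) - E s \<le> 2 * \<alpha> * \<delta>\<^sup>2" using elim E_lim_le[of s] s tau_nonneg[of n] by simp
      qed (use s assms alpha_pos in auto)
      also have "\<dots> = \<delta>" using assms alpha_pos by (simp add: field_simps power2_eq_square)
      finally show "L2_norm (\<lambda>x. u s x - u (\<tau> n) x) \<le> \<delta>" .
    qed
  qed
qed

text \<open>Continuity argument: as long as the energy norm is at most \<open>M + 1\<close>, closeness in \<open>L\<^sup>2\<close> controls the potential energy,
  and the decay of the energy then keeps the norm strictly below \<open>M + 1\<close>.\<close>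

lemma eventually_bounded:
  obtains M where "H1_norm W0 \<le> M" "eventually (\<lambda>n. \<forall>s\<in>{\<tau> n..\<tau> n + 1}. H1_norm (u s) \<le> M) sequentially"
proof -
  obtain M where M: "0 \<le> M" "\<And>n. energy_space_norm (u (\<tau> n)) (v (\<tau> n)) \<le> M" "H1_norm W0 \<le> M"
    using norm_bound_at_tau by metis
  let ?K = "\<lambda>s. energy_space_norm (u s) (v s)"
  obtain \<delta> where \<delta>: "0 < \<delta>" "\<forall>w\<in>(H1 :: ('a \<Rightarrow> real) set). \<forall>w'\<in>H1. H1_norm w \<le> M + 1 \<longrightarrow> H1_norm w' \<le> M + 1 \<longrightarrow>
      L2_norm (\<lambda>x. w x - w' x) \<le> \<delta> \<longrightarrow>
      \<bar>(\<integral>x. NL p (w x) \<partial>lborel) - (\<integral>x. NL p (w' x) \<partial>lborel)\<bar> \<le> 1 / 4"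
    using potential_energy_uniformly_continuous[of "1 / 4" "M + 1"] by auto
  have "eventually (\<lambda>n. \<forall>s\<in>{\<tau> n..\<tau> n + 1}. H1_norm (u s) \<le> M + 1) sequentially"
    using eventually_close[OF \<delta>(1)]
  proof eventually_elim
    case (elim n)
    show ?case
    proof
      fix s assume s: "s \<in> {\<tau> n..\<tau> n + 1}"
      have "?K s \<le> M + 1"
      proof (rule ccontr)
        assume "\<not> ?K s \<le> M + 1"
        moreover have "continuous_on {\<tau> n..s} ?K"
          by (rule continuous_on_subset[OF continuous_on_energy_space_norm]) (use tau_nonneg[of n] in auto)
        \<comment> \<open>A time at which the norm is exactly \<open>M + 1\<close>: the modulus
          \<open>\<delta>\<close> for radius \<open>M + 1\<close> still applies, yet the bound
          \<open>M\<close> at \<open>\<tau> n\<close> has been exceeded by a full unit.\<close>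
        ultimately obtain r where r: "\<tau> n \<le> r" "r \<le> s" "?K r = M + 1"
          using IVT'[of ?K "\<tau> n" "M + 1" s] M(2)[of n] s by auto
        have r0: "0 \<le> r" using r(1) tau_nonneg[of n] by linarith
        have "H1_norm (u r) \<le> M + 1" "H1_norm (u (\<tau> n)) \<le> M + 1"
          using H1_norm_le_energy_space_norm[of "u r" "v r"] H1_norm_le_energy_space_norm[of "u (\<tau> n)" "v (\<tau> n)"]
            r(3) M(2)[of n] by linarith+
        moreover have "L2_norm (\<lambda>x. u r x - u (\<tau> n) x) \<le> \<delta>" using elim r s by auto
        ultimately have "\<bar>(\<integral>x. NL p (u r x) \<partial>lborel) - (\<integral>x. NL p (u (\<tau> n) x) \<partial>lborel)\<bar> \<le> 1 / 4"
          using \<delta>(2)[rule_format, OF u_H1[OF r0] u_H1[OF tau_nonneg]] by blast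
        moreover have "E r \<le> E (\<tau> n)" by (rule energy_antimono[OF tau_nonneg r(1)])
        moreover have "(?K (\<tau> n))\<^sup>2 \<le> M\<^sup>2" using M(2)[of n] by (intro power_mono) auto
        \<comment> \<open>Twice the energy inequality: the quadratic part carries the factor 1/2, so
          the potential error 1/4 becomes 1/2, less than the gap 2 M + 1.\<close>
        ultimately have "(M + 1)\<^sup>2 \<le> M\<^sup>2 + 1 / 2"
          using energy_eq[OF subcritical u_H1[OF r0] v_L2[OF r0]]
            energy_eq[OF subcritical u_H1[OF tau_nonneg[of n]] v_L2[OF tau_nonneg[of n]]] unfolding r(3) by linarith
        then show False using M(1) by (simp add: power2_sum)
      qed
      then show "H1_norm (u s) \<le> M + 1"
        using H1_norm_le_energy_space_norm[of "u s" "v s"] by linarith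
    qed
  qed
  then show thesis using that[of "M + 1"] M(3) by simp
qed

text \<open>Over the whole unit interval \<open>u s\<close> is L2-close to the translated profile,
  by way of \<open>u (\<tau> n)\<close>. Translating profile and test function together then removes
  \<open>y n\<close>.\<close>

lemma eventually_residual_close:
  assumes "\<phi> \<in> test_functions" "0 < \<epsilon>"
  shows "eventually (\<lambda>n. \<forall>s\<in>{\<tau> n..\<tau> n + 1}. \<bar>residual p (u s) (\<lambda>x. \<phi> (x - y n)) - residual p W0 \<phi>\<bar> \<le> \<epsilon>) sequentially"
proof -
  obtain M where M: "H1_norm W0 \<le> M" "eventually (\<lambda>n. \<forall>s\<in>{\<tau> n..\<tau> n + 1}. H1_norm (u s) \<le> M) sequentially"
    by (rule eventually_bounded)
  obtain \<delta> where \<delta>: "0 < \<delta>"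
    "\<forall>w\<in>H1. \<forall>w'\<in>H1. \<forall>c. H1_norm w \<le> M \<longrightarrow> H1_norm w' \<le> M \<longrightarrow> L2_norm (\<lambda>x. w x - w' x) \<le> \<delta> \<longrightarrow>
      \<bar>residual p w (\<lambda>x. \<phi> (x + c)) - residual p w' (\<lambda>x. \<phi> (x + c))\<bar> \<le> \<epsilon>"
    using residual_uniformly_continuous[OF subcritical assms, of M] by blast
  have \<delta>2: "0 < \<delta> / 2" using \<delta>(1) by simp
  show ?thesis
    using M(2) eventually_close[OF \<delta>2] eventually_close_at_tau[OF \<delta>2]
  proof eventually_elim
    case (elim n)
    show ?case
    proof
      fix s assume s: "s \<in> {\<tau> n..\<tau> n + 1}"
      have s0: "0 \<le> s" using s tau_nonneg[of n] by simp
      have "L2_norm (\<lambda>x. u s x - W0_at n x) \<le> \<delta>"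
        using L2_norm_diff_triangle[OF u_L2[OF s0] u_L2[OF tau_nonneg[of n]] H1_L2[OF W0_at_H1[of n]]] elim s by force
      moreover have "H1_norm (W0_at n) \<le> M" using M(1) H1_norm_W0_at by simp
      ultimately have "\<bar>residual p (u s) (\<lambda>x. \<phi> (x + (- y n))) - residual p (W0_at n) (\<lambda>x. \<phi> (x + (- y n)))\<bar> \<le> \<epsilon>"
        using \<delta>(2)[rule_format, OF u_H1[OF s0] W0_at_H1] elim s by blast
      moreover have "residual p (W0_at n) (\<lambda>x. \<phi> (x - y n)) = residual p W0 \<phi>"
        using residual_translation[OF W0_H1 assms(1), of p "- y n"] by simp
      ultimately show "\<bar>residual p (u s) (\<lambda>x. \<phi> (x - y n)) - residual p W0 \<phi>\<bar> \<le> \<epsilon>" by simp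
    qed
  qed
qed

text \<open>Write \<open>c = \<integral> W\<^sub>1 \<phi>\<close> and \<open>L\<close> for the residual of \<open>W\<^sub>0\<close>. On \<open>[\<tau>\<^sub>n, \<tau>\<^sub>n + 1]\<close> the pairing of \<open>u - u(\<tau>\<^sub>n)\<close> with the
  translated test function is close to \<open>0\<close>, but also, integrating the equation twice, close to the
  parabola \<open>c \<sigma> - L \<sigma>\<^sup>2 / 2\<close>.\<close>

lemma parabola_small:
  assumes "\<phi> \<in> test_functions" "0 < \<epsilon>" "0 \<le> \<sigma>" "\<sigma> \<le> 1"
  shows "\<bar>(\<integral>x. W1 x * \<phi> x \<partial>lborel) * \<sigma> - residual p W0 \<phi> * \<sigma>\<^sup>2 / 2\<bar> \<le> \<epsilon> * (1 + (2 * \<alpha> + 2) * L2_norm \<phi>)"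
proof -
  let ?c = "\<integral>x. W1 x * \<phi> x \<partial>lborel" and ?L = "residual p W0 \<phi>" and ?f = "L2_norm \<phi>"
  \<comment> \<open>The claim does not mention n, so a single index satisfying all three closeness
    conditions is enough.\<close>
  obtain n where n: "\<forall>s\<in>{\<tau> n..\<tau> n + 1}. L2_norm (\<lambda>x. u s x - u (\<tau> n) x) \<le> \<epsilon>"
      "\<forall>s\<in>{\<tau> n..\<tau> n + 1}. \<bar>residual p (u s) (\<lambda>x. \<phi> (x - y n)) - ?L\<bar> \<le> \<epsilon>"
      "L2_norm (\<lambda>x. v (\<tau> n) x - W1_at n x) \<le> \<epsilon>"
    using eventually_happens'[OF sequentially_bot eventually_conj[OF eventually_close[OF assms(2)]
        eventually_conj[OF eventually_residual_close[OF assms(1,2)] eventually_close_at_tau[OF assms(2)]]]] by blast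
  define a where "a = \<tau> n"
  have a: "0 \<le> a" by (simp add: a_def tau_nonneg)
  define \<psi> where "\<psi> = (\<lambda>x. \<phi> (x - y n))"
  have \<psi>: "\<psi> \<in> test_functions" unfolding \<psi>_def using test_function_translation[OF assms(1), of "- y n"] by simp
  have \<psi>2: "\<psi> \<in> L2" by (rule test_function_L2[OF \<psi>])
  have [measurable]: "\<phi> \<in> borel_measurable borel" "W1 \<in> borel_measurable borel" using assms(1) W1_L2 by auto
  have f: "L2_norm \<psi> = ?f" unfolding \<psi>_def using L2_norm_translation[of \<phi> "- y n"] by simp
  define h where "h s = (\<integral>x. v s x * \<psi> x \<partial>lborel)" for s
  define H where "H s = (\<integral>x. u s x * \<psi> x \<partial>lborel) - (\<integral>x. u a x * \<psi> x \<partial>lborel)" for s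
  define R where "R s = residual p (u s) \<psi>" for s
  have sub: "{a..a + 1} \<subseteq> {0..}" using a by auto
  have H': "(H has_real_derivative h s) (at s within {a..a + 1})" if "s \<in> {a..a + 1}" for s
    unfolding H_def h_def
    using DERIV_subset[OF pairing_has_derivative[OF \<psi>2, of s] sub] that a by (auto intro!: derivative_eq_intros)
  have h': "(h has_real_derivative - 2 * \<alpha> * h s - R s) (at s within {a..a + 1})" if "s \<in> {a..a + 1}" for s
  proof -
    have "(h has_real_derivative - 2 * \<alpha> * h s - R s) (at s within {0..})"
      using solution \<psi> that a unfolding DKG_solution_def h_def R_def residual_def by (auto simp: algebra_simps)
    then show ?thesis using sub by (rule DERIV_subset)
  qed
  have H_small: "\<bar>H s\<bar> \<le> \<epsilon> * ?f" if s: "s \<in> {a..a + 1}" for s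
  proof -
    have L2: "u s \<in> L2" "u a \<in> L2" using u_L2 a s by auto
    have "H s = (\<integral>x. (u s x - u a x) * \<psi> x \<partial>lborel)"
      unfolding H_def using integrable_L2_mult[OF L2(1) \<psi>2] integrable_L2_mult[OF L2(2) \<psi>2]
      by (simp add: left_diff_distrib)
    then have "\<bar>H s\<bar> \<le> L2_norm (\<lambda>x. u s x - u a x) * ?f"
      using L2_Cauchy_Schwarz_real[OF L2_diff[OF L2] \<psi>2] f by simp
    also have "\<dots> \<le> \<epsilon> * ?f" using n(1) s by (intro mult_right_mono) (auto simp: a_def)
    finally show ?thesis .
  qed
  have ha: "\<bar>h a - ?c\<bar> \<le> \<epsilon> * ?f"
  proof -
    have "?c = (\<integral>x. W1_at n x * \<psi> x \<partial>lborel)"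
      unfolding \<psi>_def using integral_lborel_translation[of "\<lambda>x. W1 x * \<phi> x" "- y n"] by simp
    then have "h a - ?c = (\<integral>x. (v a x - W1_at n x) * \<psi> x \<partial>lborel)"
      unfolding h_def using integrable_L2_mult[OF v_L2[OF a] \<psi>2] integrable_L2_mult[OF W1_at_L2[of n] \<psi>2]
      by (simp add: left_diff_distrib)
    then have "\<bar>h a - ?c\<bar> \<le> L2_norm (\<lambda>x. v a x - W1_at n x) * ?f"
      using L2_Cauchy_Schwarz_real[OF L2_diff[OF v_L2[OF a] W1_at_L2[of n]] \<psi>2] f by simp
    also have "\<dots> \<le> \<epsilon> * ?f" using n(3) by (intro mult_right_mono) (auto simp: a_def)
    finally show ?thesis .
  qed
  have Ha: "H a = 0" by (simp add: H_def)
  have first: "\<bar>h s - h a + ?L * (s - a)\<bar> \<le> \<epsilon> + 2 * \<alpha> * (\<epsilon> * ?f)" if s: "s \<in> {a..a + 1}" for s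
  proof -
    \<comment> \<open>First integration: \<open>2 * \<alpha> * H\<close> is an antiderivative of the
      damping term, so the derivative of \<open>?P\<close> is the residual error alone, and
      \<open>H\<close> itself is small.\<close>
    let ?P = "\<lambda>s. h s + 2 * \<alpha> * H s + ?L * (s - a)"
    have "\<bar>?P s - ?P a\<bar> \<le> \<epsilon>"
    proof (rule derivative_within_bound_imp_le[where f = ?P and f' = "\<lambda>x. ?L - R x"])
      show "(?P has_real_derivative ?L - R x) (at x within {a..a + 1})" if "x \<in> {a..a + 1}" for x
        using h'[OF that] H'[OF that] by (auto intro!: derivative_eq_intros)
      show "\<bar>?L - R x\<bar> \<le> \<epsilon>" if "x \<in> {a..a + 1}" for x
        using n(2) that by (simp add: a_def R_def \<psi>_def abs_minus_commute)
    qed (use s in auto)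
    moreover have "\<bar>2 * \<alpha> * H s\<bar> \<le> 2 * \<alpha> * (\<epsilon> * ?f)"
      using H_small[OF s] alpha_pos by (simp add: abs_mult)
    ultimately show ?thesis using Ha by (simp add: abs_le_iff)
  qed
  \<comment> \<open>Second integration: the derivative of \<open>?Q\<close> is the quantity bounded
    in \<open>first\<close>, up to replacing \<open>h a\<close> by its limit
    \<open>?c\<close>.\<close>
  let ?Q = "\<lambda>s. H s - ?c * (s - a) + ?L * (s - a)\<^sup>2 / 2"
  have "\<bar>?Q (a + \<sigma>) - ?Q a\<bar> \<le> \<epsilon> + 2 * \<alpha> * (\<epsilon> * ?f) + \<epsilon> * ?f"
  proof (rule derivative_within_bound_imp_le[where f = ?Q and f' = "\<lambda>x. h x - ?c + ?L * (x - a)"])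
    show "(?Q has_real_derivative h x - ?c + ?L * (x - a)) (at x within {a..a + 1})" if "x \<in> {a..a + 1}" for x
      using H'[OF that] by (auto intro!: derivative_eq_intros)
    show "\<bar>h x - ?c + ?L * (x - a)\<bar> \<le> \<epsilon> + 2 * \<alpha> * (\<epsilon> * ?f) + \<epsilon> * ?f" if "x \<in> {a..a + 1}" for x
      using first[OF that] ha by linarith
  qed (use assms in auto)
  then have "\<bar>H (a + \<sigma>) - (?c * \<sigma> - ?L * \<sigma>\<^sup>2 / 2)\<bar> \<le> \<epsilon> + 2 * \<alpha> * (\<epsilon> * ?f) + \<epsilon> * ?f"
    using Ha by (simp add: algebra_simps)
  moreover have "\<bar>H (a + \<sigma>)\<bar> \<le> \<epsilon> * ?f" using assms by (intro H_small) auto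
  ultimately have "\<bar>?c * \<sigma> - ?L * \<sigma>\<^sup>2 / 2\<bar> \<le> \<epsilon> + 2 * \<alpha> * (\<epsilon> * ?f) + \<epsilon> * ?f + \<epsilon> * ?f" by linarith
  then show ?thesis by (simp add: algebra_simps)
qed

text \<open>The parabola vanishes at \<sigma> = 1 and \<sigma> = 1/2. With c the pairing of
  \<open>W1\<close> and L the residual, this reads c - L/2 = 0 and c/2 - L/8 = 0, which forces c = L
  = 0.\<close>

lemma cluster_point_weakly_stationary:
  assumes "\<phi> \<in> test_functions"
  shows "(\<integral>x. W1 x * \<phi> x \<partial>lborel) = 0" and "residual p W0 \<phi> = 0"
proof -
  have C: "0 \<le> 1 + (2 * \<alpha> + 2) * L2_norm \<phi>" using alpha_pos by simp
  have "(\<integral>x. W1 x * \<phi> x \<partial>lborel) * 1 - residual p W0 \<phi> * 1\<^sup>2 / 2 = 0"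
    by (rule real_eq_0I[OF C]) (rule parabola_small[OF assms], auto)
  moreover have "(\<integral>x. W1 x * \<phi> x \<partial>lborel) * (1 / 2) - residual p W0 \<phi> * (1 / 2)\<^sup>2 / 2 = 0"
    by (rule real_eq_0I[OF C]) (rule parabola_small[OF assms], auto)
  ultimately show "(\<integral>x. W1 x * \<phi> x \<partial>lborel) = 0" "residual p W0 \<phi> = 0"
    by (simp_all add: power2_eq_square)
qed

lemma W1_AE_zero: "AE x in lborel. W1 x = 0"
  by (rule L2_AE_zero_if_weakly_zero[OF W1_L2 cluster_point_weakly_stationary(1)])

lemma W0_bound_state: "bound_state p W0"
  using W0_H1 cluster_point_weakly_stationary(2) by (simp add: bound_state_def residual_def)

lemma E_lim_eq: "E_lim = energy p W0 (\<lambda>x. 0)"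
proof -
  have "L2_norm W1 = L2_norm (\<lambda>x::'a. 0::real)"
    using W1_AE_zero W1_L2 by (intro L2_norm_cong_AE) auto
  then show ?thesis
    using energy_eq[OF subcritical W0_H1 W1_L2] energy_eq[OF subcritical W0_H1 L2_zero]
    by (simp add: energy_space_norm_def)
qed

end

theorem proposition1p2:
  fixes \<alpha> p :: real
    and X :: "'a::euclidean_space solution_class"
    and T :: ereal
    and u v :: "real \<Rightarrow> 'a \<Rightarrow> real"
  assumes "\<alpha> > 0"
    and "2 \<le> DIM('a)" and "DIM('a) \<le> 5"
    and "energy_subcritical DIM('a) p"
    and "DKG_locally_well_posed \<alpha> p X"
    and "DKG_energy_identity \<alpha> p X"
    and "packed_solution \<alpha> p X T u v"
  shows "T = \<infinity> \<and> continuous_in_H1_L2 {0..} u v \<and>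
    bdd_below ((\<lambda>t. energy p (u t) (v t)) ` {0..}) \<and>
    set_integrable lborel {0..} (\<lambda>s. (L2_norm (v s))\<^sup>2) \<and>
    (\<forall>W0 W1 t y. cluster_point T u v W0 W1 t y \<longrightarrow>
       bound_state p W0 \<and> (AE x in lborel. W1 x = 0) \<and>
       (\<forall>t\<ge>0. energy p (u t) (v t) - energy p W0 (\<lambda>x. 0)
          = 2 * \<alpha> * (LBINT s:{t..}. (L2_norm (v s))\<^sup>2)))"
proof -
  have maximal: "DKG_maximal_solution \<alpha> p X T u v"
    using assms(7) by (simp add: packed_solution_def)
  obtain W0 W1 \<tau> y where cluster: "cluster_point T u v W0 W1 \<tau> y"
    using assms(7) by (auto simp: packed_solution_def)
  have T: "T = \<infinity>" by (rule packed_solution_global[OF assms(5) maximal cluster])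
  have sol: "DKG_solution \<alpha> p \<infinity> u v" "u \<in> X \<infinity>"
    using maximal T by (auto simp: DKG_maximal_solution_def)
  interpret global_solution \<alpha> p u v
  proof
    show "energy p (u t2) (v t2) - energy p (u t1) (v t1) = - 2 * \<alpha> * (LBINT t:{t1..t2}. (L2_norm (v t))\<^sup>2)"
      if "0 \<le> t1" "t1 \<le> t2" for t1 t2
      using assms(6) sol that unfolding DKG_energy_identity_def by force
  qed (use assms sol in auto)
  \<comment> \<open>Stated for arbitrary cluster data because it is used twice: for the cluster
    point that packedness provides, and for each cluster point quantified over in the
    conclusion.\<close>
  have clustering: "clustering_solution \<alpha> p u v W0' W1' \<tau>' y'"
    if "cluster_point T u v W0' W1' \<tau>' y'" for W0' W1' \<tau>' y'
    by unfold_locales (use that T in simp)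
  interpret clustering_solution \<alpha> p u v W0 W1 \<tau> y
    by (rule clustering[OF cluster])
  have "bdd_below (E ` {0..})"
    using E_lim_le by (intro bdd_belowI[of _ E_lim]) auto
  moreover have "bound_state p W0' \<and> (AE x in lborel. W1' x = 0) \<and>
      (\<forall>t\<ge>0. E t - energy p W0' (\<lambda>x. 0) = 2 * \<alpha> * (LBINT s:{t..}. (L2_norm (v s))\<^sup>2))"
    if "cluster_point T u v W0' W1' \<tau>' y'" for W0' W1' \<tau>' y'
  proof -
    interpret c: clustering_solution \<alpha> p u v W0' W1' \<tau>' y' by (rule clustering[OF that])
    show ?thesis
      using c.W0_bound_state c.W1_AE_zero c.dissipation_integral(2) c.E_lim_eq by simp
  qed
  ultimately show ?thesis
    using T continuous_in_energy_space dissipation_integral(1)[of 0] by blast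
qed

end
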